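(* Let $\phi=\phi_1\times\phi_2:M=M_1\times_fM_2\to N=N_1\times_\rho N_2$ be a Riemannian warped product map between two Riemannian warped product manifolds, where $\phi_i:M_i\to N_i$ are Riemannian maps. Then $\phi$ is a Clairaut Riemannian warped product map with $r=e^g$, for some smooth function $g$ on $M$, if and only if $\phi_1$ has totally umbilical fibers, $\phi_2$ has totally geodesic fibers, and the mean curvature vector field of (the fibers of) $\phi$ is $-\nabla^M\ln f$.
   Context: Let $(M_i,g_{M_i})$, $(N_i,g_{N_i})$, $i=1,2$, be Riemannian manifolds and $f:M_1\to(0,\infty)$, $\rho:N_1\to(0,\infty)$ smooth. The warped product $M=M_1\times_fM_2$ is $M_1\times M_2$ with metric $g_M=\pi_1^*g_{M_1}+(f\circ\pi_1)^2\pi_2^*g_{M_2}$, where $\pi_i$ are the projections; similarly $N=N_1\times_\rho N_2$. A smooth map $\phi_i:M_i\to N_i$ with $0<\operatorname{rank}\phi_i\le\min\{\dim M_i,\dim N_i\}$ is a Riemannian map if at every point $\phi_{i*}$ restricts to a linear isometry from $(\ker\phi_{i*})^\perp$ onto $\operatorname{range}\phi_{i*}$. If $\phi_1,\phi_2$ are Riemannian maps, $\phi=\phi_1\times\phi_2:M\to N$, $\phi(p_1,p_2)=(\phi_1(p_1),\phi_2(p_2))$, is called a Riemannian warped product map. It is a Clairaut Riemannian warped product map if there is a function $r:M\to(0,\infty)$ such that for every geodesic of $M$, making angle $\theta$ with the horizontal subspaces $(\ker\phi_* )^\perp$, the quantity $r\sin\theta$ is constant along the geodesic. Fibers are the integral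 submanifolds of the vertical distributions $\ker\phi_*$ (resp. $\ker\phi_{i*}$); with $T(U,V)$ the horizontal part of $\nabla_UV$ for vertical $U,V$, fibers are totally geodesic if $T(U,V)=0$ and totally umbilical if $T(U,V)=g(U,V)H$ for all vertical $U,V$, with $H$ the mean curvature vector field of the fibers. $\nabla^M\ln f$ is the gradient of $\ln f$.
   Formalization: The fibers of both maps are assumed to have positive dimension (the kernels of both differentials are nonzero at every point); if one factor is an immersion the "only if" direction fails, e.g. for id × |x| on R × (R²∖{0}) with f = 1. *)

theory Defs
  imports "HOL-Analysis.Analysis"
begin

section \<open>Smoothness in Euclidean spaces\<close>

text \<open>Meant for open \<open>S\<close>: all iterated directional derivatives up to order \<open>k\<close> exist and are
  continuous (in finite dimension this is the usual class of k times continuously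
  differentiable maps).\<close>

primrec Ck_on :: "nat \<Rightarrow> 'a::real_normed_vector set \<Rightarrow> ('a \<Rightarrow> 'b::real_normed_vector) \<Rightarrow> bool" where
  "Ck_on 0 S f \<longleftrightarrow> continuous_on S f"
| "Ck_on (Suc k) S f \<longleftrightarrow>
     (\<forall>x\<in>S. f differentiable (at x)) \<and> (\<forall>v. Ck_on k S (\<lambda>x. frechet_derivative f (at x) v))"

definition smooth_on :: "'a::real_normed_vector set \<Rightarrow> ('a \<Rightarrow> 'b::real_normed_vector) \<Rightarrow> bool" where
  "smooth_on S f \<longleftrightarrow> (\<forall>k. Ck_on k S f)"


section \<open>Smooth manifolds\<close>

text \<open>A manifold lives on a whole topological type. The value of \<open>cmap c\<close> outside \<open>cdom c\<close> is
  irrelevant. The atlas is not required to be maximal. As part of the structure, every point \<open>p\<close>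
  carries a preferred chart \<open>chart_at M p\<close> around it, and the tangent space at \<open>p\<close> is the model
  space \<open>'e\<close>: the vector \<open>v\<close> stands for the tangent vector at \<open>p\<close> whose coordinates in the
  preferred chart are \<open>v\<close>. Its coordinates in another chart are obtained by the derivative
  of the transition map (see \<open>tangent_to_chart\<close> below).\<close>

datatype ('a, 'e) chart = Chart (cdom: "'a set") (cmap: "'a \<Rightarrow> 'e")

definition cinv :: "('a, 'e) chart \<Rightarrow> 'e \<Rightarrow> 'a" where
  "cinv c = inv_into (cdom c) (cmap c)"

record ('a, 'e) manifold =
  atlas :: "('a, 'e) chart set"
  chart_at :: "'a \<Rightarrow> ('a, 'e) chart"

definition smooth_manifold ::
  "('a::{t2_space,second_countable_topology}, 'e::euclidean_space, 'z) manifold_scheme \<Rightarrow> bool" where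
  "smooth_manifold M \<longleftrightarrow>
     (\<forall>c\<in>atlas M. open (cdom c) \<and> open (cmap c ` cdom c) \<and>
        homeomorphism (cdom c) (cmap c ` cdom c) (cmap c) (cinv c)) \<and>
     (\<forall>c\<in>atlas M. \<forall>d\<in>atlas M. smooth_on (cmap c ` (cdom c \<inter> cdom d)) (cmap d \<circ> cinv c)) \<and>
     (\<forall>p. chart_at M p \<in> atlas M \<and> p \<in> cdom (chart_at M p))"

definition product_chart ::
  "('a, 'e) chart \<Rightarrow> ('b, 'f) chart \<Rightarrow> ('a \<times> 'b, 'e \<times> 'f) chart" where
  "product_chart c d = Chart (cdom c \<times> cdom d) (map_prod (cmap c) (cmap d))"

definition product_manifold ::
  "('a, 'e, 'z) manifold_scheme \<Rightarrow> ('b, 'f, 'y) manifold_scheme \<Rightarrow> ('a \<times> 'b, 'e \<times> 'f) manifold" where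
  "product_manifold M1 M2 =
     \<lparr>atlas = {product_chart c d | c d. c \<in> atlas M1 \<and> d \<in> atlas M2},
      chart_at = (\<lambda>p. product_chart (chart_at M1 (fst p)) (chart_at M2 (snd p)))\<rparr>"

definition smooth_map ::
  "('a::topological_space, 'e::euclidean_space, 'z) manifold_scheme \<Rightarrow>
   ('b::topological_space, 'f::euclidean_space, 'y) manifold_scheme \<Rightarrow> ('a \<Rightarrow> 'b) \<Rightarrow> bool" where
  "smooth_map M N \<phi> \<longleftrightarrow> continuous_on UNIV \<phi> \<and>
     (\<forall>c\<in>atlas M. \<forall>d\<in>atlas N.
        smooth_on (cmap c ` (cdom c \<inter> \<phi> -` cdom d)) (cmap d \<circ> \<phi> \<circ> cinv c))"

definition smooth_function ::
  "('a, 'e::euclidean_space, 'z) manifold_scheme \<Rightarrow> ('a \<Rightarrow> real) \<Rightarrow> bool" where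
  "smooth_function M h \<longleftrightarrow> (\<forall>c\<in>atlas M. smooth_on (cmap c ` cdom c) (h \<circ> cinv c))"

definition differential ::
  "('a, 'e::euclidean_space, 'z) manifold_scheme \<Rightarrow> ('b, 'f::euclidean_space, 'y) manifold_scheme \<Rightarrow>
   ('a \<Rightarrow> 'b) \<Rightarrow> 'a \<Rightarrow> 'e \<Rightarrow> 'f" where
  "differential M N \<phi> p =
     frechet_derivative (cmap (chart_at N (\<phi> p)) \<circ> \<phi> \<circ> cinv (chart_at M p))
       (at (cmap (chart_at M p) p))"

text \<open>Coordinates in the chart \<open>c\<close> of a tangent vector at \<open>p\<close>, and the tangent vector at \<open>p\<close>
  with given coordinates in \<open>c\<close>.\<close>

definition tangent_to_chart ::
  "('a, 'e::euclidean_space, 'z) manifold_scheme \<Rightarrow> ('a, 'e) chart \<Rightarrow> 'a \<Rightarrow> 'e \<Rightarrow> 'e" where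
  "tangent_to_chart M c p =
     frechet_derivative (cmap c \<circ> cinv (chart_at M p)) (at (cmap (chart_at M p) p))"

definition chart_to_tangent ::
  "('a, 'e::euclidean_space, 'z) manifold_scheme \<Rightarrow> ('a, 'e) chart \<Rightarrow> 'a \<Rightarrow> 'e \<Rightarrow> 'e" where
  "chart_to_tangent M c p =
     frechet_derivative (cmap (chart_at M p) \<circ> cinv c) (at (cmap c p))"

text \<open>\<open>V\<close> is only relevant on the open set \<open>W\<close>.\<close>

definition smooth_field_on ::
  "('a, 'e::euclidean_space, 'z) manifold_scheme \<Rightarrow> 'a set \<Rightarrow> ('a \<Rightarrow> 'e) \<Rightarrow> bool" where
  "smooth_field_on M W V \<longleftrightarrow>
     (\<forall>c\<in>atlas M. smooth_on (cmap c ` (cdom c \<inter> W))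
        (\<lambda>x. tangent_to_chart M c (cinv c x) (V (cinv c x))))"


section \<open>Riemannian manifolds\<close>

record ('a, 'e) riemannian = "('a, 'e) manifold" +
  metric_tensor :: "'a \<Rightarrow> 'e \<Rightarrow> 'e \<Rightarrow> real"

definition local_metric ::
  "('a, 'e::euclidean_space) riemannian \<Rightarrow> ('a, 'e) chart \<Rightarrow> 'e \<Rightarrow> 'e \<Rightarrow> 'e \<Rightarrow> real" where
  "local_metric M c x u v =
     (let p = cinv c x in
      metric_tensor M p (chart_to_tangent M c p u) (chart_to_tangent M c p v))"

definition riemannian_manifold ::
  "('a::{t2_space,second_countable_topology}, 'e::euclidean_space) riemannian \<Rightarrow> bool" where
  "riemannian_manifold M \<longleftrightarrow> smooth_manifold M \<and>
     (\<forall>p. bilinear (metric_tensor M p)) \<and>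
     (\<forall>p u v. metric_tensor M p u v = metric_tensor M p v u) \<and>
     (\<forall>p u. u \<noteq> 0 \<longrightarrow> metric_tensor M p u u > 0) \<and>
     (\<forall>c\<in>atlas M. \<forall>u v. smooth_on (cmap c ` cdom c) (\<lambda>x. local_metric M c x u v))"

definition tnorm :: "('a, 'e) riemannian \<Rightarrow> 'a \<Rightarrow> 'e \<Rightarrow> real" where
  "tnorm M p v = sqrt (metric_tensor M p v v)"

definition gradient ::
  "('a, 'e::euclidean_space) riemannian \<Rightarrow> ('a \<Rightarrow> real) \<Rightarrow> 'a \<Rightarrow> 'e" where
  "gradient M h p =
     (THE w. \<forall>v. metric_tensor M p w v =
        frechet_derivative (h \<circ> cinv (chart_at M p)) (at (cmap (chart_at M p) p)) v)"

text \<open>The Levi-Civita connection: in the preferred chart at \<open>p\<close>, Koszul's formula for constant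
  coordinate fields gives the bilinear map \<open>christoffel M p\<close> of Christoffel symbols at \<open>p\<close>, and
  the coordinates of the covariant derivative at \<open>p\<close> are \<open>DV(u) + \<Gamma>(u, V)\<close>.\<close>

definition christoffel ::
  "('a, 'e::euclidean_space) riemannian \<Rightarrow> 'a \<Rightarrow> 'e \<Rightarrow> 'e \<Rightarrow> 'e" where
  "christoffel M p u v =
     (let c = chart_at M p;
          Dg = (\<lambda>a b e. frechet_derivative (\<lambda>x. local_metric M c x b e) (at (cmap c p)) a)
      in THE z. \<forall>w. 2 * metric_tensor M p z w = Dg u v w + Dg v u w - Dg w u v)"

definition covariant_derivative ::
  "('a, 'e::euclidean_space) riemannian \<Rightarrow> ('a \<Rightarrow> 'e) \<Rightarrow> ('a \<Rightarrow> 'e) \<Rightarrow> 'a \<Rightarrow> 'e" where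
  "covariant_derivative M U V p =
     (let c = chart_at M p in
      frechet_derivative (\<lambda>x. tangent_to_chart M c (cinv c x) (V (cinv c x))) (at (cmap c p)) (U p)
      + christoffel M p (U p) (V p))"

definition velocity ::
  "('a, 'e::euclidean_space) riemannian \<Rightarrow> (real \<Rightarrow> 'a) \<Rightarrow> real \<Rightarrow> 'e" where
  "velocity M \<gamma> t = vector_derivative (cmap (chart_at M (\<gamma> t)) \<circ> \<gamma>) (at t)"

definition acceleration ::
  "('a, 'e::euclidean_space) riemannian \<Rightarrow> (real \<Rightarrow> 'a) \<Rightarrow> real \<Rightarrow> 'e" where
  "acceleration M \<gamma> t =
     (let c = chart_at M (\<gamma> t) in
      vector_derivative (\<lambda>s. vector_derivative (cmap c \<circ> \<gamma>) (at s)) (at t)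
      + christoffel M (\<gamma> t) (velocity M \<gamma> t) (velocity M \<gamma> t))"

text \<open>Twice continuously differentiable is enough: the geodesic equation then gives smoothness.\<close>

definition geodesic ::
  "('a::topological_space, 'e::euclidean_space) riemannian \<Rightarrow> real set \<Rightarrow> (real \<Rightarrow> 'a) \<Rightarrow> bool" where
  "geodesic M I \<gamma> \<longleftrightarrow> open I \<and> is_interval I \<and> continuous_on I \<gamma> \<and>
     (\<forall>c\<in>atlas M. Ck_on 2 (I \<inter> \<gamma> -` cdom c) (cmap c \<circ> \<gamma>)) \<and>
     (\<forall>t\<in>I. acceleration M \<gamma> t = 0)"

definition warped_product ::
  "('a, 'e::euclidean_space) riemannian \<Rightarrow> ('a \<Rightarrow> real) \<Rightarrow> ('b, 'f::euclidean_space) riemannian \<Rightarrow>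
   ('a \<times> 'b, 'e \<times> 'f) riemannian" where
  "warped_product M1 f M2 =
     (let P = product_manifold M1 M2;
          \<pi>1 = differential P M1 fst;
          \<pi>2 = differential P M2 snd
      in \<lparr>atlas = atlas P, chart_at = chart_at P,
          metric_tensor = (\<lambda>p v w.
            metric_tensor M1 (fst p) (\<pi>1 p v) (\<pi>1 p w)
            + (f (fst p))\<^sup>2 * metric_tensor M2 (snd p) (\<pi>2 p v) (\<pi>2 p w))\<rparr>)"


section \<open>Riemannian maps and the geometry of their fibers\<close>

definition vertical ::
  "('a, 'e::euclidean_space) riemannian \<Rightarrow> ('b, 'f::euclidean_space) riemannian \<Rightarrow>
   ('a \<Rightarrow> 'b) \<Rightarrow> 'a \<Rightarrow> 'e set" where
  "vertical M N \<phi> p = {v. differential M N \<phi> p v = 0}"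

definition horizontal ::
  "('a, 'e::euclidean_space) riemannian \<Rightarrow> ('b, 'f::euclidean_space) riemannian \<Rightarrow>
   ('a \<Rightarrow> 'b) \<Rightarrow> 'a \<Rightarrow> 'e set" where
  "horizontal M N \<phi> p = {x. \<forall>v\<in>vertical M N \<phi> p. metric_tensor M p x v = 0}"

definition hor ::
  "('a, 'e::euclidean_space) riemannian \<Rightarrow> ('b, 'f::euclidean_space) riemannian \<Rightarrow>
   ('a \<Rightarrow> 'b) \<Rightarrow> 'a \<Rightarrow> 'e \<Rightarrow> 'e" where
  "hor M N \<phi> p x = (THE h. h \<in> horizontal M N \<phi> p \<and> x - h \<in> vertical M N \<phi> p)"

definition riemannian_map ::
  "('a::topological_space, 'e::euclidean_space) riemannian \<Rightarrow>
   ('b::topological_space, 'f::euclidean_space) riemannian \<Rightarrow> ('a \<Rightarrow> 'b) \<Rightarrow> bool" where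
  "riemannian_map M N \<phi> \<longleftrightarrow> smooth_map M N \<phi> \<and>
     (\<forall>p. 0 < dim (range (differential M N \<phi> p)) \<and>
          dim (range (differential M N \<phi> p)) \<le> min DIM('e) DIM('f) \<and>
          differential M N \<phi> p ` horizontal M N \<phi> p = range (differential M N \<phi> p) \<and>
          (\<forall>x\<in>horizontal M N \<phi> p. \<forall>y\<in>horizontal M N \<phi> p.
             metric_tensor N (\<phi> p) (differential M N \<phi> p x) (differential M N \<phi> p y)
             = metric_tensor M p x y))"

definition vertical_field_on ::
  "('a, 'e::euclidean_space) riemannian \<Rightarrow> ('b, 'f::euclidean_space) riemannian \<Rightarrow>
   ('a \<Rightarrow> 'b) \<Rightarrow> 'a set \<Rightarrow> ('a \<Rightarrow> 'e) \<Rightarrow> bool" where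
  "vertical_field_on M N \<phi> W V \<longleftrightarrow> smooth_field_on M W V \<and> (\<forall>p\<in>W. V p \<in> vertical M N \<phi> p)"

definition T_tensor ::
  "('a, 'e::euclidean_space) riemannian \<Rightarrow> ('b, 'f::euclidean_space) riemannian \<Rightarrow>
   ('a \<Rightarrow> 'b) \<Rightarrow> ('a \<Rightarrow> 'e) \<Rightarrow> ('a \<Rightarrow> 'e) \<Rightarrow> 'a \<Rightarrow> 'e" where
  "T_tensor M N \<phi> U V p = hor M N \<phi> p (covariant_derivative M U V p)"

text \<open>The trace of T over the vertical space, divided by its dimension. As T is tensorial
  on vertical fields, any vertical fields near \<open>p\<close> that form an orthonormal basis at \<open>p\<close> give the
  same value. If the vertical space is trivial, the value is 0.\<close>

definition mean_curvature ::
  "('a::topological_space, 'e::euclidean_space) riemannian \<Rightarrow> ('b, 'f::euclidean_space) riemannian \<Rightarrow>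
   ('a \<Rightarrow> 'b) \<Rightarrow> 'a \<Rightarrow> 'e" where
  "mean_curvature M N \<phi> p =
     (let m = dim (vertical M N \<phi> p) in
      THE w. \<exists>W E. open W \<and> p \<in> W \<and> (\<forall>i<m. vertical_field_on M N \<phi> W (E i)) \<and>
        (\<forall>i<m. \<forall>j<m. metric_tensor M p (E i p) (E j p) = (if i = j then 1 else 0)) \<and>
        w = (1 / real m) *\<^sub>R (\<Sum>i<m. T_tensor M N \<phi> (E i) (E i) p))"

definition totally_geodesic_fibers ::
  "('a::topological_space, 'e::euclidean_space) riemannian \<Rightarrow> ('b, 'f::euclidean_space) riemannian \<Rightarrow>
   ('a \<Rightarrow> 'b) \<Rightarrow> bool" where
  "totally_geodesic_fibers M N \<phi> \<longleftrightarrow>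
     (\<forall>W U V. open W \<and> vertical_field_on M N \<phi> W U \<and> vertical_field_on M N \<phi> W V \<longrightarrow>
        (\<forall>p\<in>W. T_tensor M N \<phi> U V p = 0))"

definition totally_umbilical_fibers ::
  "('a::topological_space, 'e::euclidean_space) riemannian \<Rightarrow> ('b, 'f::euclidean_space) riemannian \<Rightarrow>
   ('a \<Rightarrow> 'b) \<Rightarrow> bool" where
  "totally_umbilical_fibers M N \<phi> \<longleftrightarrow>
     (\<forall>W U V. open W \<and> vertical_field_on M N \<phi> W U \<and> vertical_field_on M N \<phi> W V \<longrightarrow>
        (\<forall>p\<in>W. T_tensor M N \<phi> U V p = metric_tensor M p (U p) (V p) *\<^sub>R mean_curvature M N \<phi> p))"

text \<open>The angle between a nonzero vector and the horizontal space is its angle with its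
  orthogonal projection, \<open>\<pi>/2\<close> if that projection is 0.\<close>

definition horizontal_angle ::
  "('a, 'e::euclidean_space) riemannian \<Rightarrow> ('b, 'f::euclidean_space) riemannian \<Rightarrow>
   ('a \<Rightarrow> 'b) \<Rightarrow> 'a \<Rightarrow> 'e \<Rightarrow> real" where
  "horizontal_angle M N \<phi> p v = arccos (tnorm M p (hor M N \<phi> p v) / tnorm M p v)"

text \<open>Constant geodesics are excluded, since they make no angle with anything.\<close>

definition clairaut_with ::
  "('a::topological_space, 'e::euclidean_space) riemannian \<Rightarrow> ('b, 'f::euclidean_space) riemannian \<Rightarrow>
   ('a \<Rightarrow> 'b) \<Rightarrow> ('a \<Rightarrow> real) \<Rightarrow> bool" where
  "clairaut_with M N \<phi> r \<longleftrightarrow> (\<forall>p. r p > 0) \<and>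
     (\<forall>I \<gamma>. geodesic M I \<gamma> \<and> (\<forall>t\<in>I. velocity M \<gamma> t \<noteq> 0) \<longrightarrow>
        (\<lambda>t. r (\<gamma> t) * sin (horizontal_angle M N \<phi> (\<gamma> t) (velocity M \<gamma> t))) constant_on I)"

end

theory Submission
  imports Defs
begin

text \<open>By the geodesic equation, \<open>\<phi>\<close> is a Clairaut map with \<open>r = e\<^sup>g\<close> if and only if the vertical energy
  \<open>|v|\<^sup>2\<close> of the velocity \<open>v + h\<close> of every geodesic, multiplied by \<open>e\<^bsup>2g\<^esup>\<close>, is constant. For a single
  Riemannian map write the metric \<open>g\<close> as the sum of \<open>k\<close>, the pullback of the metric of the target, and
  \<open>l\<close>, which vanishes on horizontal vectors. Since \<open>k\<close> and \<open>l\<close> are positive semidefinite, their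
  derivatives vanish on their kernels, and since \<open>k\<close> is a pullback, its Koszul expression vanishes
  if the last argument is vertical. It follows that the derivative of the vertical energy is
  \<open>2 \<langle>T(v, v), h\<rangle>\<close>, and for the warped product it is
  \<open>2 \<langle>T(v, v), h\<rangle> + 2 v(ln f) |h\<^sub>2|\<^sup>2\<close>. As a geodesic starts in every direction, the Clairaut condition
  becomes \<open>|v|\<^sup>2 dg(v + h) + \<langle>T(v, v), h\<rangle> + v(ln f) |h\<^sub>2|\<^sup>2 = 0\<close> for all vertical \<open>v\<close> and
  horizontal \<open>h\<close>. Its even and odd parts in \<open>h\<close>, evaluated on the two factors, say that \<open>ln f\<close> is
  constant along the fibers, that \<open>T\<^sub>1 = - g\<^sub>1 \<nabla> ln f\<close>, and that \<open>T\<^sub>2 = 0\<close>. The trace of \<open>T\<close>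
  recovers these conditions from the mean curvature.\<close>

section \<open>Calculus of k times continuously differentiable maps\<close>

text \<open>Nothing relates \<open>f\<close> to \<open>\<rho> \<circ> \<phi>1\<close>, so the
  product map need not be a Riemannian map, and the horizontal form of the product need not be a
  pullback from the target. It is assembled from those of the factors, with the weight
  \<open>f\<close> squared; differentiating the weight produces the term with
  \<open>v(ln f)\<close>. The other obstacle is the encoding of tangent vectors: the preferred chart
  may jump from point to point, so a field, a form or a velocity is read in one fixed chart before
  it is differentiated, and identities at a point are stated in the chart preferred there. No
  adapted frames are used: vertical fields come from projecting constant fields, and the projection
  is smooth because it solves a linear system with smooth coefficients. The Clairaut condition sees
  \<open>dg\<close> on horizontal vectors only in a product with the square of \<open>|v|\<close>. A
  nonzero vertical vector of the second factor therefore yields \<open>dg = d ln f\<close> on the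
  first, and one of the first factor yields \<open>dg = 0\<close> on the second; a nonzero
  horizontal vector of the second, available since the rank is positive, forces
  \<open>v(ln f) = 0\<close>.\<close>

abbreviation fderiv :: "('a::real_normed_vector \<Rightarrow> 'b::real_normed_vector) \<Rightarrow> 'a \<Rightarrow> 'a \<Rightarrow> 'b" where
  "fderiv f x \<equiv> frechet_derivative f (at x)"

lemma fderiv_eq: "(f has_derivative f') (at x) \<Longrightarrow> fderiv f x = f'"
  using frechet_derivative_at by metis

lemma fderiv_works: "f differentiable (at x) \<Longrightarrow> (f has_derivative fderiv f x) (at x)"
  by (simp add: frechet_derivative_works)

lemma fderiv_cong:
  assumes "open S" "x \<in> S" "\<And>y. y \<in> S \<Longrightarrow> f y = g y"
  shows "fderiv f x = fderiv g x"
proof -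
  have "(f has_derivative h) (at x) \<longleftrightarrow> (g has_derivative h) (at x)" for h
    using assms by (metis has_derivative_transform_within_open)
  then show ?thesis unfolding frechet_derivative_def by simp
qed

lemma differentiable_cong_open:
  assumes "open S" "x \<in> S" "\<And>y. y \<in> S \<Longrightarrow> f y = g y" "f differentiable (at x)"
  shows "g differentiable (at x)"
  using assms unfolding differentiable_def by (metis has_derivative_transform_within_open)

lemma Ck_on_cong:
  assumes "open S" "Ck_on k S f" "\<And>x. x \<in> S \<Longrightarrow> f x = g x"
  shows "Ck_on k S g"
  using assms(2,3)
proof (induction k arbitrary: f g)
  case 0
  then show ?case by (metis Ck_on.simps(1) continuous_on_cong)
next
  case (Suc k)
  have "Ck_on k S (\<lambda>x. fderiv g x v)" for v
  proof (rule Suc.IH)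
    show "Ck_on k S (\<lambda>x. fderiv f x v)" using Suc.prems by simp
    show "fderiv f x v = fderiv g x v" if "x \<in> S" for x
      using fderiv_cong[OF assms(1) that, of f g] Suc.prems(2) by simp
  qed
  moreover have "g differentiable (at x)" if "x \<in> S" for x
    using differentiable_cong_open[OF assms(1) that, of f g] Suc.prems that by simp
  ultimately show ?case by simp
qed

lemma Ck_on_subset: "Ck_on k S f \<Longrightarrow> T \<subseteq> S \<Longrightarrow> Ck_on k T f"
  by (induction k arbitrary: f) (auto intro: continuous_on_subset)

lemma Ck_on_SucD: "Ck_on (Suc k) S f \<Longrightarrow> Ck_on k S f"
proof (induction k arbitrary: f)
  case 0
  then have "\<forall>x\<in>S. isCont f x" by (simp add: differentiable_imp_continuous_within)
  then show ?case by (simp add: continuous_at_imp_continuous_on)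
next
  case (Suc k)
  then show ?case by (metis Ck_on.simps(2))
qed

lemma Ck_on_le: "Ck_on k S f \<Longrightarrow> j \<le> k \<Longrightarrow> Ck_on j S f"
proof (induction k)
  case (Suc k)
  then show ?case by (metis Ck_on_SucD le_Suc_eq)
qed simp

lemma Ck_on_differentiable: "Ck_on (Suc k) S f \<Longrightarrow> x \<in> S \<Longrightarrow> f differentiable (at x)"
  by simp

lemma Ck_on_continuous: "Ck_on k S f \<Longrightarrow> continuous_on S f"
  using Ck_on_le[of k S f 0] by simp

lemma Ck_on_SucI:
  assumes "open S" "\<And>x. x \<in> S \<Longrightarrow> (f has_derivative f' x) (at x)"
    and "\<And>v. Ck_on k S (\<lambda>x. f' x v)"
  shows "Ck_on (Suc k) S f"
proof -
  have "Ck_on k S (\<lambda>x. fderiv f x v)" for v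
    by (rule Ck_on_cong[OF assms(1) assms(3)[of v]]) (simp add: fderiv_eq[OF assms(2)])
  then show ?thesis using assms(2) by (auto simp: differentiable_def)
qed

text \<open>Serves coordinate expressions that are controlled only on the overlap with one chart of
  the target at a time, as in \<open>hloc_Ck\<close>.\<close>

lemma Ck_on_local:
  assumes "\<And>x. x \<in> S \<Longrightarrow> \<exists>T. open T \<and> x \<in> T \<and> Ck_on k T f"
  shows "Ck_on k S f"
  using assms
proof (induction k arbitrary: f)
  case 0
  then have "\<forall>x\<in>S. isCont f x" by (metis Ck_on.simps(1) continuous_on_eq_continuous_at)
  then show ?case by (simp add: continuous_at_imp_continuous_on)
next
  case (Suc k)
  then have "f differentiable (at x)" if "x \<in> S" for x using that by (metis Ck_on.simps(2))
  moreover have "Ck_on k S (\<lambda>x. fderiv f x v)" for v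
    by (rule Suc.IH) (metis Suc.prems Ck_on.simps(2))
  ultimately show ?case by simp
qed

section \<open>Closure properties of the classes \<open>Ck_on\<close>\<close>

lemma Ck_on_const [simp]: "Ck_on k S (\<lambda>x. c)"
  by (induction k arbitrary: c) auto

lemma Ck_on_bounded_linear:
  assumes "open S" "bounded_linear h" "Ck_on k S f"
  shows "Ck_on k S (\<lambda>x. h (f x))"
  using assms(3)
proof (induction k arbitrary: f)
  case 0
  then show ?case using bounded_linear.continuous_on[OF assms(2)] by simp
next
  case (Suc k)
  show ?case
  proof (rule Ck_on_SucI[OF assms(1)])
    show "((\<lambda>x. h (f x)) has_derivative (\<lambda>v. h (fderiv f x v))) (at x)" if "x \<in> S" for x
      using bounded_linear.has_derivative[OF assms(2)] Suc.prems that frechet_derivative_works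
      by (metis Ck_on.simps(2))
    show "Ck_on k S (\<lambda>x. h (fderiv f x v))" for v using Suc by simp
  qed
qed

lemma Ck_on_ident: "open S \<Longrightarrow> Ck_on k S (\<lambda>x. x)"
proof (cases k)
  case (Suc j)
  assume "open S"
  then show ?thesis unfolding Suc
    by (intro Ck_on_SucI[where f' = "\<lambda>x v. v"]) (auto intro: derivative_eq_intros)
qed auto

lemma Ck_on_add:
  assumes "open S" "Ck_on k S f" "Ck_on k S g"
  shows "Ck_on k S (\<lambda>x. f x + g x)"
  using assms(2,3)
proof (induction k arbitrary: f g)
  case 0
  then show ?case by (simp add: continuous_on_add)
next
  case (Suc k)
  show ?case
  proof (rule Ck_on_SucI[OF assms(1)])
    show "((\<lambda>x. f x + g x) has_derivative (\<lambda>v. fderiv f x v + fderiv g x v)) (at x)" if "x \<in> S" for x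
      using has_derivative_add Suc.prems that frechet_derivative_works by (metis Ck_on.simps(2))
    show "Ck_on k S (\<lambda>x. fderiv f x v + fderiv g x v)" for v using Suc by simp
  qed
qed

lemma Ck_on_bilinear:
  assumes "open S" "bounded_bilinear B" "Ck_on k S f" "Ck_on k S g"
  shows "Ck_on k S (\<lambda>x. B (f x) (g x))"
  using assms(3,4)
proof (induction k arbitrary: f g)
  case 0
  then show ?case using bounded_bilinear.continuous_on[OF assms(2)] by simp
next
  case (Suc k)
  show ?case
  proof (rule Ck_on_SucI[OF assms(1)])
    show "((\<lambda>x. B (f x) (g x)) has_derivative (\<lambda>v. B (f x) (fderiv g x v) + B (fderiv f x v) (g x))) (at x)"
      if "x \<in> S" for x
    proof (rule bounded_bilinear.FDERIV[OF assms(2)])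
      show "(f has_derivative fderiv f x) (at x)" "(g has_derivative fderiv g x) (at x)"
        using Suc.prems that by (simp_all add: fderiv_works)
    qed
    have "Ck_on k S f" "Ck_on k S g" using Suc.prems by (blast dest: Ck_on_SucD)+
    then show "Ck_on k S (\<lambda>x. B (f x) (fderiv g x v) + B (fderiv f x v) (g x))" for v
      using Suc.prems by (intro Ck_on_add[OF assms(1)] Suc.IH) simp_all
  qed
qed

lemmas Ck_on_scaleR = Ck_on_bilinear[OF _ bounded_bilinear_scaleR]
lemmas Ck_on_mult = Ck_on_bilinear[OF _ bounded_bilinear_mult]
lemmas Ck_on_inner_left = Ck_on_bounded_linear[OF _ bounded_linear_inner_left]
lemmas Ck_on_fst = Ck_on_bounded_linear[OF _ bounded_linear_fst]
lemmas Ck_on_snd = Ck_on_bounded_linear[OF _ bounded_linear_snd]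

lemma Ck_on_sum:
  assumes "open S" "\<And>i. i \<in> I \<Longrightarrow> Ck_on k S (f i)"
  shows "Ck_on k S (\<lambda>x. \<Sum>i\<in>I. f i x)"
  using assms(2) by (induction I rule: infinite_finite_induct) (auto intro!: Ck_on_add assms(1))

lemma Ck_on_minus: "open S \<Longrightarrow> Ck_on k S f \<Longrightarrow> Ck_on k S (\<lambda>x. - f x)"
  by (rule Ck_on_bounded_linear[where h = uminus]) (auto intro: bounded_linear_minus bounded_linear_ident)

lemma Ck_on_diff:
  "open S \<Longrightarrow> Ck_on k S f \<Longrightarrow> Ck_on k S g \<Longrightarrow> Ck_on k S (\<lambda>x. f x - g x)"
  using Ck_on_add[of S k f "\<lambda>x. - g x"] Ck_on_minus[of S k g] by simp

lemma Ck_on_Pair: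
  assumes "open S" "Ck_on k S f" "Ck_on k S g"
  shows "Ck_on k S (\<lambda>x. (f x, g x))"
proof -
  have "Ck_on k S (\<lambda>x. (f x, 0) + (0, g x))"
    using assms by (intro Ck_on_add Ck_on_bounded_linear[where h = "\<lambda>y. (y, 0)"]
        Ck_on_bounded_linear[where h = "\<lambda>y. (0, y)"])
      (auto intro!: bounded_linear_Pair bounded_linear_zero bounded_linear_ident)
  then show ?thesis by simp
qed

text \<open>\<open>Ck_on\<close> speaks of derivatives in constant directions; expanding the moving
  direction \<open>w x\<close> in the standard basis reduces to these. The separate base point
  \<open>y x\<close> is for the chain rule, where the derivative of the outer map is taken at the
  image point.\<close>

lemma Ck_on_fderiv_vec:
  fixes f :: "'a::euclidean_space \<Rightarrow> 'b::real_normed_vector"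
  assumes "open S" "\<And>v. Ck_on k S (\<lambda>x. fderiv f (y x) v)" "Ck_on k S w"
    and "\<And>x. x \<in> S \<Longrightarrow> f differentiable (at (y x))"
  shows "Ck_on k S (\<lambda>x. fderiv f (y x) (w x))"
proof (rule Ck_on_cong[OF assms(1)])
  show "Ck_on k S (\<lambda>x. \<Sum>b\<in>Basis. (w x \<bullet> b) *\<^sub>R fderiv f (y x) b)"
    using assms by (intro Ck_on_sum Ck_on_scaleR Ck_on_inner_left)
  fix x assume "x \<in> S"
  then have l: "linear (fderiv f (y x))" using assms(4) linear_frechet_derivative by blast
  have "fderiv f (y x) (w x) = fderiv f (y x) (\<Sum>b\<in>Basis. (w x \<bullet> b) *\<^sub>R b)"
    by (simp add: euclidean_representation)
  also have "\<dots> = (\<Sum>b\<in>Basis. (w x \<bullet> b) *\<^sub>R fderiv f (y x) b)"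
    by (simp add: linear_sum[OF l] linear_scale[OF l])
  finally show "(\<Sum>b\<in>Basis. (w x \<bullet> b) *\<^sub>R fderiv f (y x) b) = fderiv f (y x) (w x)" by simp
qed

lemma Ck_on_compose:
  fixes f :: "'a::real_normed_vector \<Rightarrow> 'b::euclidean_space" and g :: "'b \<Rightarrow> 'c::real_normed_vector"
  assumes "open S" "open T" "f ` S \<subseteq> T" "Ck_on k S f" "Ck_on k T g"
  shows "Ck_on k S (\<lambda>x. g (f x))"
  using assms(4,5)
proof (induction k arbitrary: g)
  case 0
  then show ?case using continuous_on_compose2 assms(3) by auto
next
  case (Suc k)
  show ?case
  proof (rule Ck_on_SucI[OF assms(1)])
    show "((\<lambda>x. g (f x)) has_derivative (\<lambda>v. fderiv g (f x) (fderiv f x v))) (at x)" if "x \<in> S" for x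
    proof -
      have "f differentiable (at x)" "g differentiable (at (f x))" using Suc.prems that assms(3) by auto
      then show ?thesis
        using diff_chain_at[of f "fderiv f x" x g "fderiv g (f x)"]
        by (simp add: frechet_derivative_works o_def)
    qed
    show "Ck_on k S (\<lambda>x. fderiv g (f x) (fderiv f x v))" for v
    proof (rule Ck_on_fderiv_vec[OF assms(1)])
      show "Ck_on k S (\<lambda>x. fderiv g (f x) w)" for w
        using Suc.prems Ck_on_SucD[of k S f] by (intro Suc.IH) auto
    qed (use Suc.prems assms(3) in auto)
  qed
qed

lemma Ck_on_inverse: "Ck_on k {x::real. x > 0} inverse"
proof (induction k)
  case 0
  then show ?case by (auto intro!: continuous_intros)
next
  case (Suc k)
  have o: "open {x::real. x > 0}" using open_greaterThan[of "0::real"] by (simp add: greaterThan_def)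
  show ?case
    by (rule Ck_on_SucI[OF o, where f' = "\<lambda>x h. - (inverse x * h * inverse x)"])
      (auto intro!: has_derivative_inverse' Ck_on_minus Ck_on_mult o Suc)
qed

lemma Ck_on_ln: "Ck_on k {x::real. x > 0} ln"
proof (cases k)
  case 0
  then show ?thesis by (auto intro!: continuous_intros)
next
  case (Suc j)
  have o: "open {x::real. x > 0}" using open_greaterThan[of "0::real"] by (simp add: greaterThan_def)
  have d: "(ln has_derivative (\<lambda>h. h * inverse x)) (at x)" if "x > 0" for x :: real
    using has_derivative_ln[OF _ has_derivative_ident, of x UNIV] that by (simp add: divide_inverse)
  show ?thesis unfolding Suc
    by (rule Ck_on_SucI[OF o, where f' = "\<lambda>x h. h * inverse x"])
      (auto intro!: d Ck_on_mult o Ck_on_inverse)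
qed

lemma smooth_onI: "(\<And>k. Ck_on k S f) \<Longrightarrow> smooth_on S f"
  by (simp add: smooth_on_def)

lemma smooth_on_Ck: "smooth_on S f \<Longrightarrow> Ck_on k S f"
  by (simp add: smooth_on_def)

lemma smooth_on_differentiable: "smooth_on S f \<Longrightarrow> x \<in> S \<Longrightarrow> f differentiable (at x)"
  using smooth_on_Ck[of S f 1] by simp

subsection \<open>Symmetry of second derivatives\<close>

text \<open>The mean value theorem is applied first to the increment \<open>G\<close> in direction
  \<open>u\<close>, then to the derivative along \<open>u\<close> in direction \<open>v\<close>. The
  second difference is symmetric in \<open>u\<close> and \<open>v\<close>, which links the two mixed
  derivatives.\<close>

lemma second_difference_mvt:
  fixes f :: "'a::real_normed_vector \<Rightarrow> real"
  assumes "0 < h" "\<And>s t. 0 \<le> s \<Longrightarrow> s \<le> h \<Longrightarrow> 0 \<le> t \<Longrightarrow> t \<le> h \<Longrightarrow> x + s *\<^sub>R u + t *\<^sub>R v \<in> S"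
    and f: "\<And>y. y \<in> S \<Longrightarrow> f differentiable (at y)"
    and f2: "\<And>y. y \<in> S \<Longrightarrow> (\<lambda>y. fderiv f y u) differentiable (at y)"
  obtains s t where "0 \<le> s" "s \<le> h" "0 \<le> t" "t \<le> h"
    "f (x + h *\<^sub>R u + h *\<^sub>R v) - f (x + h *\<^sub>R u) - f (x + h *\<^sub>R v) + f x
      = h * (h * fderiv (\<lambda>y. fderiv f y u) (x + s *\<^sub>R u + t *\<^sub>R v) v)"
proof -
  define G where "G t = f (x + t *\<^sub>R u + h *\<^sub>R v) - f (x + t *\<^sub>R u)" for t
  have lin: "fderiv f y (a *\<^sub>R w) = a * fderiv f y w" if "y \<in> S" for y a w
    using linear_scale[OF linear_frechet_derivative[OF f[OF that]]] by simp
  have lin2: "fderiv (\<lambda>y. fderiv f y u) y (a *\<^sub>R w) = a * fderiv (\<lambda>y. fderiv f y u) y w" if "y \<in> S" for y a w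
    using linear_scale[OF linear_frechet_derivative[OF f2[OF that]]] by simp
  have S0: "x + s *\<^sub>R u \<in> S" if "0 \<le> s" "s \<le> h" for s using assms(1) assms(2)[of s 0] that by simp
  have dG: "(G has_derivative (\<lambda>d. fderiv f (x + s *\<^sub>R u + h *\<^sub>R v) (d *\<^sub>R u) - fderiv f (x + s *\<^sub>R u)
    (d *\<^sub>R u)))
      (at s within {0..h})" if s: "0 \<le> s" "s \<le> h" for s
    unfolding G_def
  proof (rule has_derivative_diff)
    have "((\<lambda>s. x + s *\<^sub>R u + h *\<^sub>R v) has_derivative (\<lambda>d. d *\<^sub>R u)) (at s)"
      by (auto intro!: derivative_eq_intros)
    from diff_chain_at[OF this, of f] f[OF assms(2)[OF s, of h]] assms(1)
    show "((\<lambda>t. f (x + t *\<^sub>R u + h *\<^sub>R v)) has_derivative (\<lambda>d. fderiv f (x + s *\<^sub>R u + h *\<^sub>R v) (d *\<^sub>R u)))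
        (at s within {0..h})"
      by (auto simp: frechet_derivative_works o_def intro: has_derivative_at_withinI)
    have "((\<lambda>s. x + s *\<^sub>R u) has_derivative (\<lambda>d. d *\<^sub>R u)) (at s)"
      by (auto intro!: derivative_eq_intros)
    from diff_chain_at[OF this, of f] f[OF S0[OF s]]
    show "((\<lambda>t. f (x + t *\<^sub>R u)) has_derivative (\<lambda>d. fderiv f (x + s *\<^sub>R u) (d *\<^sub>R u)))
        (at s within {0..h})"
      by (auto simp: frechet_derivative_works o_def intro: has_derivative_at_withinI)
  qed
  obtain s where s: "0 \<le> s" "s \<le> h"
    and e1: "G h - G 0 = fderiv f (x + s *\<^sub>R u + h *\<^sub>R v) (h *\<^sub>R u) - fderiv f (x + s *\<^sub>R u) (h *\<^sub>R u)"
    using mvt_very_simple[of 0 h G, OF _ dG] assms(1) by auto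
  have s': "x + s *\<^sub>R u + h *\<^sub>R v \<in> S" "x + s *\<^sub>R u \<in> S" using assms(1,2) s S0 by auto
  define K where "K t = fderiv f (x + s *\<^sub>R u + t *\<^sub>R v) u" for t
  have dK: "(K has_derivative (\<lambda>d. fderiv (\<lambda>y. fderiv f y u) (x + s *\<^sub>R u + t *\<^sub>R v) (d *\<^sub>R v)))
      (at t within {0..h})" if t: "0 \<le> t" "t \<le> h" for t
  proof -
    have "((\<lambda>t. x + s *\<^sub>R u + t *\<^sub>R v) has_derivative (\<lambda>d. d *\<^sub>R v)) (at t)"
      by (auto intro!: derivative_eq_intros)
    from diff_chain_at[OF this, of "\<lambda>y. fderiv f y u"] f2[OF assms(2)[OF s t]]
    show ?thesis unfolding K_def
      by (auto simp: frechet_derivative_works o_def intro: has_derivative_at_withinI)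
  qed
  obtain t where t: "0 \<le> t" "t \<le> h"
    and e2: "K h - K 0 = fderiv (\<lambda>y. fderiv f y u) (x + s *\<^sub>R u + t *\<^sub>R v) (h *\<^sub>R v)"
    using mvt_very_simple[of 0 h K, OF _ dK] assms(1) by auto
  have "f (x + h *\<^sub>R u + h *\<^sub>R v) - f (x + h *\<^sub>R u) - f (x + h *\<^sub>R v) + f x = G h - G 0"
    by (simp add: G_def)
  also have "\<dots> = h * (K h - K 0)"
    unfolding e1 lin[OF s'(1)] lin[OF s'(2)] K_def by (simp add: algebra_simps)
  also have "\<dots> = h * (h * fderiv (\<lambda>y. fderiv f y u) (x + s *\<^sub>R u + t *\<^sub>R v) v)"
    unfolding e2 by (subst lin2) (use assms(2) s t in auto)
  finally show ?thesis using that[OF s t] by blast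
qed

lemma second_derivative_symmetric_real:
  fixes f :: "'a::real_normed_vector \<Rightarrow> real"
  assumes "open S" "x \<in> S" "Ck_on 2 S f"
  shows "fderiv (\<lambda>y. fderiv f y u) x v = fderiv (\<lambda>y. fderiv f y v) x u"
proof (rule ccontr)
  define A where "A y = fderiv (\<lambda>y. fderiv f y u) y v" for y
  define B where "B y = fderiv (\<lambda>y. fderiv f y v) y u" for y
  assume "\<not> ?thesis"
  \<comment> \<open>Half the distance is the tolerance: a value within it of \<open>A x\<close>
    cannot equal one within it of \<open>B x\<close>.\<close>
  then have e: "dist (A x) (B x) / 2 > 0" (is "?e > 0") by (simp add: A_def B_def)
  have C2: "f differentiable (at y)" "(\<lambda>y. fderiv f y w) differentiable (at y)"
    "continuous_on S (\<lambda>y. fderiv (\<lambda>y. fderiv f y w) y w')" if "y \<in> S" for y w w'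
    using assms(3) that by (auto simp: numeral_2_eq_2)
  have "isCont A x" "isCont B x" unfolding A_def B_def
    using C2(3)[OF assms(2)] assms(1,2) continuous_on_eq_continuous_at by blast+
  then obtain d1 d2 where d: "d1 > 0" "\<And>y. dist y x < d1 \<Longrightarrow> dist (A y) (A x) < ?e"
     "d2 > 0" "\<And>y. dist y x < d2 \<Longrightarrow> dist (B y) (B x) < ?e"
    unfolding continuous_at_eps_delta using e by metis
  obtain d3 where d3: "d3 > 0" "ball x d3 \<subseteq> S" using assms(1,2) open_contains_ball by blast
  define d where "d = min d1 (min d2 d3)"
  have dpos: "d > 0" using d d3 by (simp add: d_def)
  \<comment> \<open>Keeps all points of the parallelogram within \<open>d / 2\<close> of
    \<open>x\<close>; the summand 1 avoids a zero denominator when \<open>u\<close> and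
    \<open>v\<close> vanish.\<close>
  define h where "h = d / 2 / (norm u + norm v + 1)"
  have np: "norm u + norm v + 1 > 0" by (smt (verit) norm_ge_zero)
  then have h: "h > 0" using dpos by (simp add: h_def)
  have near: "dist (x + s *\<^sub>R w + t *\<^sub>R w') x < d"
    if "0 \<le> s" "s \<le> h" "0 \<le> t" "t \<le> h" "norm w + norm w' = norm u + norm v" for s t w w'
  proof -
    have "dist (x + s *\<^sub>R w + t *\<^sub>R w') x \<le> s * norm w + t * norm w'"
      using norm_triangle_ineq[of "s *\<^sub>R w" "t *\<^sub>R w'"] that by (simp add: dist_norm add.assoc)
    also have "\<dots> \<le> h * norm w + h * norm w'" using that by (intro add_mono mult_right_mono) auto
    also have "\<dots> \<le> h * (norm u + norm v + 1)"
      using that h by (simp flip: distrib_left)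
    also have "\<dots> = d / 2" using np nonzero_eq_divide_eq[of "norm u + norm v + 1" h "d / 2"] h_def by linarith
    finally show ?thesis using dpos by simp
  qed
  then have inS: "x + s *\<^sub>R w + t *\<^sub>R w' \<in> S"
    if "0 \<le> s" "s \<le> h" "0 \<le> t" "t \<le> h" "norm w + norm w' = norm u + norm v" for s t w w'
  proof -
    have "x + s *\<^sub>R w + t *\<^sub>R w' \<in> ball x d3"
      using near[OF that] by (simp add: d_def dist_commute)
    then show ?thesis using d3 by blast
  qed
  obtain s t where 1: "0 \<le> s" "s \<le> h" "0 \<le> t" "t \<le> h"
    "f (x + h *\<^sub>R u + h *\<^sub>R v) - f (x + h *\<^sub>R u) - f (x + h *\<^sub>R v) + f x = h * (h * A (x + s *\<^sub>R u + t *\<^sub>R v))"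
    unfolding A_def
    by (rule second_difference_mvt[OF h, of x u v S f]) (use inS[of _ _ u v] C2 in auto)
  obtain s' t' where 2: "0 \<le> s'" "s' \<le> h" "0 \<le> t'" "t' \<le> h"
    "f (x + h *\<^sub>R v + h *\<^sub>R u) - f (x + h *\<^sub>R v) - f (x + h *\<^sub>R u) + f x = h * (h * B (x + s' *\<^sub>R v + t'
      *\<^sub>R u))"
    unfolding B_def
    by (rule second_difference_mvt[OF h, of x v u S f]) (use inS[of _ _ v u] C2 in auto)
  have "h * (h * A (x + s *\<^sub>R u + t *\<^sub>R v))
      = f (x + h *\<^sub>R u + h *\<^sub>R v) - f (x + h *\<^sub>R u) - f (x + h *\<^sub>R v) + f x"
    by (rule 1(5)[symmetric])
  also have "\<dots> = f (x + h *\<^sub>R v + h *\<^sub>R u) - f (x + h *\<^sub>R v) - f (x + h *\<^sub>R u) + f x"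
    by (simp add: add_ac)
  also have "\<dots> = h * (h * B (x + s' *\<^sub>R v + t' *\<^sub>R u))" by (rule 2(5))
  finally have "h * (h * A (x + s *\<^sub>R u + t *\<^sub>R v)) = h * (h * B (x + s' *\<^sub>R v + t' *\<^sub>R u))" .
  then have "A (x + s *\<^sub>R u + t *\<^sub>R v) = B (x + s' *\<^sub>R v + t' *\<^sub>R u)" using h by simp
  moreover have "dist (A (x + s *\<^sub>R u + t *\<^sub>R v)) (A x) < ?e"
    using near[OF 1(1-4)] by (intro d) (simp add: d_def)
  moreover have "dist (B (x + s' *\<^sub>R v + t' *\<^sub>R u)) (B x) < ?e"
    using near[OF 2(1-4), of v u] by (intro d) (simp add: d_def)
  ultimately show False by (simp add: dist_real_def abs_if split: if_splits)
qed

lemma second_derivative_symmetric: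
  fixes f :: "'a::real_normed_vector \<Rightarrow> 'b::euclidean_space"
  assumes "open S" "x \<in> S" "Ck_on 2 S f"
  shows "fderiv (\<lambda>y. fderiv f y u) x v = fderiv (\<lambda>y. fderiv f y v) x u"
proof (rule euclidean_eqI)
  fix b :: 'b assume "b \<in> Basis"
  have C2: "f differentiable (at y)" "(\<lambda>y. fderiv f y w) differentiable (at y)" if "y \<in> S" for y w
    using assms(3) that by (auto simp: numeral_2_eq_2)
  have d1: "fderiv (\<lambda>y. f y \<bullet> b) y w = fderiv f y w \<bullet> b" if "y \<in> S" for y w
    using bounded_linear.has_derivative[OF bounded_linear_inner_left fderiv_works[OF C2(1)[OF that]], of b]
    by (simp add: fderiv_eq[of _ "\<lambda>w. fderiv f y w \<bullet> b"])
  have d2: "fderiv (\<lambda>y. fderiv (\<lambda>y. f y \<bullet> b) y w) x w' = fderiv (\<lambda>y. fderiv f y w) x w' \<bullet> b" for w w'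
  proof -
    have "fderiv (\<lambda>y. fderiv (\<lambda>y. f y \<bullet> b) y w) x = fderiv (\<lambda>y. fderiv f y w \<bullet> b) x"
      by (rule fderiv_cong[OF assms(1,2)]) (rule d1)
    then show ?thesis
      using bounded_linear.has_derivative[OF bounded_linear_inner_left fderiv_works[OF C2(2)[OF
        assms(2), of w]], of b]
      by (simp add: fderiv_eq[of _ "\<lambda>w'. fderiv (\<lambda>y. fderiv f y w) x w' \<bullet> b"])
  qed
  have "Ck_on 2 S (\<lambda>y. f y \<bullet> b)" using assms by (intro Ck_on_inner_left)
  from second_derivative_symmetric_real[OF assms(1,2) this, of u v]
  show "fderiv (\<lambda>y. fderiv f y u) x v \<bullet> b = fderiv (\<lambda>y. fderiv f y v) x u \<bullet> b"
    unfolding d2 .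
qed

section \<open>Local solutions of ordinary differential equations\<close>

text \<open>Picard's argument for a global vector field: the integral operator contracts the
  complete space of bounded continuous functions by the factor \<open>a * L\<close>.\<close>

lemma banach_fix_bounded_continuous:
  fixes F :: "'e::euclidean_space \<Rightarrow> 'e"
  assumes a: "0 < a" "a * L < 1" and L: "0 \<le> L" "\<And>x y. dist (F x) (F y) \<le> L * dist x y"
    and B: "\<And>x. norm (F x) \<le> B"
  obtains X where "X 0 = x0" "continuous_on {-a..a} X"
    "\<And>t. t \<in> {-a..a} \<Longrightarrow> (X has_vector_derivative F (X t)) (at t within {-a..a})"
proof -
  have cF: "continuous_on UNIV F"
    unfolding continuous_on_iff
  proof (intro ballI allI impI)
    fix x and e :: real assume e: "e > 0"
    show "\<exists>d>0. \<forall>x'\<in>UNIV. dist x' x < d \<longrightarrow> dist (F x') (F x) < e"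
    proof (intro exI[of _ "e / (L + 1)"] conjI ballI impI)
      fix x' assume d: "dist x' x < e / (L + 1)"
      have "dist (F x') (F x) \<le> (L + 1) * dist x' x"
        using L(2)[of x' x] by (simp add: algebra_simps add_increasing)
      also have "\<dots> < e" using d L(1) by (simp add: field_simps)
      finally show "dist (F x') (F x) < e" .
    qed (use e L(1) in simp)
  qed
  \<comment> \<open>Integrals start at the left endpoint \<open>-a\<close>; subtracting the one up
    to 0 places the initial value at time 0.\<close>
  define J where "J G t = integral {-a..t} (\<lambda>s. F (G s)) - integral {-a..0} (\<lambda>s. F (G s))" for G ::
    "real \<Rightarrow> 'e" and t
  have cFG: "continuous_on S (\<lambda>s. F (G s))" if "continuous_on S G" for G :: "real \<Rightarrow> 'e" and S
    using continuous_on_compose2[OF cF that] by simp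
  have dJ: "(J G has_vector_derivative F (G t)) (at t within {-a..a})"
    if "continuous_on {-a..a} G" "t \<in> {-a..a}" for G t
  proof -
    have "((\<lambda>t. integral {-a..t} (\<lambda>s. F (G s)) - integral {-a..0} (\<lambda>s. F (G s))) has_vector_derivative F
      (G t) - 0)
      (at t within {-a..a})"
      using integral_has_vector_derivative[OF cFG[OF that(1)] that(2)]
      by (intro has_vector_derivative_diff) auto
    then show ?thesis by (simp add: J_def[abs_def])
  qed
  have J0: "J G 0 = 0" for G by (simp add: J_def)
  have cJ: "continuous_on {-a..a} (J G)" if "continuous_on {-a..a} G" for G
    using dJ[OF that] has_vector_derivative_continuous continuous_on_eq_continuous_within by blast
  have bnd: "norm (J G t - J H t) \<le> a * C"
    if G: "continuous_on {-a..a} G" "continuous_on {-a..a} H" and t: "t \<in> {-a..a}"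
      and C: "\<And>s. s \<in> {-a..a} \<Longrightarrow> norm (F (G s) - F (H s)) \<le> C" for G H t C
  proof -
    have d: "((\<lambda>t. J G t - J H t) has_derivative (\<lambda>h. h *\<^sub>R (F (G s) - F (H s)))) (at s within {-a..a})"
      if "s \<in> {-a..a}" for s
      using has_vector_derivative_diff[OF dJ[OF G(1) that] dJ[OF G(2) that]]
      by (simp add: has_vector_derivative_def)
    have "norm ((J G t - J H t) - (J G 0 - J H 0)) \<le> C * norm (t - 0)"
    proof (rule differentiable_bound[OF _ d])
      show "onorm (\<lambda>h. h *\<^sub>R (F (G s) - F (H s))) \<le> C" if "s \<in> {-a..a}" for s
        using C[OF that] by (intro onorm_le) (simp add: mult.commute[of C] mult_left_mono)
    qed (use t a in auto)
    also have "\<dots> \<le> a * C"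
    proof -
      have "C \<ge> 0" using C[OF t] norm_ge_zero order_trans by blast
      moreover have "norm (t - 0) \<le> a" using t by auto
      ultimately show ?thesis by (simp add: mult.commute mult_left_mono)
    qed
    finally show ?thesis by (simp add: J0)
  qed
  \<comment> \<open>Clamping the time to \<open>{-a..a}\<close> extends the iterate to a bounded
    continuous function on the whole line, where the fixed point theorem applies.\<close>
  define T where "T G = Bcontfun (\<lambda>t. x0 + J (apply_bcontfun G) (clamp (-a) a t))" for G :: "real \<Rightarrow>\<^sub>C 'e"
  have cl: "clamp (-a) a t \<in> {-a..a}" for t
    using clamp_in_interval[where a = "-a" and b = a and x = t] a by (simp add: cbox_interval)
  have clid: "clamp (-a) a t = t" if "t \<in> {-a..a}" for t
    using that clamp_cancel_cbox[where x = t and a = "-a" and b = a] by (simp add: cbox_interval)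
  have cG: "continuous_on S (apply_bcontfun G)" for G :: "real \<Rightarrow>\<^sub>C 'e" and S
    using apply_bcontfun[of G] by (auto simp: bcontfun_def intro: continuous_on_subset)
  have inb: "(\<lambda>t. x0 + J (apply_bcontfun G) (clamp (-a) a t)) \<in> bcontfun" for G :: "real \<Rightarrow>\<^sub>C 'e"
  proof -
    have c: "continuous_on (cbox (-a) a) (\<lambda>t. x0 + J (apply_bcontfun G) t)"
      using cJ[OF cG] by (auto simp: cbox_interval intro!: continuous_intros)
    have "continuous_on UNIV (\<lambda>t. x0 + J (apply_bcontfun G) (clamp (-a) a t))"
      using clamp_continuous_on[OF c] by simp
    moreover have "bounded (range (\<lambda>t. x0 + J (apply_bcontfun G) (clamp (-a) a t)))"
      using clamp_bounded[where a = "-a" and b = a and f = "\<lambda>t. x0 + J (apply_bcontfun G) t"]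
        compact_imp_bounded[OF compact_continuous_image[OF c compact_cbox]] by simp
    ultimately show ?thesis by (simp add: bcontfun_def)
  qed
  have Tapp: "apply_bcontfun (T G) t = x0 + J (apply_bcontfun G) (clamp (-a) a t)" for G t
    unfolding T_def by (simp add: Bcontfun_inverse[OF inb])
  have "\<exists>!G. G \<in> UNIV \<and> T G = G"
  proof (rule Banach_fix[OF complete_UNIV])
    show "0 \<le> a * L" using a L by simp
    show "dist (T G) (T H) \<le> a * L * dist G H" for G H
    proof (rule dist_bound)
      fix t
      have "norm (J (apply_bcontfun G) (clamp (-a) a t) - J (apply_bcontfun H) (clamp (-a) a t)) \<le> a *
        (L * dist G H)"
      proof (rule bnd[OF cG cG cl])
        show "norm (F (G s) - F (H s)) \<le> L * dist G H" for s
          using L(2)[of "G s" "H s"] mult_left_mono[OF dist_bounded[of G s H] L(1)]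
          by (simp add: dist_norm)
      qed
      then show "dist (T G t) (T H t) \<le> a * L * dist G H"
        by (simp add: Tapp dist_norm mult.assoc)
    qed
  qed (use a in auto)
  then obtain G where G: "T G = G" by blast
  define X where "X = apply_bcontfun G"
  have X: "X t = x0 + J X t" if "t \<in> {-a..a}" for t
    using Tapp[of G t] clid[OF that] by (simp add: G X_def)
  show ?thesis
  proof
    show "X 0 = x0" using X[of 0] a J0 by simp
    show "continuous_on {-a..a} X" using cG X_def by simp
    fix t assume t: "t \<in> {-a..a}"
    have "((\<lambda>t. x0 + J X t) has_vector_derivative F (X t)) (at t within {-a..a})"
      using dJ[of X t] cG t by (auto simp: X_def intro!: derivative_eq_intros)
    then show "(X has_vector_derivative F (X t)) (at t within {-a..a})"
      by (rule has_vector_derivative_transform[OF t, rotated]) (rule X)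
  qed
qed

text \<open>The vector field is extended from a ball to a globally Lipschitz bounded one by composing
  with the nearest-point projection.\<close>

theorem local_solution_exists:
  fixes F :: "'e::euclidean_space \<Rightarrow> 'e"
  assumes r: "0 < r" and L: "0 \<le> L"
    "\<And>x y. x \<in> cball x0 r \<Longrightarrow> y \<in> cball x0 r \<Longrightarrow> dist (F x) (F y) \<le> L * dist x y"
  obtains a X where "0 < a" "X 0 = x0" "\<And>t. t \<in> {-a<..<a} \<Longrightarrow> X t \<in> cball x0 r"
    "\<And>t. t \<in> {-a<..<a} \<Longrightarrow> (X has_vector_derivative F (X t)) (at t)"
proof -
  define P where "P = closest_point (cball x0 r)"
  have P: "P x \<in> cball x0 r" for x unfolding P_def using r by (intro closest_point_in_set) auto
  have Pid: "P x = x" if "x \<in> cball x0 r" for x unfolding P_def using that by (rule closest_point_self)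
  have Pl: "dist (P x) (P y) \<le> dist x y" for x y
    unfolding P_def using r by (intro closest_point_lipschitz) auto
  have lip: "dist (F (P x)) (F (P y)) \<le> L * dist x y" for x y
    using L(2)[OF P P, of x y] mult_left_mono[OF Pl[of x y] L(1)] by simp
  have bd: "norm (F (P x)) \<le> norm (F x0) + L * r" for x
  proof -
    have "dist (F (P x)) (F x0) \<le> L * dist (P x) x0" using L(2) P r by simp
    also have "\<dots> \<le> L * r" using P[of x] L(1) by (intro mult_left_mono) (auto simp: dist_commute)
    finally show ?thesis
      using norm_triangle_ineq2[of "F (P x)" "F x0"] by (simp add: dist_norm)
  qed
  \<comment> \<open>With this choice \<open>a * L\<close> stays below 1/2, also for
    \<open>L = 0\<close>.\<close>
  define a where "a = 1 / (2 * (L + 1))"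
  have a: "0 < a" "a * L < 1" using L(1) by (auto simp: a_def field_simps)
  obtain X where X: "X 0 = x0" "continuous_on {-a..a} X"
    "\<And>t. t \<in> {-a..a} \<Longrightarrow> (X has_vector_derivative F (P (X t))) (at t within {-a..a})"
    using banach_fix_bounded_continuous[OF a L(1), of "\<lambda>x. F (P x)" "norm (F x0) + L * r" x0] lip bd by blast
  have "isCont X 0" using X(2) a by (simp add: continuous_on_interior interior_atLeastAtMost_real)
  then obtain d where d: "d > 0" "\<And>t. dist t 0 < d \<Longrightarrow> dist (X t) (X 0) < r"
    unfolding continuous_at_eps_delta using r by metis
  \<comment> \<open>Before time \<open>d\<close> the solution has not left the ball, so the
    projection acts as the identity on it and the extended field is the original one.\<close>
  define b where "b = min a d"
  have inr: "X t \<in> cball x0 r" if "t \<in> {-b<..<b}" for t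
    using d(2)[of t] that X(1) by (auto simp: b_def dist_commute less_imp_le)
  show ?thesis
  proof
    show "0 < b" using a d by (simp add: b_def)
    fix t assume t: "t \<in> {-b<..<b}"
    then have t': "-a < t" "t < a" by (auto simp: b_def)
    then have "(X has_vector_derivative F (P (X t))) (at t)"
      using X(3)[of t] at_within_Icc_at[OF t'] by simp
    then show "(X has_vector_derivative F (X t)) (at t)" using Pid[OF inr[OF t]] by simp
  qed (use X inr in auto)
qed

section \<open>Positive definite forms and fields of bilinear forms\<close>

locale pos_def_form =
  fixes g :: "'e::euclidean_space \<Rightarrow> 'e \<Rightarrow> real"
  assumes bil: "bilinear g" and sym: "g u v = g v u" and pos: "u \<noteq> 0 \<Longrightarrow> g u u > 0"
begin

lemmas simps = bilinear_ladd[OF bil] bilinear_radd[OF bil] bilinear_lsub[OF bil] bilinear_rsub[OF bil]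
  bilinear_lmul[OF bil] bilinear_rmul[OF bil] bilinear_lneg[OF bil] bilinear_rneg[OF bil]
  bilinear_lzero[OF bil] bilinear_rzero[OF bil]

lemma nondegenerate: "(\<And>w. g u w = 0) \<Longrightarrow> u = 0"
  using pos[of u] by (metis less_irrefl)

lemma eqI: "(\<And>w. g u w = g v w) \<Longrightarrow> u = v"
  using nondegenerate[of "u - v"] by (simp add: simps)

lemma nonneg: "g u u \<ge> 0"
  using pos[of u] simps(9) by (cases "u = 0") (auto simp: less_imp_le)

lemma zero_iff: "g u u = 0 \<longleftrightarrow> u = 0"
  using pos[of u] simps(9) by (metis less_irrefl)

text \<open>The map \<open>A\<close> that represents \<open>g\<close> in the ambient inner product
  is injective by nondegeneracy, hence onto in finite dimension. This gives meaning to the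
  descriptions that define gradients and Christoffel symbols.\<close>

lemma riesz:
  assumes "linear c"
  shows "\<exists>!z. \<forall>w. g z w = c w"
proof -
  define A where "A z = (\<Sum>b\<in>Basis. g z b *\<^sub>R b)" for z
  have Ab: "A z \<bullet> b = g z b" if "b \<in> Basis" for z b
    unfolding A_def using that by (simp add: inner_sum_left inner_Basis if_distrib cong: if_cong)
  have Aw: "A z \<bullet> w = g z w" for z w
  proof -
    have "g z w = g z (\<Sum>b\<in>Basis. (w \<bullet> b) *\<^sub>R b)" by (simp add: euclidean_representation)
    also have "\<dots> = (\<Sum>b\<in>Basis. (w \<bullet> b) * g z b)"
      using bil unfolding bilinear_def by (simp add: linear_sum linear_scale)
    also have "\<dots> = (\<Sum>b\<in>Basis. (w \<bullet> b) * (A z \<bullet> b))" by (simp add: Ab)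
    also have "\<dots> = A z \<bullet> w" by (simp add: euclidean_inner[of "A z" w] mult.commute)
    finally show ?thesis by simp
  qed
  have "linear A"
    unfolding A_def by (rule linearI) (simp_all add: simps algebra_simps sum.distrib scaleR_sum_right)
  moreover have "inj A"
    unfolding linear_injective_0[OF \<open>linear A\<close>] using Aw nondegenerate by (metis inner_zero_left)
  ultimately have "surj A" using linear_injective_imp_surjective by blast
  obtain z where z: "A z = (\<Sum>b\<in>Basis. c b *\<^sub>R b)" using \<open>surj A\<close> by (metis surjD)
  have "g z w = c w" for w
  proof -
    have "g z w = (\<Sum>b\<in>Basis. c b *\<^sub>R b) \<bullet> w" using Aw z by metis
    also have "\<dots> = (\<Sum>b\<in>Basis. (w \<bullet> b) *\<^sub>R c b)"
      by (simp add: inner_sum_left inner_commute[of w] mult.commute)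
    also have "\<dots> = c (\<Sum>b\<in>Basis. (w \<bullet> b) *\<^sub>R b)"
      by (simp add: linear_sum[OF assms] linear_scale[OF assms])
    finally show ?thesis by (simp add: euclidean_representation)
  qed
  then show ?thesis using eqI by (intro ex1I[of _ z]) auto
qed

lemma riesz_the:
  assumes "linear c"
  shows "g (THE z. \<forall>w. g z w = c w) w = c w"
  using theI'[OF riesz[OF assms]] by blast

end

lemma bilinear_expand:
  fixes \<beta> :: "'e::euclidean_space \<Rightarrow> 'f::euclidean_space \<Rightarrow> real"
  assumes "bilinear \<beta>"
  shows "\<beta> u v = (\<Sum>i\<in>Basis. \<Sum>j\<in>Basis. (u \<bullet> i) * ((v \<bullet> j) * \<beta> i j))"
proof -
  have "\<beta> u v = \<beta> (\<Sum>i\<in>Basis. (u \<bullet> i) *\<^sub>R i) (\<Sum>j\<in>Basis. (v \<bullet> j) *\<^sub>R j)"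
    by (simp add: euclidean_representation)
  also have "\<dots> = (\<Sum>(i,j)\<in>Basis\<times>Basis. \<beta> ((u \<bullet> i) *\<^sub>R i) ((v \<bullet> j) *\<^sub>R j))"
    by (rule bilinear_sum[OF assms])
  also have "\<dots> = (\<Sum>i\<in>Basis. \<Sum>j\<in>Basis. (u \<bullet> i) * ((v \<bullet> j) * \<beta> i j))"
    by (simp add: sum.cartesian_product bilinear_lmul[OF assms] bilinear_rmul[OF assms] mult_ac)
  finally show ?thesis .
qed

lemma linear_expand:
  fixes c :: "'e::euclidean_space \<Rightarrow> real"
  assumes "linear c"
  shows "c u = (\<Sum>i\<in>Basis. (u \<bullet> i) * c i)"
proof -
  have "c u = c (\<Sum>i\<in>Basis. (u \<bullet> i) *\<^sub>R i)" by (simp add: euclidean_representation)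
  also have "\<dots> = (\<Sum>i\<in>Basis. (u \<bullet> i) * c i)"
    by (simp add: linear_sum[OF assms] linear_scale[OF assms])
  finally show ?thesis .
qed

subsection \<open>Derivatives of fields of bilinear forms\<close>

definition dform :: "('x::real_normed_vector \<Rightarrow> 'e \<Rightarrow> 'f \<Rightarrow> real) \<Rightarrow> 'x \<Rightarrow> 'x \<Rightarrow> 'e \<Rightarrow> 'f \<Rightarrow> real" where
  "dform \<beta> x a u v = fderiv (\<lambda>y. \<beta> y u v) x a"

text \<open>Koszul's formula for constant coordinate fields, for an arbitrary field of forms: it is
  also applied to the degenerate parts of the metric.\<close>

definition koszul :: "('e::real_normed_vector \<Rightarrow> 'e \<Rightarrow> 'e \<Rightarrow> real) \<Rightarrow> 'e \<Rightarrow> 'e \<Rightarrow> 'e \<Rightarrow> 'e \<Rightarrow> real" where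
  "koszul \<beta> x u v w = dform \<beta> x u v w + dform \<beta> x v u w - dform \<beta> x w u v"

text \<open>Neither symmetry nor definiteness is asked for, so that the degenerate parts of a metric
  fit, and so does the derivative of a map paired with a vector
  (\<open>has_derivative_fderiv_apply\<close>).\<close>

locale form_field =
  fixes S :: "'x::real_normed_vector set" and \<beta> :: "'x \<Rightarrow> 'e::euclidean_space \<Rightarrow> 'f::euclidean_space \<Rightarrow> real"
  assumes open_S: "open S" and bilin: "x \<in> S \<Longrightarrow> bilinear (\<beta> x)"
    and diffble: "x \<in> S \<Longrightarrow> (\<lambda>y. \<beta> y u v) differentiable (at x)"
begin

lemma has_deriv: "x \<in> S \<Longrightarrow> ((\<lambda>y. \<beta> y u v) has_derivative (\<lambda>a. dform \<beta> x a u v)) (at x)"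
  unfolding dform_def by (rule fderiv_works[OF diffble])

lemma dform_unique: "x \<in> S \<Longrightarrow> ((\<lambda>y. \<beta> y u v) has_derivative D) (at x) \<Longrightarrow> dform \<beta> x a u v = D a"
  unfolding dform_def by (simp add: fderiv_eq)

lemma dform_unique_cong:
  assumes "x \<in> S" "\<And>y. y \<in> S \<Longrightarrow> \<beta> y u v = h y" "(h has_derivative D) (at x)"
  shows "dform \<beta> x a u v = D a"
  by (rule dform_unique[OF assms(1)], rule has_derivative_transform_within_open[OF assms(3) open_S assms(1)])
    (simp add: assms(2))

lemma dform_add_l: "x \<in> S \<Longrightarrow> dform \<beta> x a (u + u') v = dform \<beta> x a u v + dform \<beta> x a u' v"
  by (rule dform_unique_cong[where D = "\<lambda>a. dform \<beta> x a u v + dform \<beta> x a u' v"])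
    (auto intro!: has_derivative_add has_deriv simp: bilinear_ladd[OF bilin])

lemma dform_add_r: "x \<in> S \<Longrightarrow> dform \<beta> x a u (v + v') = dform \<beta> x a u v + dform \<beta> x a u v'"
  by (rule dform_unique_cong[where D = "\<lambda>a. dform \<beta> x a u v + dform \<beta> x a u v'"])
    (auto intro!: has_derivative_add has_deriv simp: bilinear_radd[OF bilin])

lemma dform_scale_l: "x \<in> S \<Longrightarrow> dform \<beta> x a (r *\<^sub>R u) v = r * dform \<beta> x a u v"
  by (rule dform_unique_cong[where D = "\<lambda>a. r * dform \<beta> x a u v"])
    (auto intro!: has_derivative_mult_right has_deriv simp: bilinear_lmul[OF bilin])

lemma dform_scale_r: "x \<in> S \<Longrightarrow> dform \<beta> x a u (r *\<^sub>R v) = r * dform \<beta> x a u v"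
  by (rule dform_unique_cong[where D = "\<lambda>a. r * dform \<beta> x a u v"])
    (auto intro!: has_derivative_mult_right has_deriv simp: bilinear_rmul[OF bilin])

lemma linear_dform: "x \<in> S \<Longrightarrow> linear (\<lambda>a. dform \<beta> x a u v)"
  using has_deriv has_derivative_linear by blast

lemma dform_add: "x \<in> S \<Longrightarrow> dform \<beta> x (a + b) u v = dform \<beta> x a u v + dform \<beta> x b u v"
  using linear_add[OF linear_dform] .

lemma dform_scale: "x \<in> S \<Longrightarrow> dform \<beta> x (r *\<^sub>R a) u v = r * dform \<beta> x a u v"
  using linear_scale[OF linear_dform] by force

lemmas dform_simps = dform_add_l dform_add_r dform_scale_l dform_scale_r dform_add dform_scale

lemma bilinear_dform: "x \<in> S \<Longrightarrow> bilinear (dform \<beta> x a)"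
  unfolding bilinear_def by (auto intro!: linearI simp: dform_simps)

text \<open>Differentiability is known only for fixed vectors, so both arguments are expanded in the
  standard basis before the product rule is applied.\<close>

lemma has_derivative_form:
  assumes X: "(X has_derivative X') (at s)" and U: "(U has_derivative U') (at s)"
    and V: "(V has_derivative V') (at s)" and s: "X s \<in> S"
  shows "((\<lambda>s. \<beta> (X s) (U s) (V s)) has_derivative
    (\<lambda>h. dform \<beta> (X s) (X' h) (U s) (V s) + \<beta> (X s) (U' h) (V s) + \<beta> (X s) (U s) (V' h))) (at s)"
proof -
  have bX: "((\<lambda>s. \<beta> (X s) i j) has_derivative (\<lambda>h. dform \<beta> (X s) (X' h) i j)) (at s)" for i j
    using diff_chain_at[OF X has_deriv[OF s]] by (simp add: o_def)
  have "isCont X s" using X has_derivative_continuous by blast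
  from topological_tendstoD[OF isContD[OF this] open_S s] have "\<forall>\<^sub>F y in at s. X y \<in> S" .
  then have ev: "\<forall>\<^sub>F y in at s. (\<Sum>i\<in>Basis. \<Sum>j\<in>Basis. (U y \<bullet> i) * ((V y \<bullet> j) * \<beta> (X y) i j)) = \<beta> (X y) (U
    y) (V y)"
    by eventually_elim (rule bilinear_expand[OF bilin, symmetric])
  have Ui: "((\<lambda>s. U s \<bullet> i) has_derivative (\<lambda>h. U' h \<bullet> i)) (at s)" for i
    using bounded_linear.has_derivative[OF bounded_linear_inner_left U] .
  have Vj: "((\<lambda>s. V s \<bullet> j) has_derivative (\<lambda>h. V' h \<bullet> j)) (at s)" for j
    using bounded_linear.has_derivative[OF bounded_linear_inner_left V] .
  have "((\<lambda>y. \<Sum>i\<in>Basis. \<Sum>j\<in>Basis. (U y \<bullet> i) * ((V y \<bullet> j) * \<beta> (X y) i j)) has_derivative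
    (\<lambda>h. \<Sum>i\<in>Basis. \<Sum>j\<in>Basis. (U s \<bullet> i) * ((V s \<bullet> j) * dform \<beta> (X s) (X' h) i j + (V' h \<bullet> j) * \<beta> (X s) i j)
       + (U' h \<bullet> i) * ((V s \<bullet> j) * \<beta> (X s) i j))) (at s)"
    by (intro has_derivative_sum has_derivative_mult Ui Vj bX)
  moreover have "(\<Sum>i\<in>Basis. \<Sum>j\<in>Basis. (U s \<bullet> i) * ((V s \<bullet> j) * dform \<beta> (X s) (X' h) i j + (V' h \<bullet> j) * \<beta>
    (X s) i j)
       + (U' h \<bullet> i) * ((V s \<bullet> j) * \<beta> (X s) i j)) =
      dform \<beta> (X s) (X' h) (U s) (V s) + \<beta> (X s) (U' h) (V s) + \<beta> (X s) (U s) (V' h)" for h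
    unfolding bilinear_expand[OF bilinear_dform[OF s], of _ "U s" "V s"]
      bilinear_expand[OF bilin[OF s], of "U' h" "V s"] bilinear_expand[OF bilin[OF s], of "U s" "V' h"]
    unfolding sum.distrib[symmetric] by (intro sum.cong refl) (simp add: algebra_simps)
  ultimately have "((\<lambda>y. \<Sum>i\<in>Basis. \<Sum>j\<in>Basis. (U y \<bullet> i) * ((V y \<bullet> j) * \<beta> (X y) i j)) has_derivative
    (\<lambda>h. dform \<beta> (X s) (X' h) (U s) (V s) + \<beta> (X s) (U' h) (V s) + \<beta> (X s) (U s) (V' h))) (at s)"
    by simp
  then show ?thesis
    by (rule has_derivative_transform_eventually[OF _ ev])
      (simp_all add: bilinear_expand[OF bilin[OF s], of "U s" "V s"])
qed

end

lemma dform_cong: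
  assumes "open S" "x \<in> S" "\<And>y. y \<in> S \<Longrightarrow> \<beta> y u v = \<gamma> y u v"
  shows "dform \<beta> x a u v = dform \<gamma> x a u v"
  unfolding dform_def using fderiv_cong[OF assms(1,2), of "\<lambda>y. \<beta> y u v" "\<lambda>y. \<gamma> y u v"] assms(3) by simp

lemma dform_commute:
  assumes "\<And>y u v. y \<in> S \<Longrightarrow> \<beta> y u v = \<beta> y v u" "open S" "x \<in> S"
  shows "dform \<beta> x a u v = dform \<beta> x a v u"
  unfolding dform_def using fderiv_cong[OF assms(2,3), of "\<lambda>y. \<beta> y u v" "\<lambda>y. \<beta> y v u"] assms(1) by simp

lemma koszul_linear:
  assumes "form_field S \<beta>" "x \<in> S"
  shows "linear (\<lambda>w. koszul \<beta> x u v w)"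
proof -
  interpret form_field S \<beta> by fact
  show ?thesis unfolding koszul_def
    by (rule linearI) (simp_all add: dform_simps[OF assms(2)] algebra_simps)
qed

text \<open>Differentiating the pullback brings in six terms with second derivatives of
  \<open>\<tau>\<close>; as these derivatives are symmetric, four terms cancel and the other two
  agree. For a transition map this is the transformation law of Christoffel symbols; for the
  coordinate expression of a Riemannian map it controls the horizontal form.\<close>

lemma
  fixes \<beta> :: "'f::euclidean_space \<Rightarrow> 'f \<Rightarrow> 'f \<Rightarrow> real" and \<tau> :: "'e::euclidean_space \<Rightarrow> 'f"
  assumes \<beta>: "form_field T \<beta>" "\<And>y u v. y \<in> T \<Longrightarrow> \<beta> y u v = \<beta> y v u"
    and \<tau>: "open S" "Ck_on 2 S \<tau>" "\<tau> ` S \<subseteq> T"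
    and \<alpha>: "\<And>y u v. y \<in> S \<Longrightarrow> \<alpha> y u v = \<beta> (\<tau> y) (fderiv \<tau> y u) (fderiv \<tau> y v)"
  shows form_field_pullback: "form_field S \<alpha>"
    and koszul_pullback: "x \<in> S \<Longrightarrow> koszul \<alpha> x u v w = koszul \<beta> (\<tau> x) (fderiv \<tau> x u) (fderiv \<tau> x v) (fderiv \<tau> x w)
       + 2 * \<beta> (\<tau> x) (fderiv (\<lambda>y. fderiv \<tau> y v) x u) (fderiv \<tau> x w)"
proof -
  interpret B: form_field T \<beta> by fact
  have \<tau>1: "\<tau> differentiable (at y)" "(\<lambda>y. fderiv \<tau> y v) differentiable (at y)" if "y \<in> S" for y v
    using \<tau>(2) that by (auto simp: numeral_2_eq_2)
  have lin: "linear (fderiv \<tau> y)" if "y \<in> S" for y using linear_frechet_derivative[OF \<tau>1(1)[OF that]] .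
  have hd: "((\<lambda>y. \<alpha> y u v) has_derivative (\<lambda>a. dform \<beta> (\<tau> y) (fderiv \<tau> y a) (fderiv \<tau> y u) (fderiv \<tau> y v)
       + \<beta> (\<tau> y) (fderiv (\<lambda>y. fderiv \<tau> y u) y a) (fderiv \<tau> y v)
       + \<beta> (\<tau> y) (fderiv \<tau> y u) (fderiv (\<lambda>y. fderiv \<tau> y v) y a))) (at y)" if y: "y \<in> S" for y u v
    by (rule has_derivative_transform_within_open[OF B.has_derivative_form[OF
          fderiv_works[OF \<tau>1(1)[OF y]] fderiv_works[OF \<tau>1(2)[OF y, of u]]
          fderiv_works[OF \<tau>1(2)[OF y, of v]]] \<tau>(1) y])
      (use y \<tau>(3) \<alpha> in auto)
  show A: "form_field S \<alpha>"
  proof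
    show "bilinear (\<alpha> y)" if "y \<in> S" for y
    proof -
      have "\<tau> y \<in> T" using that \<tau>(3) by blast
      note b = bilinear_ladd[OF B.bilin[OF this]] bilinear_radd[OF B.bilin[OF this]]
        bilinear_lmul[OF B.bilin[OF this]] bilinear_rmul[OF B.bilin[OF this]]
      show ?thesis
        unfolding bilinear_def using that
        by (auto intro!: linearI simp: \<alpha> linear_add[OF lin] linear_scale[OF lin] b)
    qed
    show "(\<lambda>y. \<alpha> y u v) differentiable (at y)" if "y \<in> S" for y u v
      using hd[OF that] unfolding differentiable_def by blast
  qed (rule \<tau>(1))
  interpret A: form_field S \<alpha> by (rule A)
  assume x: "x \<in> S"
  have d: "dform \<alpha> x a u v = dform \<beta> (\<tau> x) (fderiv \<tau> x a) (fderiv \<tau> x u) (fderiv \<tau> x v)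
       + \<beta> (\<tau> x) (fderiv (\<lambda>y. fderiv \<tau> y u) x a) (fderiv \<tau> x v)
       + \<beta> (\<tau> x) (fderiv \<tau> x u) (fderiv (\<lambda>y. fderiv \<tau> y v) x a)" for a u v
    by (rule A.dform_unique[OF x hd[OF x]])
  have Tx: "\<tau> x \<in> T" using x \<tau>(3) by blast
  show "koszul \<alpha> x u v w = koszul \<beta> (\<tau> x) (fderiv \<tau> x u) (fderiv \<tau> x v) (fderiv \<tau> x w)
       + 2 * \<beta> (\<tau> x) (fderiv (\<lambda>y. fderiv \<tau> y v) x u) (fderiv \<tau> x w)"
    unfolding koszul_def d
      second_derivative_symmetric[OF \<tau>(1) x \<tau>(2), of u v]
      second_derivative_symmetric[OF \<tau>(1) x \<tau>(2), of w u]
      second_derivative_symmetric[OF \<tau>(1) x \<tau>(2), of w v]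
      \<beta>(2)[OF Tx, of "fderiv \<tau> x v"] by simp
qed

subsection \<open>Smooth dependence of solutions of linear systems\<close>

text \<open>Where \<open>h\<close> vanishes, the term with the derivative of \<open>f\<close> drops
  out of the product rule and continuity of \<open>f\<close> suffices. This is the passage from
  continuity to differentiability of solutions.\<close>

lemma has_derivative_mult_vanishing:
  fixes f h :: "'x::real_normed_vector \<Rightarrow> real"
  assumes f: "isCont f p" and h: "(h has_derivative h') (at p)" and h0: "h p = 0"
  shows "((\<lambda>x. f x * h x) has_derivative (\<lambda>v. f p * h' v)) (at p)"
proof -
  have bl: "bounded_linear h'" using h has_derivative_bounded_linear by blast
  obtain K where K: "K > 0" "\<And>v. norm (h' v) \<le> norm v * K"
    using bounded_linear.pos_bounded[OF bl] by blast
  obtain d1 where d1: "d1 > 0" "\<And>y. norm (y - p) < d1 \<Longrightarrow> norm (h y - h' (y - p)) \<le> norm (y - p)"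
    using h[unfolded has_derivative_at_alt] h0 by (metis diff_zero mult_1 zero_less_one)
  have hb: "\<bar>h y\<bar> \<le> norm (y - p) * (K + 1)" if "norm (y - p) < d1" for y
    using d1(2)[OF that] K(2)[of "y - p"] by (simp add: algebra_simps)
  have 0: "((\<lambda>x. (f x - f p) * h x) has_derivative (\<lambda>v. 0)) (at p)"
    unfolding has_derivative_at_alt
  proof (intro conjI allI impI)
    fix e :: real assume e: "e > 0"
    obtain d2 where d2: "d2 > 0" "\<And>y. dist y p < d2 \<Longrightarrow> dist (f y) (f p) < e / (K + 1)"
      using f[unfolded continuous_at_eps_delta] e K by (metis add_pos_pos divide_pos_pos zero_less_one)
    have "norm ((f y - f p) * h y) \<le> e * norm (y - p)" if y: "norm (y - p) < min d1 d2" for y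
    proof -
      have "\<bar>f y - f p\<bar> * \<bar>h y\<bar> \<le> e / (K + 1) * (norm (y - p) * (K + 1))"
        using d2(2)[of y] y hb[of y] K e by (intro mult_mono) (auto simp: dist_norm)
      also have "\<dots> = e * norm (y - p)" using K by simp
      finally show ?thesis by (simp add: abs_mult)
    qed
    then show "\<exists>d>0. \<forall>y. norm (y - p) < d \<longrightarrow> norm ((f y - f p) * h y - (f p - f p) * h p - 0) \<le> e * norm (y - p)"
      using d1(1) d2(1) by (intro exI[of _ "min d1 d2"]) auto
  qed simp
  have "((\<lambda>x. f p * h x + (f x - f p) * h x) has_derivative (\<lambda>v. f p * h' v + 0)) (at p)"
    by (intro has_derivative_add 0 has_derivative_mult_right h)
  then show ?thesis by (simp add: algebra_simps)
qed

lemma (in pos_def_form) coercive: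
  obtains m where "m > 0" "\<And>u. m * (norm u)\<^sup>2 \<le> g u u"
proof -
  have "continuous_on (sphere 0 1) (\<lambda>u. \<Sum>i\<in>Basis. \<Sum>j\<in>Basis. (u \<bullet> i) * ((u \<bullet> j) * g i j))"
    by (intro continuous_intros)
  then have c: "continuous_on (sphere 0 1) (\<lambda>u. g u u)"
    by (rule continuous_on_eq) (rule bilinear_expand[OF bil, symmetric])
  have "sphere (0::'e) 1 \<noteq> {}" by simp
  then obtain u0 where u0: "u0 \<in> sphere 0 1" "\<And>u. u \<in> sphere 0 1 \<Longrightarrow> g u0 u0 \<le> g u u"
    using continuous_attains_inf[OF compact_sphere _ c] by blast
  show ?thesis
  proof
    have "u0 \<noteq> 0" using u0(1) by auto
    then show "g u0 u0 > 0" by (rule pos)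
    show "g u0 u0 * (norm u)\<^sup>2 \<le> g u u" for u
    proof (cases "u = 0")
      case False
      have "g u0 u0 \<le> g (u /\<^sub>R norm u) (u /\<^sub>R norm u)" using u0(2) False by simp
      also have "\<dots> = g u u / (norm u)\<^sup>2" by (simp add: simps power2_eq_square field_simps)
      finally show ?thesis using False by (simp add: field_simps)
    qed (simp add: simps)
  qed
qed

text \<open>Subtract the systems at \<open>x\<close> and \<open>p\<close> and test with the
  difference \<open>d\<close> of the solutions: coercivity at \<open>p\<close> bounds
  \<open>d\<close> by the change of the coefficients.\<close>

lemma solution_continuous:
  fixes \<beta> :: "'x::real_normed_vector \<Rightarrow> 'e::euclidean_space \<Rightarrow> 'e \<Rightarrow> real"
  assumes "open S" "p \<in> S" and pd: "\<And>x. x \<in> S \<Longrightarrow> pos_def_form (\<beta> x)"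
    and \<beta>: "\<And>u v. continuous_on S (\<lambda>x. \<beta> x u v)" and c: "\<And>w. continuous_on S (\<lambda>x. c x w)"
    and eq: "\<And>x w. x \<in> S \<Longrightarrow> \<beta> x (z x) w = c x w"
  shows "isCont z p"
proof -
  interpret p: pos_def_form "\<beta> p" using pd assms(2) .
  obtain m where m: "m > 0" "\<And>u. m * (norm u)\<^sup>2 \<le> \<beta> p u u" by (rule p.coercive) (rule that)
  \<comment> \<open>\<open>E\<close> and \<open>C\<close> bound, entry by entry, the change of the
    form and of the right-hand side.\<close>
  define E where "E x = (\<Sum>i\<in>Basis. \<Sum>j\<in>Basis. \<bar>\<beta> x i j - \<beta> p i j\<bar>)" for x
  define C where "C x = (\<Sum>i\<in>Basis. \<bar>c x i - c p i\<bar>)" for x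
  have ic: "isCont (\<lambda>x. \<beta> x u v) p" "isCont (\<lambda>x. c x w) p" for u v w
    using \<beta> c assms(1,2) continuous_on_eq_continuous_at by blast+
  have Elim: "(E \<longlongrightarrow> 0) (at p)"
    using isContD[of p E] ic unfolding E_def by (simp add: continuous_intros)
  have Clim: "(C \<longlongrightarrow> 0) (at p)"
    using isContD[of p C] ic unfolding C_def by (simp add: continuous_intros)
  have E: "\<bar>\<beta> x u v - \<beta> p u v\<bar> \<le> E x * norm u * norm v" if x: "x \<in> S" for x u v
  proof -
    interpret x: pos_def_form "\<beta> x" using pd x .
    have "\<beta> x u v - \<beta> p u v = (\<Sum>i\<in>Basis. \<Sum>j\<in>Basis. (u \<bullet> i) * ((v \<bullet> j) * (\<beta> x i j - \<beta> p i j)))"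
      unfolding bilinear_expand[OF x.bil, of u v] bilinear_expand[OF p.bil, of u v]
      by (simp add: algebra_simps sum_subtractf)
    also have "\<bar>\<dots>\<bar> \<le> (\<Sum>i\<in>Basis. \<Sum>j\<in>Basis. norm u * (norm v * \<bar>\<beta> x i j - \<beta> p i j\<bar>))"
      by (intro order_trans[OF sum_abs] sum_mono)
        (auto simp: abs_mult Basis_le_norm intro!: mult_mono)
    also have "\<dots> = E x * norm u * norm v"
      by (simp add: E_def sum_distrib_left sum_distrib_right mult_ac)
    finally show ?thesis .
  qed
  have C: "\<bar>c x u - c p u\<bar> \<le> C x * norm u" if x: "x \<in> S" for x u
  proof -
    interpret x: pos_def_form "\<beta> x" using pd x .
    have "linear (c y)" if "y \<in> S" for y
    proof -
      have "bilinear (\<beta> y)" using pd[OF that] by (simp add: pos_def_form_def)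
      then have "linear (\<beta> y (z y))" by (simp add: bilinear_def)
      then show ?thesis using eq[OF that] by (simp add: linear_iff)
    qed
    then have "c x u - c p u = (\<Sum>i\<in>Basis. (u \<bullet> i) * (c x i - c p i))"
      using linear_expand[of "c x" u] linear_expand[of "c p" u] x assms(2)
      by (simp add: algebra_simps sum_subtractf)
    also have "\<bar>\<dots>\<bar> \<le> (\<Sum>i\<in>Basis. norm u * \<bar>c x i - c p i\<bar>)"
      by (intro order_trans[OF sum_abs] sum_mono) (auto simp: abs_mult Basis_le_norm intro!: mult_mono)
    also have "\<dots> = C x * norm u" by (simp add: C_def sum_distrib_left sum_distrib_right mult_ac)
    finally show ?thesis .
  qed
  have "\<forall>\<^sub>F x in at p. x \<in> S"
    using assms(1,2) eventually_at_in_open' by blast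
  \<comment> \<open>Below \<open>m / 2\<close> the perturbation of the form is absorbed by half of
    the coercivity.\<close>
  moreover have "\<forall>\<^sub>F x in at p. E x < m / 2"
    using order_tendstoD(2)[OF Elim, of "m / 2"] m(1) by simp
  ultimately have "\<forall>\<^sub>F x in at p. norm (z x - z p) \<le> (C x + E x * norm (z p)) * (2 / m)"
  proof eventually_elim
    case (elim x)
    interpret x: pos_def_form "\<beta> x" using pd elim(1) .
    define d where "d = z x - z p"
    have 1: "\<beta> x d d = (c x d - c p d) - (\<beta> x (z p) d - \<beta> p (z p) d)"
      by (simp add: d_def x.simps p.simps eq[OF elim(1), symmetric] eq[OF assms(2), symmetric])
    have "m * (norm d)\<^sup>2 \<le> \<beta> x d d - (\<beta> x d d - \<beta> p d d)" using m(2)[of d] by simp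
    also have "\<dots> \<le> \<beta> x d d + E x * norm d * norm d" using E[OF elim(1), of d d] by linarith
    also have "\<dots> \<le> C x * norm d + E x * norm (z p) * norm d + E x * norm d * norm d"
      unfolding 1 using C[OF elim(1), of d] E[OF elim(1), of "z p" d] by linarith
    also have "E x * norm d * norm d \<le> m / 2 * (norm d * norm d)"
      using mult_right_mono[of "E x" "m / 2" "norm d * norm d"] elim(2) by (simp add: mult.assoc)
    finally have "norm d * (norm d * m) \<le> norm d * (2 * (C x + E x * norm (z p)))"
      by (simp add: power2_eq_square algebra_simps)
    then have "norm d * m \<le> 2 * (C x + E x * norm (z p))" if "d \<noteq> 0"
      using that by (simp add: mult_le_cancel_left)
    moreover have "0 \<le> 2 * (C x + E x * norm (z p))"
      by (simp add: C_def E_def sum_nonneg)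
    ultimately have "norm d * m \<le> 2 * (C x + E x * norm (z p))" by (cases "d = 0") auto
    then show ?case using m(1) by (simp add: d_def field_simps)
  qed
  moreover have "((\<lambda>x. (C x + E x * norm (z p)) * (2 / m)) \<longlongrightarrow> 0) (at p)"
    using m(1) by (auto intro!: tendsto_eq_intros Clim Elim)
  ultimately have "((\<lambda>x. z x - z p) \<longlongrightarrow> 0) (at p)" by (rule Lim_null_comparison)
  then show ?thesis unfolding isCont_def by (rule LIM_zero_cancel)
qed

text \<open>Let \<open>r\<close> represent the \<open>j\<close>-th coordinate with respect to
  \<open>\<beta> p\<close>. Then this coordinate of \<open>z x\<close> is \<open>c x r\<close> minus
  a combination of entries of \<open>\<beta> x - \<beta> p\<close>, which vanish at
  \<open>p\<close>, with merely continuous coefficients.\<close>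

lemma solution_differentiable:
  fixes \<beta> :: "'x::real_normed_vector \<Rightarrow> 'e::euclidean_space \<Rightarrow> 'e \<Rightarrow> real"
  assumes "open S" "p \<in> S" and pd: "\<And>x. x \<in> S \<Longrightarrow> pos_def_form (\<beta> x)"
    and \<beta>: "\<And>x u v. x \<in> S \<Longrightarrow> (\<lambda>x. \<beta> x u v) differentiable (at x)"
    and c: "\<And>x w. x \<in> S \<Longrightarrow> (\<lambda>x. c x w) differentiable (at x)"
    and eq: "\<And>x w. x \<in> S \<Longrightarrow> \<beta> x (z x) w = c x w"
  shows "z differentiable (at p)"
proof -
  interpret p: pos_def_form "\<beta> p" using pd assms(2) .
  have cz: "isCont z p"
    by (rule solution_continuous[OF assms(1,2) pd _ _ eq])
      (auto intro!: continuous_at_imp_continuous_on differentiable_imp_continuous_within \<beta> c)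
  have "(\<lambda>x. z x \<bullet> j) differentiable (at p)" if "j \<in> Basis" for j
  proof -
    obtain r where r: "\<And>u. \<beta> p u r = u \<bullet> j"
    proof -
      have "linear (\<lambda>u. u \<bullet> j)" by (simp add: bounded_linear.linear[OF bounded_linear_inner_left])
      from p.riesz_the[OF this] that show ?thesis by (metis p.sym)
    qed
    define h where "h i x = \<beta> x i r - \<beta> p i r" for i x
    have hz: "(\<lambda>x. (z x \<bullet> i) * h i x) differentiable (at p)" for i
    proof (rule Derivative.differentiableI[OF has_derivative_mult_vanishing])
      show "isCont (\<lambda>x. z x \<bullet> i) p" using cz by (intro continuous_intros)
      show "(h i has_derivative fderiv (h i) p) (at p)"
        unfolding h_def using \<beta>[OF assms(2)]
        by (intro fderiv_works differentiable_diff) auto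
    qed (simp add: h_def)
    have "(\<lambda>x. c x r - (\<Sum>i\<in>Basis. (z x \<bullet> i) * h i x)) differentiable (at p)"
      using c[OF assms(2)] hz by (intro differentiable_diff differentiable_sum) auto
    moreover have "c x r - (\<Sum>i\<in>Basis. (z x \<bullet> i) * h i x) = z x \<bullet> j" if x: "x \<in> S" for x
    proof -
      interpret x: pos_def_form "\<beta> x" using pd x .
      have "linear (\<lambda>u. \<beta> x u r)" "linear (\<lambda>u. \<beta> p u r)"
        using x.bil p.bil by (auto simp: bilinear_def)
      from linear_expand[OF this(1), of "z x"] linear_expand[OF this(2), of "z x"]
      have "\<beta> x (z x) r - \<beta> p (z x) r = (\<Sum>i\<in>Basis. (z x \<bullet> i) * h i x)"
        by (simp add: h_def algebra_simps sum_subtractf)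
      then show ?thesis using eq[OF x] r by simp
    qed
    ultimately show ?thesis by (rule differentiable_cong_open[OF assms(1,2), rotated 1])
  qed
  then show ?thesis using differentiable_componentwise_within[of z p UNIV] by simp
qed

text \<open>The derivative of the solution solves a system with the same left-hand side, which
  makes an induction possible.\<close>

lemma solution_Ck:
  fixes \<beta> :: "'x::real_normed_vector \<Rightarrow> 'e::euclidean_space \<Rightarrow> 'e \<Rightarrow> real"
  assumes "open S" and pd: "\<And>x. x \<in> S \<Longrightarrow> pos_def_form (\<beta> x)"
    and \<beta>: "\<And>u v. Ck_on k S (\<lambda>x. \<beta> x u v)" and c: "\<And>w. Ck_on k S (\<lambda>x. c x w)"
    and eq: "\<And>x w. x \<in> S \<Longrightarrow> \<beta> x (z x) w = c x w"
  shows "Ck_on k S z"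
  using \<beta> c eq
proof (induction k arbitrary: c z)
  case 0
  then have "isCont z x" if "x \<in> S" for x
    by (intro solution_continuous[OF assms(1) that pd]) auto
  then show ?case by (simp add: continuous_at_imp_continuous_on)
next
  case (Suc k)
  have b1: "(\<lambda>x. \<beta> x u v) differentiable (at x)" and c1: "(\<lambda>x. c x w) differentiable (at x)"
    if "x \<in> S" for x u v w
    using Suc.prems that by auto
  interpret form_field S \<beta>
    using assms(1) b1 pd by unfold_locales (auto simp: pos_def_form_def)
  have zd: "z differentiable (at x)" if "x \<in> S" for x
    by (rule solution_differentiable[OF assms(1) that pd b1 c1 Suc.prems(3)])
  have b: "Ck_on k S (\<lambda>x. \<beta> x u v)" and c: "Ck_on k S (\<lambda>x. c x w)" for u v w
    using Suc.prems(1,2) Ck_on_SucD by blast+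
  have z: "Ck_on k S z" by (rule Suc.IH[OF b c Suc.prems(3)])
  have "Ck_on k S (\<lambda>x. fderiv z x a)" for a
  proof (rule Suc.IH[where c = "\<lambda>x w. fderiv (\<lambda>x. c x w) x a - dform \<beta> x a (z x) w", OF b])
    fix w
    have "Ck_on k S (\<lambda>x. \<Sum>i\<in>Basis. (z x \<bullet> i) * dform \<beta> x a i w)"
      using Suc.prems(1) unfolding dform_def
      by (intro Ck_on_sum Ck_on_mult Ck_on_inner_left assms(1) z) simp
    then have "Ck_on k S (\<lambda>x. dform \<beta> x a (z x) w)"
    proof (rule Ck_on_cong[OF assms(1)])
      fix x assume "x \<in> S"
      then have "linear (\<lambda>u. dform \<beta> x a u w)" using bilinear_dform by (simp add: bilinear_def)
      then show "(\<Sum>i\<in>Basis. (z x \<bullet> i) * dform \<beta> x a i w) = dform \<beta> x a (z x) w"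
        using linear_expand by metis
    qed
    then show "Ck_on k S (\<lambda>x. fderiv (\<lambda>x. c x w) x a - dform \<beta> x a (z x) w)"
      using Suc.prems(2) by (intro Ck_on_diff assms(1)) auto
  next
    fix x w assume x: "x \<in> S"
    have A: "((\<lambda>x. \<beta> x (z x) w) has_derivative
        (\<lambda>h. dform \<beta> x h (z x) w + \<beta> x (fderiv z x h) w + \<beta> x (z x) 0)) (at x)"
      by (rule has_derivative_form[OF has_derivative_ident fderiv_works[OF zd[OF x]] has_derivative_const x])
    have B: "((\<lambda>x. \<beta> x (z x) w) has_derivative fderiv (\<lambda>x. c x w) x) (at x)"
      by (rule has_derivative_transform_within_open[OF fderiv_works[OF c1[OF x]] assms(1) x])
        (simp add: Suc.prems(3))
    from fun_cong[OF has_derivative_unique[OF A B], of a]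
    show "\<beta> x (fderiv z x a) w = fderiv (\<lambda>x. c x w) x a - dform \<beta> x a (z x) w"
      using bilinear_rzero[OF bilin[OF x]] by simp
  qed
  then show ?case using zd by simp
qed

section \<open>Charts, tangent vectors and vector fields\<close>

definition transition :: "('a, 'e) chart \<Rightarrow> ('a, 'e) chart \<Rightarrow> 'e \<Rightarrow> 'e" where
  "transition c d = cmap d \<circ> cinv c"

text \<open>\<open>local_metric\<close> for any field of forms, because the horizontal and vertical
  parts of the metric must be read in charts too.\<close>

definition local_form ::
  "('a, 'e::euclidean_space, 'z) manifold_scheme \<Rightarrow> ('a \<Rightarrow> 'e \<Rightarrow> 'e \<Rightarrow> real) \<Rightarrow> ('a, 'e) chart \<Rightarrow> 'e \<Rightarrow> 'e \<Rightarrow> 'e \<Rightarrow> real"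
  where "local_form M \<beta> c x u v =
    \<beta> (cinv c x) (chart_to_tangent M c (cinv c x) u) (chart_to_tangent M c (cinv c x) v)"

lemma local_metric_eq: "local_metric M = local_form M (metric_tensor M)"
  by (intro ext) (simp add: local_metric_def local_form_def Let_def)

locale smooth_mfd =
  fixes M :: "('a::{t2_space,second_countable_topology}, 'e::euclidean_space, 'z) manifold_scheme"
  assumes sm: "smooth_manifold M"
begin

lemma atlas_homeo: "c \<in> atlas M \<Longrightarrow> homeomorphism (cdom c) (cmap c ` cdom c) (cmap c) (cinv c)"
  and open_cdom: "c \<in> atlas M \<Longrightarrow> open (cdom c)"
  and open_img: "c \<in> atlas M \<Longrightarrow> open (cmap c ` cdom c)"
  and chart_at_atlas [simp]: "chart_at M p \<in> atlas M"
  and in_chart_at [simp]: "p \<in> cdom (chart_at M p)"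
  using sm by (auto simp: smooth_manifold_def)

lemma transition_Ck: "c \<in> atlas M \<Longrightarrow> d \<in> atlas M \<Longrightarrow> Ck_on k (cmap c ` (cdom c \<inter> cdom d)) (transition c d)"
  using sm by (auto simp: smooth_manifold_def transition_def smooth_on_def)

lemma cinv_cmap [simp]: "c \<in> atlas M \<Longrightarrow> q \<in> cdom c \<Longrightarrow> cinv c (cmap c q) = q"
  using atlas_homeo homeomorphism_apply1 by blast

lemma open_image:
  assumes "c \<in> atlas M" "open U" "U \<subseteq> cdom c"
  shows "open (cmap c ` U)"
proof -
  have "openin (top_of_set (cdom c)) U" using assms by (simp add: open_subset)
  then have "openin (top_of_set (cmap c ` cdom c)) (cmap c ` U)"
    using homeomorphism_imp_open_map[OF atlas_homeo[OF assms(1)]] by blast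
  then show ?thesis using open_img[OF assms(1)] openin_open_trans by blast
qed

lemma open_image_Int: "c \<in> atlas M \<Longrightarrow> open U \<Longrightarrow> open (cmap c ` (cdom c \<inter> U))"
  by (rule open_image) (auto simp: open_cdom)

lemma continuous_cmap: "c \<in> atlas M \<Longrightarrow> continuous_on (cdom c) (cmap c)"
  using atlas_homeo homeomorphism_cont1 by blast

lemma continuous_cinv: "c \<in> atlas M \<Longrightarrow> continuous_on (cmap c ` cdom c) (cinv c)"
  using atlas_homeo homeomorphism_cont2 by blast

lemma transition_deriv:
  assumes "c \<in> atlas M" "d \<in> atlas M" "q \<in> cdom c" "q \<in> cdom d"
  shows "(transition c d has_derivative fderiv (transition c d) (cmap c q)) (at (cmap c q))"
  using transition_Ck[OF assms(1,2), of 1] assms(3,4) by (intro fderiv_works) simp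

lemma linear_transition:
  assumes "c \<in> atlas M" "d \<in> atlas M" "q \<in> cdom c" "q \<in> cdom d"
  shows "linear (fderiv (transition c d) (cmap c q))"
  using transition_deriv[OF assms] has_derivative_linear by blast

text \<open>The chain rule. Together with \<open>transition_self\<close> it makes the two
  conversions between tangent vectors and chart coordinates inverse to each other.\<close>

lemma transition_cocycle:
  assumes "c \<in> atlas M" "d \<in> atlas M" "e \<in> atlas M" "q \<in> cdom c" "q \<in> cdom d" "q \<in> cdom e"
  shows "fderiv (transition d e) (cmap d q) (fderiv (transition c d) (cmap c q) v)
    = fderiv (transition c e) (cmap c q) v"
proof -
  have x: "transition c d (cmap c q) = cmap d q" using assms by (simp add: transition_def)
  have "(transition d e \<circ> transition c d has_derivative
      fderiv (transition d e) (cmap d q) \<circ> fderiv (transition c d) (cmap c q)) (at (cmap c q))"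
    by (rule diff_chain_at) (use transition_deriv assms x in simp_all)
  moreover have "open (cmap c ` (cdom c \<inter> (cdom d \<inter> cdom e)))"
    using assms by (intro open_image_Int) (auto simp: open_cdom)
  ultimately have "(transition c e has_derivative
      fderiv (transition d e) (cmap d q) \<circ> fderiv (transition c d) (cmap c q)) (at (cmap c q))"
    by (rule has_derivative_transform_within_open) (use assms in \<open>auto simp: transition_def\<close>)
  then show ?thesis by (simp add: fderiv_eq[of "transition c e"])
qed

lemma transition_self:
  assumes "c \<in> atlas M" "q \<in> cdom c"
  shows "fderiv (transition c c) (cmap c q) v = v"
proof -
  have "((\<lambda>x. x) has_derivative (\<lambda>v. v)) (at (cmap c q))" by (rule has_derivative_ident)
  then have "(transition c c has_derivative (\<lambda>v. v)) (at (cmap c q))"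
    by (rule has_derivative_transform_within_open[OF _ open_img[OF assms(1)]])
      (use assms in \<open>auto simp: transition_def\<close>)
  then show ?thesis by (simp add: fderiv_eq[of "transition c c"])
qed

lemma ttc_eq: "tangent_to_chart M c p = fderiv (transition (chart_at M p) c) (cmap (chart_at M p) p)"
  by (simp add: tangent_to_chart_def transition_def)

lemma ctt_eq: "chart_to_tangent M c p = fderiv (transition c (chart_at M p)) (cmap c p)"
  by (simp add: chart_to_tangent_def transition_def)

lemma ctt_ttc [simp]: "c \<in> atlas M \<Longrightarrow> p \<in> cdom c \<Longrightarrow> chart_to_tangent M c p (tangent_to_chart M c p v) = v"
  by (simp add: ttc_eq ctt_eq transition_cocycle transition_self)

lemma ttc_ctt [simp]: "c \<in> atlas M \<Longrightarrow> p \<in> cdom c \<Longrightarrow> tangent_to_chart M c p (chart_to_tangent M c p v) = v"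
  by (simp add: ttc_eq ctt_eq transition_cocycle transition_self)

lemma linear_ctt: "c \<in> atlas M \<Longrightarrow> p \<in> cdom c \<Longrightarrow> linear (chart_to_tangent M c p)"
  by (simp add: ctt_eq linear_transition)

lemma linear_ttc: "c \<in> atlas M \<Longrightarrow> p \<in> cdom c \<Longrightarrow> linear (tangent_to_chart M c p)"
  by (simp add: ttc_eq linear_transition)

lemma ctt_transition:
  "c \<in> atlas M \<Longrightarrow> d \<in> atlas M \<Longrightarrow> q \<in> cdom c \<Longrightarrow> q \<in> cdom d \<Longrightarrow>
    chart_to_tangent M d q (fderiv (transition c d) (cmap c q) v) = chart_to_tangent M c q v"
  by (simp add: ctt_eq transition_cocycle)

lemma transition_ttc:
  "c \<in> atlas M \<Longrightarrow> d \<in> atlas M \<Longrightarrow> q \<in> cdom c \<Longrightarrow> q \<in> cdom d \<Longrightarrow>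
    fderiv (transition c d) (cmap c q) (tangent_to_chart M c q v) = tangent_to_chart M d q v"
  by (simp add: ttc_eq transition_cocycle)

lemma ctt_chart_at [simp]: "chart_to_tangent M (chart_at M p) p v = v"
  by (simp add: ctt_eq transition_self)

lemma ttc_chart_at [simp]: "tangent_to_chart M (chart_at M p) p v = v"
  by (simp add: ttc_eq transition_self)

lemma local_form_chart_at [simp]: "local_form M \<beta> (chart_at M p) (cmap (chart_at M p) p) = \<beta> p"
  by (intro ext) (simp add: local_form_def)

lemma local_form_cmap:
  "c \<in> atlas M \<Longrightarrow> q \<in> cdom c \<Longrightarrow>
    local_form M \<beta> c (cmap c q) u v = \<beta> q (chart_to_tangent M c q u) (chart_to_tangent M c q v)"
  by (simp add: local_form_def)

lemma local_form_transition:
  assumes "c \<in> atlas M" "d \<in> atlas M" "x \<in> cmap c ` (cdom c \<inter> cdom d)"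
  shows "local_form M \<beta> c x u v = local_form M \<beta> d (transition c d x)
    (fderiv (transition c d) x u) (fderiv (transition c d) x v)"
  using assms by (auto simp: local_form_def transition_def[of c d, THEN fun_cong] ctt_transition)

text \<open>In another chart the coordinates are obtained by applying the derivative of a transition
  map, so one chart that covers \<open>W\<close> suffices. The vertical fields built below are
  smooth by construction in a single chart.\<close>

lemma smooth_field_onI:
  assumes c: "c \<in> atlas M" "open W" "W \<subseteq> cdom c"
    and V: "smooth_on (cmap c ` W) (\<lambda>x. tangent_to_chart M c (cinv c x) (V (cinv c x)))"
  shows "smooth_field_on M W V"
  unfolding smooth_field_on_def
proof (intro ballI smooth_onI)
  fix d k assume d: "d \<in> atlas M"
  define S where "S = cmap d ` (cdom d \<inter> W)"
  have S: "open S" unfolding S_def by (rule open_image_Int[OF d c(2)])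
  have T: "open (cmap c ` (cdom c \<inter> cdom d))" by (rule open_image_Int[OF c(1) open_cdom[OF d]])
  define V' where "V' = (\<lambda>x. tangent_to_chart M c (cinv c x) (V (cinv c x)))"
  have t1: "Ck_on j S (transition d c)" for j
    using transition_Ck[OF d c(1)] by (rule Ck_on_subset) (use c(3) in \<open>auto simp: S_def\<close>)
  have t2: "transition d c ` S \<subseteq> cmap c ` W" using d c by (auto simp: S_def transition_def)
  have V': "Ck_on k S (\<lambda>y. V' (transition d c y))"
    using V by (intro Ck_on_compose[OF S open_image[OF c] t2 t1]) (simp add: V'_def smooth_on_Ck)
  \<comment> \<open>One order more than \<open>k\<close>, since the coordinates change by the
    derivative of the transition map.\<close>
  have td: "Ck_on (Suc k) (cmap c ` (cdom c \<inter> cdom d)) (transition c d)" by (rule transition_Ck[OF c(1) d])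
  have t3: "transition d c ` S \<subseteq> cmap c ` (cdom c \<inter> cdom d)" using d c by (auto simp: S_def transition_def)
  have "Ck_on k S (\<lambda>y. fderiv (transition c d) (transition d c y) (V' (transition d c y)))"
  proof (rule Ck_on_fderiv_vec[OF S _ V'])
    show "Ck_on k S (\<lambda>x. fderiv (transition c d) (transition d c x) v)" for v
      using td by (intro Ck_on_compose[OF S T t3 t1]) simp
    show "transition c d differentiable (at (transition d c x))" if "x \<in> S" for x
      using td t3 that by auto
  qed
  then show "Ck_on k (cmap d ` (cdom d \<inter> W)) (\<lambda>x. tangent_to_chart M d (cinv d x) (V (cinv d x)))"
    unfolding S_def[symmetric]
  proof (rule Ck_on_cong[OF S])
    fix x assume "x \<in> S"
    then show "fderiv (transition c d) (transition d c x) (V' (transition d c x))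
      = tangent_to_chart M d (cinv d x) (V (cinv d x))"
      using d c by (auto simp: S_def V'_def transition_def[of d c, THEN fun_cong] transition_ttc subset_iff)
  qed
qed

lemma curve_transition:
  fixes \<gamma> :: "real \<Rightarrow> 'a"
  assumes I: "open I" "t \<in> I" "continuous_on I \<gamma>"
    and c: "c \<in> atlas M" "d \<in> atlas M" "\<gamma> t \<in> cdom c" "\<gamma> t \<in> cdom d"
  obtains J where "open J" "t \<in> J" "J \<subseteq> I" "\<And>s. s \<in> J \<Longrightarrow> \<gamma> s \<in> cdom c \<and> \<gamma> s \<in> cdom d"
    "\<And>s. s \<in> J \<Longrightarrow> (cmap d \<circ> \<gamma>) s = transition c d ((cmap c \<circ> \<gamma>) s)"
proof
  show "open (I \<inter> \<gamma> -` (cdom c \<inter> cdom d))"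
    using I c by (intro continuous_open_preimage) (auto simp: open_cdom)
qed (use assms in \<open>auto simp: transition_def\<close>)

text \<open>\<open>velocity\<close> refers to a chart that changes with time; here it is expressed
  through a single chart. It is typed for Riemannian manifolds while this locale has only charts,
  hence the second structure \<open>M'\<close> on the same charts.\<close>

lemma velocity_in_chart:
  fixes M' :: "('a, 'e) riemannian"
  assumes M': "chart_at M' = chart_at M" "atlas M' = atlas M"
    and I: "open I" "t \<in> I" "continuous_on I \<gamma>"
    and c: "c \<in> atlas M" "\<gamma> t \<in> cdom c"
    and d: "((cmap c \<circ> \<gamma>) has_vector_derivative x') (at t)"
  shows "velocity M' \<gamma> t = chart_to_tangent M c (\<gamma> t) x'"
proof -
  let ?d = "chart_at M (\<gamma> t)"
  obtain J where J: "open J" "t \<in> J" "J \<subseteq> I" "\<And>s. s \<in> J \<Longrightarrow> \<gamma> s \<in> cdom c \<and> \<gamma> s \<in> cdom ?d"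
    "\<And>s. s \<in> J \<Longrightarrow> (cmap ?d \<circ> \<gamma>) s = transition c ?d ((cmap c \<circ> \<gamma>) s)"
    using curve_transition[OF I c(1) chart_at_atlas c(2) in_chart_at] by blast
  have "(transition c ?d \<circ> (cmap c \<circ> \<gamma>) has_derivative
      fderiv (transition c ?d) (cmap c (\<gamma> t)) \<circ> (\<lambda>h. h *\<^sub>R x')) (at t)"
    using d transition_deriv[OF c(1) chart_at_atlas c(2) in_chart_at] unfolding has_vector_derivative_def
    by (intro diff_chain_at) simp_all
  then have "((cmap ?d \<circ> \<gamma>) has_derivative
      fderiv (transition c ?d) (cmap c (\<gamma> t)) \<circ> (\<lambda>h. h *\<^sub>R x')) (at t)"
    by (rule has_derivative_transform_within_open[OF _ J(1,2)]) (use J(5) in simp)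
  moreover have "fderiv (transition c ?d) (cmap c (\<gamma> t)) \<circ> (\<lambda>h. h *\<^sub>R x')
      = (\<lambda>h. h *\<^sub>R chart_to_tangent M c (\<gamma> t) x')"
    using linear_scale[OF linear_transition[OF c(1) chart_at_atlas c(2) in_chart_at]]
    by (auto simp: ctt_eq)
  ultimately have "((cmap ?d \<circ> \<gamma>) has_vector_derivative chart_to_tangent M c (\<gamma> t) x') (at t)"
    by (simp add: has_vector_derivative_def)
  then show ?thesis unfolding velocity_def M' by (rule vector_derivative_at)
qed

end

text \<open>The derivative of \<open>\<tau>\<close>, paired with a vector \<open>v\<close>, is a
  field of bilinear forms, so \<open>has_derivative_form\<close> applies to each component.\<close>

lemma has_derivative_fderiv_apply:
  fixes \<tau> :: "'e::euclidean_space \<Rightarrow> 'f::euclidean_space"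
  assumes S: "open S" "Ck_on 2 S \<tau>" "X s \<in> S"
    and X: "(X has_derivative X') (at s)" and U: "(U has_derivative U') (at s)"
  shows "((\<lambda>s. fderiv \<tau> (X s) (U s)) has_derivative
    (\<lambda>h. fderiv (\<lambda>y. fderiv \<tau> y (U s)) (X s) (X' h) + fderiv \<tau> (X s) (U' h))) (at s)"
proof -
  define \<beta> where "\<beta> y u v = fderiv \<tau> y u \<bullet> v" for y u v
  have d: "\<tau> differentiable (at y)" "(\<lambda>y. fderiv \<tau> y u) differentiable (at y)" if "y \<in> S" for y u
    using S(2) that by (auto simp: numeral_2_eq_2)
  interpret form_field S \<beta>
  proof
    show "bilinear (\<beta> x)" if "x \<in> S" for x
      using linear_frechet_derivative[OF d(1)[OF that]]
      unfolding bilinear_def \<beta>_def by (auto intro!: linearI simp: inner_simps linear_add linear_scale)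
    show "(\<lambda>y. \<beta> y u v) differentiable (at x)" if "x \<in> S" for x u v
      unfolding \<beta>_def using d(2)[OF that] by (intro differentiable_inner) auto
  qed (rule S)
  have db: "dform \<beta> (X s) a u v = fderiv (\<lambda>y. fderiv \<tau> y u) (X s) a \<bullet> v" for a u v
    by (rule dform_unique[OF S(3)]) (unfold \<beta>_def,
      rule bounded_linear.has_derivative[OF bounded_linear_inner_left fderiv_works[OF d(2)[OF S(3)]]])
  have "((\<lambda>s. \<beta> (X s) (U s) b) has_derivative
    (\<lambda>h. dform \<beta> (X s) (X' h) (U s) b + \<beta> (X s) (U' h) b + \<beta> (X s) (U s) 0)) (at s)" for b
    by (rule has_derivative_form[OF X U has_derivative_const S(3)])
  then show ?thesis
    by (subst has_derivative_componentwise_within) (auto simp: \<beta>_def db inner_simps)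
qed

section \<open>Christoffel symbols and geodesics\<close>

locale riem_mfd = smooth_mfd M
  for M :: "('a::{t2_space,second_countable_topology}, 'e::euclidean_space) riemannian" +
  assumes bil_metric: "bilinear (metric_tensor M p)"
    and sym_metric: "metric_tensor M p u v = metric_tensor M p v u"
    and pos_metric: "u \<noteq> 0 \<Longrightarrow> metric_tensor M p u u > 0"
    and smooth_metric: "c \<in> atlas M \<Longrightarrow> smooth_on (cmap c ` cdom c) (\<lambda>x. local_metric M c x u v)"

lemma riem_mfdI: "riemannian_manifold M \<Longrightarrow> riem_mfd M"
  unfolding riemannian_manifold_def riem_mfd_def riem_mfd_axioms_def smooth_mfd_def by blast

sublocale riem_mfd \<subseteq> metric: pos_def_form "metric_tensor M p" for p
  using bil_metric sym_metric pos_metric by unfold_locales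

context riem_mfd
begin

lemma pos_def_local_metric:
  assumes "c \<in> atlas M" "x \<in> cmap c ` cdom c"
  shows "pos_def_form (local_metric M c x)"
proof -
  obtain q where q: "q \<in> cdom c" "x = cmap c q" using assms(2) by blast
  have lin: "linear (chart_to_tangent M c q)" using assms(1) q(1) by (rule linear_ctt)
  have e: "local_metric M c x u v = metric_tensor M q (chart_to_tangent M c q u) (chart_to_tangent M c q
    v)" for u v
    using assms(1) q by (simp add: local_metric_eq local_form_cmap)
  have inj: "chart_to_tangent M c q u \<noteq> 0" if "u \<noteq> 0" for u
    using that ttc_ctt[OF assms(1) q(1), of u] linear_0[OF linear_ttc[OF assms(1) q(1)]] by metis
  show ?thesis
  proof
    show "bilinear (local_metric M c x)"
      unfolding bilinear_def
      by (auto intro!: linearI simp: e linear_add[OF lin] linear_scale[OF lin] metric.simps)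
    show "local_metric M c x u v = local_metric M c x v u" for u v by (simp add: e sym_metric)
    show "local_metric M c x u u > 0" if "u \<noteq> 0" for u using inj[OF that] pos_metric by (simp add: e)
  qed
qed

lemma Ck_local_metric: "c \<in> atlas M \<Longrightarrow> Ck_on k (cmap c ` cdom c) (\<lambda>x. local_metric M c x u v)"
  using smooth_metric smooth_on_Ck by blast

lemma form_field_local_metric: "c \<in> atlas M \<Longrightarrow> form_field (cmap c ` cdom c) (local_metric M c)"
  using pos_def_local_metric open_img Ck_local_metric[of c 1]
  by unfold_locales (auto simp: pos_def_form_def)

lemma local_metric_sym:
  "c \<in> atlas M \<Longrightarrow> x \<in> cmap c ` cdom c \<Longrightarrow> local_metric M c x u v = local_metric M c x v u"
  using pos_def_local_metric pos_def_form.sym by blast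

text \<open>\<open>christoffel\<close> uses at each point the chart preferred there. The geodesic
  equation has to be solved in one chart, at all of its points.\<close>

definition local_christoffel :: "('a, 'e) chart \<Rightarrow> 'e \<Rightarrow> 'e \<Rightarrow> 'e \<Rightarrow> 'e" where
  "local_christoffel c x u v = (THE z. \<forall>w. local_metric M c x z w = koszul (local_metric M c) x u v w / 2)"

lemma local_christoffel:
  assumes "c \<in> atlas M" "x \<in> cmap c ` cdom c"
  shows "local_metric M c x (local_christoffel c x u v) w = koszul (local_metric M c) x u v w / 2"
proof -
  interpret pos_def_form "local_metric M c x" by (rule pos_def_local_metric[OF assms])
  have "linear (\<lambda>w. koszul (local_metric M c) x u v w / 2)"
    using linear_compose_scale_right[OF koszul_linear[OF form_field_local_metric[OF assms(1)] assms(2)],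
      of "1/2"]
    by simp
  from riesz_the[OF this] show ?thesis unfolding local_christoffel_def .
qed

lemma christoffel:
  "2 * metric_tensor M p (christoffel M p u v) w
    = koszul (local_metric M (chart_at M p)) (cmap (chart_at M p) p) u v w"
proof -
  let ?c = "chart_at M p" and ?x = "cmap (chart_at M p) p"
  have x: "?x \<in> cmap ?c ` cdom ?c" by simp
  have "local_metric M ?c ?x = metric_tensor M p" by (simp add: local_metric_eq)
  moreover have "christoffel M p u v = local_christoffel ?c ?x u v"
    unfolding christoffel_def local_christoffel_def Let_def koszul_def dform_def calculation
    by (rule arg_cong[where f = The]) (auto simp: fun_eq_iff field_simps)
  ultimately show ?thesis using local_christoffel[OF chart_at_atlas x, of u v w] by simp
qed

text \<open>Joint regularity in point and vector, since the geodesic equation is a first-order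
  system on pairs of position and velocity.\<close>

lemma Ck_koszul:
  assumes "c \<in> atlas M"
  shows "Ck_on k (cmap c ` cdom c \<times> UNIV) (\<lambda>(x, u). koszul (local_metric M c) x u u w)"
proof -
  let ?S = "cmap c ` cdom c"
  interpret form_field ?S "local_metric M c" by (rule form_field_local_metric[OF assms])
  have o: "open (?S \<times> (UNIV :: 'e set))" by (intro open_Times open_img assms) simp
  have D0: "Ck_on k ?S (\<lambda>x. dform (local_metric M c) x a u v)" for a u v
    using Ck_local_metric[OF assms, of "Suc k"] by (simp add: dform_def)
  have D: "Ck_on k (?S \<times> (UNIV :: 'e set)) (\<lambda>y. dform (local_metric M c) (fst y) a u v)" for a u v
    by (rule Ck_on_compose[where f = fst and g = "\<lambda>x. dform (local_metric M c) x a u v", OF o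
      open_img[OF assms] _ _ D0])
      (auto intro: Ck_on_fst[OF o Ck_on_ident[OF o]])
  have "Ck_on k (?S \<times> UNIV) (\<lambda>y. 2 * (\<Sum>i\<in>Basis. (snd y \<bullet> i) *
        (\<Sum>j\<in>Basis. (snd y \<bullet> j) * dform (local_metric M c) (fst y) i j w))
      - (\<Sum>i\<in>Basis. \<Sum>j\<in>Basis. (snd y \<bullet> i) * ((snd y \<bullet> j) * dform (local_metric M c) (fst y) w i j)))"
    by (intro Ck_on_diff Ck_on_sum Ck_on_mult Ck_on_const Ck_on_inner_left Ck_on_snd Ck_on_ident D o)
  then show ?thesis
  proof (rule Ck_on_cong[OF o])
    fix y assume "y \<in> ?S \<times> (UNIV :: 'e set)"
    then have x: "fst y \<in> ?S" by auto
    let ?x = "fst y" and ?u = "snd y"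
    have 1: "dform (local_metric M c) ?x w ?u ?u
      = (\<Sum>i\<in>Basis. \<Sum>j\<in>Basis. (?u \<bullet> i) * ((?u \<bullet> j) * dform (local_metric M c) ?x w i j))"
      by (rule bilinear_expand[OF bilinear_dform[OF x]])
    have "dform (local_metric M c) ?x ?u ?u w = (\<Sum>i\<in>Basis. (?u \<bullet> i) * dform (local_metric M c) ?x i ?u w)"
      by (rule linear_expand[OF linear_dform[OF x]])
    also have "\<dots> = (\<Sum>i\<in>Basis. (?u \<bullet> i) * (\<Sum>j\<in>Basis. (?u \<bullet> j) * dform (local_metric M c) ?x i j w))"
    proof (intro sum.cong refl arg_cong2[where f = "(*)"])
      fix i
      have "linear (\<lambda>u. dform (local_metric M c) ?x i u w)"
        using bilinear_dform[OF x] by (simp add: bilinear_def)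
      from linear_expand[OF this] show "dform (local_metric M c) ?x i ?u w = (\<Sum>j\<in>Basis. (?u \<bullet> j) * dform
        (local_metric M c) ?x i j w)" .
    qed
    finally show "2 * (\<Sum>i\<in>Basis. (snd y \<bullet> i) *
        (\<Sum>j\<in>Basis. (snd y \<bullet> j) * dform (local_metric M c) (fst y) i j w))
      - (\<Sum>i\<in>Basis. \<Sum>j\<in>Basis. (snd y \<bullet> i) * ((snd y \<bullet> j) * dform (local_metric M c) (fst y) w i j))
      = (case y of (x, u) \<Rightarrow> koszul (local_metric M c) x u u w)"
      by (simp add: case_prod_beta koszul_def 1)
  qed
qed

text \<open>\<open>local_christoffel\<close> solves a linear system with the metric as coefficients,
  so \<open>solution_Ck\<close> replaces a discussion of the inverse matrix.\<close>

lemma Ck_local_christoffel: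
  assumes c: "c \<in> atlas M"
  shows "Ck_on k (cmap c ` cdom c \<times> UNIV) (\<lambda>(x, u). local_christoffel c x u u)"
proof (rule solution_Ck[where \<beta> = "\<lambda>y. local_metric M c (fst y)"
      and c = "\<lambda>y w. (1/2) * (case y of (x, u) \<Rightarrow> koszul (local_metric M c) x u u w)"])
  show o: "open (cmap c ` cdom c \<times> (UNIV :: 'e set))" by (intro open_Times open_img c) simp
  show "Ck_on k (cmap c ` cdom c \<times> (UNIV :: 'e set)) (\<lambda>y. local_metric M c (fst y) u v)" for u v
    by (rule Ck_on_compose[where f = fst and g = "\<lambda>x. local_metric M c x u v", OF o open_img[OF c] _ _
      Ck_local_metric[OF c]])
      (auto intro: Ck_on_fst[OF o Ck_on_ident[OF o]])
  show "Ck_on k (cmap c ` cdom c \<times> UNIV) (\<lambda>y. (1/2) * (case y of (x, u) \<Rightarrow> koszul (local_metric M c) x u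
    u w))" for w
    by (intro Ck_on_mult o Ck_on_const Ck_koszul[OF c])
qed (use c in \<open>auto simp: pos_def_local_metric local_christoffel\<close>)

text \<open>The change to the chart preferred at \<open>\<gamma> t\<close> adds a second derivative
  of the transition map to the acceleration; \<open>koszul_pullback\<close> yields the same term for
  the Christoffel symbols, and the two cancel.\<close>

lemma acceleration_zeroI:
  assumes I: "open I" "t \<in> I" "continuous_on I \<gamma>"
    and c: "c \<in> atlas M" "\<And>s. s \<in> I \<Longrightarrow> \<gamma> s \<in> cdom c"
    and X: "\<And>s. s \<in> I \<Longrightarrow> ((cmap c \<circ> \<gamma>) has_vector_derivative U s) (at s)"
    and U: "(U has_vector_derivative - local_christoffel c (cmap c (\<gamma> t)) (U t) (U t)) (at t)"
  shows "acceleration M \<gamma> t = 0"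
proof -
  let ?d = "chart_at M (\<gamma> t)"
  let ?g = "local_metric M c" and ?h = "local_metric M ?d"
  define \<tau> where "\<tau> = transition c ?d"
  define X where "X = cmap c \<circ> \<gamma>"
  define S where "S = cmap c ` (cdom c \<inter> cdom ?d)"
  have S: "open S" unfolding S_def by (rule open_image_Int[OF c(1) open_cdom]) simp
  have \<tau>: "Ck_on 2 S \<tau>" unfolding S_def \<tau>_def by (rule transition_Ck[OF c(1)]) simp
  obtain J where J: "open J" "t \<in> J" "J \<subseteq> I" "\<And>s. s \<in> J \<Longrightarrow> \<gamma> s \<in> cdom c \<and> \<gamma> s \<in> cdom ?d"
    "\<And>s. s \<in> J \<Longrightarrow> (cmap ?d \<circ> \<gamma>) s = \<tau> (X s)"
    unfolding \<tau>_def X_def using curve_transition[OF I c(1) chart_at_atlas c(2)[OF I(2)] in_chart_at] by blast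
  have XS: "X s \<in> S" if "s \<in> J" for s using J(4)[OF that] by (auto simp: S_def X_def)
  have \<tau>d: "\<tau> differentiable (at x)" if "x \<in> S" for x using \<tau> that by (simp add: numeral_2_eq_2)
  have dX: "(X has_derivative (\<lambda>h. h *\<^sub>R U s)) (at s)" if "s \<in> J" for s
    using X[of s] J(3) that by (auto simp: X_def has_vector_derivative_def)
  have vd: "((cmap ?d \<circ> \<gamma>) has_vector_derivative fderiv \<tau> (X s) (U s)) (at s)" if s: "s \<in> J" for s
  proof -
    have "(\<tau> \<circ> X has_derivative fderiv \<tau> (X s) \<circ> (\<lambda>h. h *\<^sub>R U s)) (at s)"
      using dX[OF s] fderiv_works[OF \<tau>d[OF XS[OF s]]] by (rule diff_chain_at)
    then have "((cmap ?d \<circ> \<gamma>) has_derivative fderiv \<tau> (X s) \<circ> (\<lambda>h. h *\<^sub>R U s)) (at s)"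
      by (rule has_derivative_transform_within_open[OF _ J(1) s]) (simp add: J(5)[symmetric])
    then show ?thesis
      using linear_scale[OF linear_frechet_derivative[OF \<tau>d[OF XS[OF s]]]]
      by (simp add: has_vector_derivative_def o_def)
  qed
  define x y u \<Gamma> where "x = X t" and "y = cmap ?d (\<gamma> t)" and "u = U t"
    and "\<Gamma> = local_christoffel c x u u"
  define u' where "u' = fderiv \<tau> x u"
  have xS: "x \<in> S" unfolding x_def by (rule XS[OF J(2)])
  have x: "x \<in> cmap c ` cdom c" using xS by (auto simp: S_def)
  have \<tau>x: "\<tau> x = y" using J(5)[OF J(2)] by (simp add: x_def y_def)
  have lin: "linear (fderiv \<tau> x)" by (rule linear_frechet_derivative[OF \<tau>d[OF xS]])
  have U': "(U has_derivative (\<lambda>h. h *\<^sub>R (- \<Gamma>))) (at t)"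
    using U by (simp add: has_vector_derivative_def \<Gamma>_def x_def X_def u_def)
  define a where "a = fderiv (\<lambda>y. fderiv \<tau> y u) x u + fderiv \<tau> x (- \<Gamma>)"
  have "((\<lambda>s. fderiv \<tau> (X s) (U s)) has_derivative
      (\<lambda>h. fderiv (\<lambda>y. fderiv \<tau> y (U t)) (X t) (h *\<^sub>R U t) + fderiv \<tau> (X t) (h *\<^sub>R (- \<Gamma>)))) (at t)"
    by (rule has_derivative_fderiv_apply[OF S \<tau> XS[OF J(2)] dX[OF J(2)] U'])
  moreover have "linear (fderiv (\<lambda>y. fderiv \<tau> y u) x)"
    using \<tau> xS by (intro linear_frechet_derivative) (simp add: numeral_2_eq_2)
  ultimately have "((\<lambda>s. fderiv \<tau> (X s) (U s)) has_vector_derivative a) (at t)"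
    using lin unfolding has_vector_derivative_def a_def x_def u_def
    by (simp add: linear_scale scaleR_add_right del: scaleR_minus_right)
  moreover have "\<forall>s\<in>J. vector_derivative (cmap ?d \<circ> \<gamma>) (at s) = fderiv \<tau> (X s) (U s)"
    using vd vector_derivative_at by blast
  ultimately have "((\<lambda>s. vector_derivative (cmap ?d \<circ> \<gamma>) (at s)) has_vector_derivative a) (at t)"
    unfolding has_vector_derivative_def
    by (elim has_derivative_transform_within_open[OF _ J(1,2)]) simp
  then have acc: "acceleration M \<gamma> t = a + christoffel M (\<gamma> t) u' u'"
    unfolding acceleration_def Let_def velocity_def
    by (simp add: vector_derivative_at[OF vd[OF J(2)]] vector_derivative_at u'_def x_def u_def)
  show ?thesis
  proof (rule metric.eqI[where p = "\<gamma> t"])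
    fix w
    \<comment> \<open>The test vector is carried back to the chart \<open>c\<close>, from which
      \<open>koszul_pullback\<close> takes its arguments.\<close>
    define w0 where "w0 = fderiv (transition ?d c) y w"
    have w: "fderiv \<tau> x w0 = w"
    proof -
      have "x = cmap c (\<gamma> t)" by (simp add: x_def X_def)
      then show ?thesis
        using transition_cocycle[of ?d c ?d "\<gamma> t" w] c(1) c(2)[OF I(2)] transition_self[of ?d "\<gamma> t" w]
        by (simp add: w0_def \<tau>_def y_def)
    qed
    have pull: "?g z v1 v2 = ?h (\<tau> z) (fderiv \<tau> z v1) (fderiv \<tau> z v2)" if "z \<in> S" for z v1 v2
      using that unfolding local_metric_eq \<tau>_def S_def by (intro local_form_transition c) simp_all
    have hy: "?h y = metric_tensor M (\<gamma> t)" by (simp add: y_def local_metric_eq)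
    have \<tau>S: "\<tau> ` S \<subseteq> cmap ?d ` cdom ?d" using c(1) by (auto simp: \<tau>_def S_def transition_def)
    have "koszul ?g x u u w0 = koszul ?h y u' u' w
       + 2 * ?h y (fderiv (\<lambda>y. fderiv \<tau> y u) x u) w"
      using koszul_pullback[OF form_field_local_metric[OF chart_at_atlas] local_metric_sym[OF
        chart_at_atlas] S \<tau> \<tau>S pull xS, of u u w0]
      by (simp add: \<tau>x w u'_def)
    moreover have "koszul ?g x u u w0 = 2 * ?h y (fderiv \<tau> x \<Gamma>) w"
      using local_christoffel[OF c(1) x, of u u w0] pull[OF xS, of \<Gamma> w0] by (simp add: \<Gamma>_def \<tau>x w)
    moreover have "koszul ?h y u' u' w = 2 * metric_tensor M (\<gamma> t) (christoffel M (\<gamma> t) u' u') w"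
      by (simp add: christoffel y_def)
    ultimately show "metric_tensor M (\<gamma> t) (acceleration M \<gamma> t) w = metric_tensor M (\<gamma> t) 0 w"
      unfolding acc a_def hy linear_neg[OF lin] metric.simps by simp
  qed
qed

end

section \<open>Existence of geodesics in every direction\<close>

lemma Ck_on_locally_lipschitz:
  fixes F :: "'x::euclidean_space \<Rightarrow> 'y::real_normed_vector"
  assumes S: "open S" "x0 \<in> S" and F: "Ck_on 1 S F" and e: "0 < e"
  obtains r L where "0 < r" "r \<le> e" "cball x0 r \<subseteq> S" "0 \<le> L"
    "\<And>x y. x \<in> cball x0 r \<Longrightarrow> y \<in> cball x0 r \<Longrightarrow> dist (F x) (F y) \<le> L * dist x y"
proof -
  obtain r0 where r0: "r0 > 0" "cball x0 r0 \<subseteq> S" using S open_contains_cball by blast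
  define r where "r = min r0 e"
  have r: "0 < r" "r \<le> e" "cball x0 r \<subseteq> S" using r0 e by (auto simp: r_def)
  have F1: "F differentiable (at x)" "continuous_on S (\<lambda>x. fderiv F x b)" if "x \<in> S" for x b
    using F that by auto
  have "\<exists>B. \<forall>x\<in>cball x0 r. norm (fderiv F x b) \<le> B" for b
  proof -
    have "continuous_on (cball x0 r) (\<lambda>x. fderiv F x b)"
      using F1(2)[OF S(2)] r(3) continuous_on_subset by blast
    then have "bounded ((\<lambda>x. fderiv F x b) ` cball x0 r)"
      by (intro compact_imp_bounded compact_continuous_image) auto
    then show ?thesis unfolding bounded_iff by blast
  qed
  then obtain B where B: "\<And>x b. x \<in> cball x0 r \<Longrightarrow> norm (fderiv F x b) \<le> B b" by metis
  define L where "L = (\<Sum>b\<in>Basis. \<bar>B b\<bar>)"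
  show ?thesis
  proof
    show "0 \<le> L" by (simp add: L_def sum_nonneg)
    fix x y assume xy: "x \<in> cball x0 r" "y \<in> cball x0 r"
    have "norm (F x - F y) \<le> L * norm (x - y)"
    proof (rule differentiable_bound[OF convex_cball _ _ xy])
      fix z assume z: "z \<in> cball x0 r"
      show d: "(F has_derivative fderiv F z) (at z within cball x0 r)"
        using F1(1) r(3) z by (blast intro: has_derivative_at_withinI fderiv_works)
      show "onorm (fderiv F z) \<le> L"
      proof (rule onorm_le)
        fix v
        have lin: "linear (fderiv F z)" using d has_derivative_linear by blast
        have "fderiv F z v = fderiv F z (\<Sum>b\<in>Basis. (v \<bullet> b) *\<^sub>R b)" by (simp add: euclidean_representation)
        also have "\<dots> = (\<Sum>b\<in>Basis. (v \<bullet> b) *\<^sub>R fderiv F z b)"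
          by (simp add: linear_sum[OF lin] linear_scale[OF lin])
        also have "norm \<dots> \<le> (\<Sum>b\<in>Basis. norm v * \<bar>B b\<bar>)"
          using B[OF z]
          by (intro order_trans[OF norm_sum] sum_mono)
            (auto simp: Basis_le_norm intro!: mult_mono intro: order_trans[OF _ abs_ge_self])
        also have "\<dots> = L * norm v" by (simp add: L_def sum_distrib_left mult.commute)
        finally show "norm (fderiv F z v) \<le> L * norm v" .
      qed
    qed
    then show "dist (F x) (F y) \<le> L * dist x y" by (simp add: dist_norm)
  qed (use r in auto)
qed

theorem (in riem_mfd) geodesic_exists:
  assumes "v \<noteq> 0"
  obtains a \<gamma> where "0 < a" "geodesic M {-a<..<a} \<gamma>" "\<gamma> 0 = p" "velocity M \<gamma> 0 = v"
    "\<And>t. t \<in> {-a<..<a} \<Longrightarrow> velocity M \<gamma> t \<noteq> 0"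
proof -
  define c where "c = chart_at M p"
  have c: "c \<in> atlas M" "p \<in> cdom c" by (auto simp: c_def)
  let ?S = "cmap c ` cdom c"
  \<comment> \<open>The geodesic equation as an autonomous first-order system for position and
    velocity in the chart \<open>c\<close>.\<close>
  define F where "F = (\<lambda>y. (snd y, - (case y of (x, u) \<Rightarrow> local_christoffel c x u u)))"
  have o: "open (?S \<times> (UNIV :: 'e set))" by (intro open_Times open_img c) simp
  have in0: "(cmap c p, v) \<in> ?S \<times> UNIV" using c by simp
  have F: "Ck_on 1 (?S \<times> UNIV) F"
    unfolding F_def by (intro Ck_on_Pair Ck_on_snd Ck_on_ident Ck_on_minus Ck_local_christoffel o c)
  \<comment> \<open>A radius of at most half of \<open>norm v\<close> keeps the velocity nonzero all
    along, as the Clairaut condition asks for.\<close>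
  obtain r L where r: "0 < r" "r \<le> norm v / 2" "cball (cmap c p, v) r \<subseteq> ?S \<times> UNIV"
    and L: "0 \<le> L" "\<And>x y. x \<in> cball (cmap c p, v) r \<Longrightarrow> y \<in> cball (cmap c p, v) r \<Longrightarrow> dist (F x) (F y) \<le> L *
      dist x y"
    by (rule Ck_on_locally_lipschitz[OF o in0 F, of "norm v / 2"]) (use assms in auto)
  obtain a Y where a: "0 < a" "Y 0 = (cmap c p, v)" "\<And>t. t \<in> {-a<..<a} \<Longrightarrow> Y t \<in> cball (cmap c p, v) r"
    "\<And>t. t \<in> {-a<..<a} \<Longrightarrow> (Y has_vector_derivative F (Y t)) (at t)"
    by (rule local_solution_exists[OF r(1) L(1), of "(cmap c p, v)" F, OF L(2)], assumption, assumption)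
      (rule that)
  let ?I = "{-a<..<a}"
  define X U where "X t = fst (Y t)" and "U t = snd (Y t)" for t
  have X: "(X has_vector_derivative U t) (at t)" if "t \<in> ?I" for t
    using bounded_linear.has_vector_derivative[OF bounded_linear_fst a(4)[OF that]]
    by (simp add: X_def[abs_def] U_def F_def)
  have U: "(U has_vector_derivative - local_christoffel c (X t) (U t) (U t)) (at t)" if "t \<in> ?I" for t
    using bounded_linear.has_vector_derivative[OF bounded_linear_snd a(4)[OF that]]
    by (simp add: X_def U_def[abs_def] F_def case_prod_beta)
  have YS: "Y t \<in> ?S \<times> UNIV" if "t \<in> ?I" for t using a(3)[OF that] r(3) by (rule subsetD[rotated])
  then have XS: "X t \<in> ?S" if "t \<in> ?I" for t using that by (simp add: X_def mem_Times_iff)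
  have U0: "U t \<noteq> 0" if "t \<in> ?I" for t
  proof
    assume "U t = 0"
    have "dist (snd (cmap c p, v)) (snd (Y t)) \<le> r" 
      using a(3)[OF that] by (intro order_trans[OF dist_snd_le]) simp
    then show False using r(1,2) \<open>U t = 0\<close> by (simp add: U_def)
  qed
  define \<gamma> where "\<gamma> t = cinv c (X t)" for t
  have \<gamma>: "\<gamma> t \<in> cdom c" "cmap c (\<gamma> t) = X t" if "t \<in> ?I" for t
    using XS[OF that] c(1) by (auto simp: \<gamma>_def)
  have contX: "continuous_on ?I X"
    using X has_vector_derivative_continuous continuous_at_imp_continuous_on by blast
  have cont\<gamma>: "continuous_on ?I \<gamma>"
    unfolding \<gamma>_def by (rule continuous_on_compose2[OF continuous_cinv[OF c(1)] contX]) (use XS in auto)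
  have dX: "((cmap c \<circ> \<gamma>) has_vector_derivative U t) (at t)" if "t \<in> ?I" for t
    using X[OF that] unfolding has_vector_derivative_def
    by (rule has_derivative_transform_within_open[OF _ open_greaterThanLessThan that]) (simp add: \<gamma>)
  have vel: "velocity M \<gamma> t = chart_to_tangent M c (\<gamma> t) (U t)" if "t \<in> ?I" for t
    using that \<gamma> dX by (intro velocity_in_chart[OF refl refl open_greaterThanLessThan _ cont\<gamma> c(1)]) auto
  have "Ck_on 2 ?I X"
    unfolding numeral_2_eq_2
  proof (rule Ck_on_SucI[OF open_greaterThanLessThan, where f' = "\<lambda>t h. h *\<^sub>R U t"])
    show "(X has_derivative (\<lambda>h. h *\<^sub>R U t)) (at t)" if "t \<in> ?I" for t
      using X[OF that] by (simp add: has_vector_derivative_def)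
    have "Ck_on (Suc 0) ?I U"
    proof (rule Ck_on_SucI[OF open_greaterThanLessThan, where f' = "\<lambda>t h. h *\<^sub>R snd (F (Y t))"])
      show "(U has_derivative (\<lambda>h. h *\<^sub>R snd (F (Y t)))) (at t)" if "t \<in> ?I" for t
        using U[OF that] by (simp add: has_vector_derivative_def F_def X_def U_def case_prod_beta)
      have "continuous_on ?I Y"
        using a(4) has_vector_derivative_continuous continuous_at_imp_continuous_on by blast
      then have "continuous_on ?I (\<lambda>t. F (Y t))"
        by (rule continuous_on_compose2[OF Ck_on_continuous[OF F]]) (use YS in blast)
      then show "Ck_on 0 ?I (\<lambda>t. h *\<^sub>R snd (F (Y t)))" for h
        by (auto intro!: continuous_intros)
    qed
    then show "Ck_on (Suc 0) ?I (\<lambda>t. h *\<^sub>R U t)" for h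
      by (intro Ck_on_scaleR Ck_on_const) auto
  qed
  have Ckd: "Ck_on 2 (?I \<inter> \<gamma> -` cdom d) (cmap d \<circ> \<gamma>)" if d: "d \<in> atlas M" for d
  proof -
    have oI: "open (?I \<inter> \<gamma> -` cdom d)"
      by (rule continuous_open_preimage[OF cont\<gamma> open_greaterThanLessThan open_cdom[OF d]])
    have "Ck_on 2 (?I \<inter> \<gamma> -` cdom d) (\<lambda>t. transition c d (X t))"
      by (rule Ck_on_compose[OF oI open_image_Int[OF c(1) open_cdom[OF d]] _ _ transition_Ck[OF c(1) d]])
        (use \<gamma> \<open>Ck_on 2 ?I X\<close> in \<open>auto intro: Ck_on_subset simp: image_iff Bex_def, metis\<close>)
    then show ?thesis by (rule Ck_on_cong[OF oI]) (auto simp: transition_def \<gamma>_def)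
  qed
  have "geodesic M ?I \<gamma>"
    unfolding geodesic_def
  proof (intro conjI ballI cont\<gamma> Ckd)
    show "acceleration M \<gamma> t = 0" if "t \<in> ?I" for t
      by (rule acceleration_zeroI[OF open_greaterThanLessThan that cont\<gamma> c(1) _ dX])
        (use \<gamma> U that in auto)
  qed (auto simp: is_interval_oo)
  moreover have "\<gamma> 0 = p" using a c by (simp add: \<gamma>_def X_def)
  moreover have "velocity M \<gamma> 0 = v" using vel[of 0] a c(2) \<open>\<gamma> 0 = p\<close> by (simp add: U_def c_def)
  moreover have "velocity M \<gamma> t \<noteq> 0" if "t \<in> ?I" for t
    using vel[OF that] U0[OF that] ttc_ctt[OF c(1) \<gamma>(1)[OF that], of "U t"]
      linear_0[OF linear_ttc[OF c(1) \<gamma>(1)[OF that]]] by metis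
  ultimately show ?thesis using that a(1) by blast
qed

section \<open>Fibers\<close>

subsection \<open>Orthonormal bases for a positive definite form\<close>

lemma (in pos_def_form) bilinear_sum_left: "g (\<Sum>i\<in>I. f i) w = (\<Sum>i\<in>I. g (f i) w)"
  using bil linear_sum[of "\<lambda>u. g u w" f I] by (simp add: bilinear_def)

lemma (in pos_def_form) bilinear_sum_right: "g w (\<Sum>i\<in>I. f i) = (\<Sum>i\<in>I. g w (f i))"
  using bil linear_sum[of "g w" f I] by (simp add: bilinear_def)

text \<open>Gram-Schmidt for \<open>g\<close> in place of the ambient inner product, one vector at a
  time.\<close>

lemma (in pos_def_form) orthonormal_basis_exists:
  assumes V: "subspace V"
  obtains e where "\<And>i. i < dim V \<Longrightarrow> e i \<in> V"
    "\<And>i j. i < dim V \<Longrightarrow> j < dim V \<Longrightarrow> g (e i) (e j) = (if i = j then 1 else 0)"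
proof -
  have "\<exists>e. (\<forall>i<n. e i \<in> V) \<and> (\<forall>i<n. \<forall>j<n. g (e i) (e j) = (if i = j then 1 else 0))" if "n \<le> dim V" for n
    using that
  proof (induction n)
    case (Suc n)
    then obtain e where e: "\<forall>i<n. e i \<in> V" "\<forall>i<n. \<forall>j<n. g (e i) (e j) = (if i = j then 1 else 0)" by auto
    have "dim (e ` {..<n}) \<le> card (e ` {..<n})" by (rule dim_le_card') simp
    also have "\<dots> \<le> n" using card_image_le[of "{..<n}" e] by simp
    finally have "dim (span (e ` {..<n})) < dim V" using Suc.prems by simp
    then obtain v where v: "v \<in> V" "v \<notin> span (e ` {..<n})"
      by (metis dim_subset not_less subsetI)
    define p where "p = (\<Sum>i<n. g v (e i) *\<^sub>R e i)"
    have p: "p \<in> span (e ` {..<n})" unfolding p_def by (intro span_sum span_mul span_base) auto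
    have pV: "p \<in> V" unfolding p_def using e V by (intro subspace_sum subspace_scale) auto
    have gp: "g (v - p) (e j) = 0" if "j < n" for j
    proof -
      have "g p (e j) = (\<Sum>i<n. g v (e i) * g (e i) (e j))"
        by (simp add: simps p_def bilinear_sum_left)
      also have "\<dots> = (\<Sum>i<n. if i = j then g v (e i) else 0)"
        using that e(2) by (intro sum.cong) auto
      finally show ?thesis using that by (simp add: simps)
    qed
    have nz: "v - p \<noteq> 0" using v p by auto
    define d where "d = v - p"
    define w where "w = d /\<^sub>R sqrt (g d d)"
    have w: "w \<in> V" unfolding w_def d_def using v pV V by (intro subspace_scale subspace_diff)
    have d: "g d d > 0" "g d (e j) = 0" "g (e j) d = 0" if "j < n" for j
      using pos[OF nz] gp[OF that] sym[of "e j" "v - p"] by (simp_all add: d_def)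
    then have gw: "g w (e j) = 0" "g (e j) w = 0" if "j < n" for j
      using that by (simp_all add: w_def simps(5,6))
    have "g d d > 0" using pos[OF nz] by (simp add: d_def)
    then have gw1: "g w w = 1" by (simp add: w_def simps(5,6) flip: inverse_mult_distrib mult.assoc)
    show ?case
      using e w gw gw1 by (intro exI[of _ "e(n := w)"]) (auto simp: less_Suc_eq)
  qed simp
  from this[of "dim V"] that show ?thesis by auto
qed

text \<open>Orthonormality makes the family independent and its size makes it spanning, so
  \<open>v\<close> expands in it. This is the tool for the traces in
  \<open>partial_trace\<close>.\<close>

lemma (in pos_def_form) parseval:
  assumes V: "subspace V" and e: "\<And>i. i < dim V \<Longrightarrow> e i \<in> V"
    "\<And>i j. i < dim V \<Longrightarrow> j < dim V \<Longrightarrow> g (e i) (e j) = (if i = j then 1 else 0)"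
    and v: "v \<in> V"
  shows "(\<Sum>i<dim V. (g v (e i))\<^sup>2) = g v v"
proof -
  let ?n = "dim V"
  have inj: "inj_on e {..<?n}"
    using e(2) by (intro inj_onI) (metis lessThan_iff zero_neq_one)
  have "independent (e ` {..<?n})"
    unfolding independent_explicit_module
  proof (intro allI impI)
    fix t u and w assume t: "finite t" "t \<subseteq> e ` {..<?n}" "(\<Sum>w\<in>t. u w *\<^sub>R w) = 0" "w \<in> t"
    then obtain j where j: "j < ?n" "w = e j" by auto
    have "0 = g (\<Sum>w\<in>t. u w *\<^sub>R w) w" by (simp add: t(3) simps)
    also have "\<dots> = (\<Sum>x\<in>t. u x * g x w)" by (simp add: bilinear_sum_left simps)
    also have "\<dots> = (\<Sum>x\<in>t. if x = w then u x else 0)"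
    proof (rule sum.cong[OF refl])
      fix x assume "x \<in> t"
      then obtain i where "i < ?n" "x = e i" using t by auto
      then show "u x * g x w = (if x = w then u x else 0)" using j e(2)[of i j] inj by (auto simp: inj_on_def)
    qed
    finally show "u w = 0" using t by simp
  qed
  moreover have "card (e ` {..<?n}) = ?n" by (simp add: card_image inj)
  ultimately have "V \<subseteq> span (e ` {..<?n})"
    using e(1) by (intro card_ge_dim_independent) auto
  then have "v \<in> span (e ` {..<?n})" using v by blast
  then obtain a where "v = (\<Sum>w\<in>e ` {..<?n}. a w *\<^sub>R w)" by (auto simp: span_finite)
  then have v: "v = (\<Sum>i<?n. a (e i) *\<^sub>R e i)" by (simp add: sum.reindex[OF inj])
  have c: "g v (e j) = a (e j)" if "j < ?n" for j
  proof -
    have "g v (e j) = (\<Sum>i<?n. a (e i) * g (e i) (e j))"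
      by (subst v) (simp add: bilinear_sum_left simps)
    also have "\<dots> = (\<Sum>i<?n. if i = j then a (e i) else 0)"
      using that e(2) by (intro sum.cong) auto
    finally show ?thesis using that by simp
  qed
  have "g v v = (\<Sum>i<?n. a (e i) * g v (e i))"
    by (subst (2) v) (simp add: bilinear_sum_right simps)
  then show ?thesis using c by (simp add: power2_eq_square)
qed

subsection \<open>Horizontal and vertical parts\<close>

lemma restrict_vertical_field:
  "vertical_field_on M N \<phi> W V \<Longrightarrow> W' \<subseteq> W \<Longrightarrow> vertical_field_on M N \<phi> W' V"
proof -
  assume V: "vertical_field_on M N \<phi> W V" and sub: "W' \<subseteq> W"
  have "cmap c ` (cdom c \<inter> W') \<subseteq> cmap c ` (cdom c \<inter> W)" for c using sub by auto
  then show ?thesis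
    using V sub unfolding vertical_field_on_def smooth_field_on_def smooth_on_def
    by (meson Ck_on_subset subsetD)
qed

text \<open>What the factors and the product have in common. The product map enters here through the
  splittings of its factors, since it need not be a Riemannian map.\<close>

locale hv_split = riem_mfd M
  for M :: "('a::{t2_space,second_countable_topology}, 'e::euclidean_space) riemannian" +
  fixes N :: "('b::{t2_space,second_countable_topology}, 'f::euclidean_space) riemannian"
    and \<phi> :: "'a \<Rightarrow> 'b"
  assumes linear_differential: "linear (differential M N \<phi> p)"
    and split_exists: "\<exists>h\<in>horizontal M N \<phi> p. x - h \<in> vertical M N \<phi> p"
begin

abbreviation "vert \<equiv> vertical M N \<phi>"
abbreviation "horiz \<equiv> horizontal M N \<phi>"
abbreviation "hproj \<equiv> hor M N \<phi>"
abbreviation "met \<equiv> metric_tensor M"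

definition vproj :: "'a \<Rightarrow> 'e \<Rightarrow> 'e" where "vproj p x = x - hproj p x"

lemma subspace_vert: "subspace (vert p)"
  unfolding vertical_def by (rule linear_subspace_kernel[OF linear_differential])

lemma subspace_horiz: "subspace (horiz p)"
  unfolding horizontal_def by (rule subspaceI) (auto simp: metric.simps)

lemma horiz_vert: "h \<in> horiz p \<Longrightarrow> v \<in> vert p \<Longrightarrow> met p h v = 0"
  and vert_horiz: "h \<in> horiz p \<Longrightarrow> v \<in> vert p \<Longrightarrow> met p v h = 0"
  by (auto simp: horizontal_def sym_metric[of p v h])

lemma split_unique:
  assumes "h \<in> horiz p" "h' \<in> horiz p" "x - h \<in> vert p" "x - h' \<in> vert p"
  shows "h = h'"
proof -
  have "(x - h') - (x - h) \<in> vert p" "h - h' \<in> horiz p"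
    by (rule subspace_diff[OF subspace_vert assms(4,3)]) (rule subspace_diff[OF subspace_horiz assms(1,2)])
  then have "met p (h - h') (h - h') = 0" using horiz_vert by fastforce
  then show ?thesis by (simp add: metric.zero_iff)
qed

lemma hproj_horiz: "hproj p x \<in> horiz p" and vproj_vert: "vproj p x \<in> vert p"
proof -
  obtain h where "h \<in> horiz p" "x - h \<in> vert p" using split_exists by blast
  then have "hproj p x \<in> horiz p \<and> x - hproj p x \<in> vert p"
    unfolding hor_def by (intro theI[of "\<lambda>h. h \<in> horiz p \<and> x - h \<in> vert p" h]) (blast intro: split_unique)+
  then show "hproj p x \<in> horiz p" "vproj p x \<in> vert p" by (auto simp: vproj_def)
qed

lemma hproj_eqI: "h \<in> horiz p \<Longrightarrow> x - h \<in> vert p \<Longrightarrow> hproj p x = h"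
  using split_unique hproj_horiz vproj_vert unfolding vproj_def by blast

lemma split_sum: "x = vproj p x + hproj p x" by (simp add: vproj_def)

lemma met_hproj: "h \<in> horiz p \<Longrightarrow> met p (hproj p x) h = met p x h"
  using split_sum[of x p] vert_horiz[OF _ vproj_vert, of h p x] metric.simps(1)[of p "vproj p x" "hproj
    p x" h] by simp

lemma met_split: "met p x x = met p (vproj p x) (vproj p x) + met p (hproj p x) (hproj p x)"
proof -
  have "met p x x = met p (vproj p x + hproj p x) (vproj p x + hproj p x)" using split_sum by metis
  then show ?thesis using horiz_vert[OF hproj_horiz vproj_vert] vert_horiz[OF hproj_horiz vproj_vert]
    by (simp add: metric.simps)
qed

lemma horiz_eqI:
  assumes "a \<in> horiz p" "b \<in> horiz p" "\<And>h. h \<in> horiz p \<Longrightarrow> met p a h = met p b h"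
  shows "a = b"
proof -
  have "a - b \<in> horiz p" using assms subspace_horiz subspace_diff by blast
  then have "met p (a - b) (a - b) = 0" using assms(3)[of "a - b"] by (simp add: metric.simps)
  then show ?thesis by (simp add: metric.zero_iff)
qed

text \<open>Pythagoras for the splitting turns the sine into the root of a ratio of energies, which
  can be followed along geodesics.\<close>

lemma sin_horizontal_angle:
  assumes "v \<noteq> 0"
  shows "sin (horizontal_angle M N \<phi> p v) = sqrt (met p (vproj p v) (vproj p v) / met p v v)"
proof -
  let ?a = "met p (hproj p v) (hproj p v)" and ?b = "met p v v"
  have b: "?b > 0" using pos_metric assms by simp
  have a: "0 \<le> ?a" "?a \<le> ?b" using met_split[of p v] metric.nonneg[of p] by (simp_all add: add_increasing)
  have eq: "tnorm M p (hproj p v) / tnorm M p v = sqrt (?a / ?b)"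
    by (simp add: tnorm_def real_sqrt_divide)
  have r: "0 \<le> ?a / ?b" "?a / ?b \<le> 1" using a b by auto
  then have s: "0 \<le> sqrt (?a / ?b)" "sqrt (?a / ?b) \<le> 1" by (auto simp: real_sqrt_le_1_iff)
  then have "sin (arccos (sqrt (?a / ?b))) = sqrt (1 - (sqrt (?a / ?b))\<^sup>2)"
    by (intro sin_arccos) linarith+
  also have "(sqrt (?a / ?b))\<^sup>2 = ?a / ?b" using r(1) by (rule real_sqrt_pow2)
  also have "1 - ?a / ?b = met p (vproj p v) (vproj p v) / ?b"
    using b met_split[of p v] by (simp add: field_simps)
  finally show ?thesis by (simp add: horizontal_angle_def eq)
qed

lemma dim_vert_pos: "vert p \<noteq> {0} \<Longrightarrow> dim (vert p) > 0"
  using subspace_0[OF subspace_vert, of p] dim_eq_0[of "vert p"] by auto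

text \<open>Differentiating \<open>\<kappa>(V, h) = 0\<close>, for a form \<open>\<kappa>\<close> with vertical kernel that agrees
  with the metric on horizontal vectors, determines the horizontal part of the covariant derivative.\<close>

lemma covariant_derivative_horiz:
  assumes W: "open W" "p \<in> W" and V: "smooth_field_on M W V"
    and \<kappa>: "form_field S (local_form M \<kappa> (chart_at M p))" "cmap (chart_at M p) p \<in> S"
    and ker: "\<And>q w. q \<in> W \<Longrightarrow> \<kappa> q (V q) w = 0"
    and h: "\<And>w. \<kappa> p w h = met p w h"
  shows "met p (covariant_derivative M U V p) h =
    koszul (local_metric M (chart_at M p)) (cmap (chart_at M p) p) (U p) (V p) h / 2
    - dform (local_form M \<kappa> (chart_at M p)) (cmap (chart_at M p) p) (U p) (V p) h"
proof -
  define c where "c = chart_at M p"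
  define x where "x = cmap c p"
  have c: "c \<in> atlas M" "p \<in> cdom c" by (auto simp: c_def)
  interpret form_field S "local_form M \<kappa> c" using \<kappa>(1) by (simp add: c_def)
  define V' where "V' y = tangent_to_chart M c (cinv c y) (V (cinv c y))" for y
  have S1: "open (cmap c ` (cdom c \<inter> W))" by (rule open_image_Int[OF c(1) W(1)])
  have x1: "x \<in> cmap c ` (cdom c \<inter> W)" using c W by (auto simp: x_def)
  have dV: "V' differentiable (at x)"
    using V c(1) x1 smooth_on_differentiable unfolding smooth_field_on_def V'_def by blast
  have "((\<lambda>y. local_form M \<kappa> c y (V' y) h) has_derivative
      (\<lambda>a. dform (local_form M \<kappa> c) x a (V' x) h + local_form M \<kappa> c x (fderiv V' x a) h
        + local_form M \<kappa> c x (V' x) 0)) (at x)"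
    by (rule has_derivative_form[OF has_derivative_ident fderiv_works[OF dV] has_derivative_const])
      (use \<kappa>(2) in \<open>simp add: x_def c_def\<close>)
  moreover have "((\<lambda>y. local_form M \<kappa> c y (V' y) h) has_derivative (\<lambda>a. 0)) (at x)"
  proof (rule has_derivative_transform_within_open[OF has_derivative_const S1 x1])
    show "0 = local_form M \<kappa> c y (V' y) h" if "y \<in> cmap c ` (cdom c \<inter> W)" for y
      using that c(1) ker by (auto simp: V'_def local_form_cmap)
  qed
  ultimately have "(\<lambda>a. dform (local_form M \<kappa> c) x a (V' x) h + local_form M \<kappa> c x (fderiv V' x a) h
        + local_form M \<kappa> c x (V' x) 0) = (\<lambda>a. 0)"
    by (rule has_derivative_unique)
  from fun_cong[OF this, of "U p"]
  have "dform (local_form M \<kappa> c) x (U p) (V' x) h + local_form M \<kappa> c x (fderiv V' x (U p)) h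
        + local_form M \<kappa> c x (V' x) 0 = 0" .
  moreover have "V' x = V p" using c by (simp add: V'_def x_def c_def)
  moreover have lf: "local_form M \<kappa> c x = \<kappa> p" by (simp add: x_def c_def)
  moreover have "bilinear (\<kappa> p)" using bilin[of x] \<kappa>(2) lf by (simp add: x_def c_def)
  ultimately have "met p (fderiv V' x (U p)) h = - dform (local_form M \<kappa> c) x (U p) (V p) h"
    using h bilinear_rzero by force
  moreover have "met p (covariant_derivative M U V p) h = met p (fderiv V' x (U p)) h + met p
    (christoffel M p (U p) (V p)) h"
    by (simp add: covariant_derivative_def Let_def V'_def[abs_def] x_def c_def metric.simps)
  ultimately show ?thesis using christoffel[of p "U p" "V p" h] by (simp add: c_def x_def)
qed

text \<open>\<open>mean_curvature\<close> is a description over all local frames that are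
  orthonormal at \<open>p\<close>. Every such frame must give \<open>w\<close>, and one must exist:
  orthonormal basis vectors are extended one by one and restricted to a common
  neighbourhood.\<close>

lemma mean_curvature_eqI:
  assumes ext: "\<And>e. e \<in> vert p \<Longrightarrow> \<exists>W V. open W \<and> p \<in> W \<and> vertical_field_on M N \<phi> W V \<and> V p = e"
    and val: "\<And>W E. open W \<Longrightarrow> p \<in> W \<Longrightarrow> \<forall>i<dim (vert p). vertical_field_on M N \<phi> W (E i) \<Longrightarrow>
      \<forall>i<dim (vert p). \<forall>j<dim (vert p). met p (E i p) (E j p) = (if i = j then 1 else 0) \<Longrightarrow>
      (1 / real (dim (vert p))) *\<^sub>R (\<Sum>i<dim (vert p). T_tensor M N \<phi> (E i) (E i) p) = w"
  shows "mean_curvature M N \<phi> p = w"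
proof -
  let ?m = "dim (vert p)"
  obtain e where e: "\<And>i. i < ?m \<Longrightarrow> e i \<in> vert p"
    "\<And>i j. i < ?m \<Longrightarrow> j < ?m \<Longrightarrow> met p (e i) (e j) = (if i = j then 1 else 0)"
    using metric.orthonormal_basis_exists[OF subspace_vert] by metis
  have "\<forall>i. \<exists>W V. i < ?m \<longrightarrow> open W \<and> p \<in> W \<and> vertical_field_on M N \<phi> W V \<and> V p = e i"
    using ext e(1) by blast
  then obtain W E where WE: "\<And>i. i < ?m \<Longrightarrow> open (W i) \<and> p \<in> W i \<and> vertical_field_on M N \<phi> (W i) (E i) \<and> E
    i p = e i"
    by metis
  define W' where "W' = (\<Inter>i\<in>{..<?m}. W i)"
  have W': "open W'" "p \<in> W'" unfolding W'_def using WE by (auto intro!: open_INT)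
  have vf: "\<forall>i<?m. vertical_field_on M N \<phi> W' (E i)"
  proof (intro allI impI)
    fix i assume i: "i < ?m"
    have "W' \<subseteq> W i" using i by (auto simp: W'_def)
    then show "vertical_field_on M N \<phi> W' (E i)" using WE[OF i] restrict_vertical_field by blast
  qed
  have on: "\<forall>i<?m. \<forall>j<?m. met p (E i p) (E j p) = (if i = j then 1 else 0)"
    using WE e(2) by simp
  show ?thesis
    unfolding mean_curvature_def Let_def
  proof (rule the_equality)
    show "\<exists>W E. open W \<and> p \<in> W \<and> (\<forall>i<?m. vertical_field_on M N \<phi> W (E i)) \<and>
        (\<forall>i<?m. \<forall>j<?m. met p (E i p) (E j p) = (if i = j then 1 else 0)) \<and>
        w = (1 / real ?m) *\<^sub>R (\<Sum>i<?m. T_tensor M N \<phi> (E i) (E i) p)"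
      using W' vf on val[OF W' vf on] by blast
  qed (use val in blast)
qed

end

section \<open>Riemannian maps\<close>

text \<open>For \<open>w\<close> in the kernel, \<open>\<beta> y w w\<close> is nonnegative and
  vanishes at \<open>x\<close>, so \<open>x\<close> is a minimum and the derivative is zero;
  polarization with \<open>u + v\<close> gives the mixed case.\<close>

lemma psd_dform_zero:
  assumes ff: "form_field S \<beta>" and x: "x \<in> S"
    and psd: "\<And>y u. y \<in> S \<Longrightarrow> \<beta> y u u \<ge> 0" and sym: "\<And>y u v. y \<in> S \<Longrightarrow> \<beta> y u v = \<beta> y v u"
    and ker: "\<And>w. \<beta> x u w = 0" "\<And>w. \<beta> x v w = 0"
  shows "dform \<beta> x a u v = 0"
proof -
  interpret form_field S \<beta> by fact
  have diag: "dform \<beta> x a w w = 0" if "\<beta> x w w = 0" for w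
  proof -
    have "\<forall>\<^sub>F y in at x. \<beta> x w w \<le> \<beta> y w w"
      using eventually_at_in_open'[OF open_S x] by eventually_elim (simp add: that psd)
    from has_derivative_local_min[OF has_deriv[OF x] this] show ?thesis by meson
  qed
  have s: "dform \<beta> x a v u = dform \<beta> x a u v" by (rule dform_commute[OF sym open_S x])
  have "\<beta> x (u + v) (u + v) = 0" by (simp add: bilinear_ladd[OF bilin[OF x]] ker)
  then have "dform \<beta> x a (u + v) (u + v) = 0" by (rule diag)
  then show ?thesis
    using diag[of u] diag[of v] ker s by (simp add: dform_add_l[OF x] dform_add_r[OF x])
qed

lemma form_field_diff:
  assumes "form_field S \<beta>" "form_field S \<gamma>"
  shows "form_field S (\<lambda>x u v. \<beta> x u v - \<gamma> x u v)"
    and "x \<in> S \<Longrightarrow> dform (\<lambda>x u v. \<beta> x u v - \<gamma> x u v) x a u v = dform \<beta> x a u v - dform \<gamma> x a u v"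
proof -
  interpret B: form_field S \<beta> by fact
  interpret C: form_field S \<gamma> by fact
  show D: "form_field S (\<lambda>x u v. \<beta> x u v - \<gamma> x u v)"
  proof
    show "bilinear (\<lambda>u v. \<beta> x u v - \<gamma> x u v)" if "x \<in> S" for x
      using B.bilin[OF that] C.bilin[OF that]
      unfolding bilinear_def by (auto intro: linear_compose_sub)
    show "(\<lambda>y. \<beta> y u v - \<gamma> y u v) differentiable (at x)" if "x \<in> S" for x u v
      using B.diffble[OF that] C.diffble[OF that] by (rule differentiable_diff)
  qed (rule B.open_S)
  interpret D: form_field S "\<lambda>x u v. \<beta> x u v - \<gamma> x u v" by (rule D)
  show "dform (\<lambda>x u v. \<beta> x u v - \<gamma> x u v) x a u v = dform \<beta> x a u v - dform \<gamma> x a u v" if "x \<in> S"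
    by (rule D.dform_unique[OF that has_derivative_diff[OF B.has_deriv[OF that] C.has_deriv[OF that]]])
qed

subsection \<open>Smooth maps in charts\<close>

locale smooth_map_pair = M: smooth_mfd M + N: smooth_mfd N
  for M :: "('a::{t2_space,second_countable_topology}, 'e::euclidean_space, 'z) manifold_scheme"
    and N :: "('b::{t2_space,second_countable_topology}, 'f::euclidean_space, 'y) manifold_scheme" +
  fixes \<phi> :: "'a \<Rightarrow> 'b"
  assumes smooth_\<phi>: "smooth_map M N \<phi>"
begin

definition "rep c d = cmap d \<circ> \<phi> \<circ> cinv c"

definition "overlap c d = cdom c \<inter> \<phi> -` cdom d"

lemma open_overlap: "c \<in> atlas M \<Longrightarrow> d \<in> atlas N \<Longrightarrow> open (overlap c d)"
  using smooth_\<phi> unfolding smooth_map_def overlap_def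
  by (intro open_Int M.open_cdom continuous_open_vimage)
    (auto simp: N.open_cdom continuous_on_eq_continuous_within)

lemma open_overlap_image: "c \<in> atlas M \<Longrightarrow> d \<in> atlas N \<Longrightarrow> open (cmap c ` overlap c d)"
  by (intro M.open_image open_overlap) (auto simp: overlap_def)

lemma rep_Ck: "c \<in> atlas M \<Longrightarrow> d \<in> atlas N \<Longrightarrow> Ck_on k (cmap c ` overlap c d) (rep c d)"
  using smooth_\<phi> unfolding smooth_map_def overlap_def rep_def by (simp add: smooth_on_Ck)

lemma rep_deriv:
  assumes "c \<in> atlas M" "d \<in> atlas N" "q \<in> cdom c" "\<phi> q \<in> cdom d"
  shows "(rep c d has_derivative fderiv (rep c d) (cmap c q)) (at (cmap c q))"
  using rep_Ck[OF assms(1,2), of 1] assms(3,4)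
  by (intro fderiv_works) (simp add: overlap_def)

lemma differential_eq: "differential M N \<phi> q = fderiv (rep (chart_at M q) (chart_at N (\<phi> q))) (cmap
  (chart_at M q) q)"
  by (simp add: differential_def rep_def)

lemma linear_differential: "linear (differential M N \<phi> q)"
  unfolding differential_eq using rep_deriv[of "chart_at M q" "chart_at N (\<phi> q)" q]
    has_derivative_linear by simp

lemma rep_change:
  assumes c: "c \<in> atlas M" "c' \<in> atlas M" "q \<in> cdom c" "q \<in> cdom c'"
    and d: "d \<in> atlas N" "d' \<in> atlas N" "\<phi> q \<in> cdom d" "\<phi> q \<in> cdom d'"
  shows "fderiv (rep c d) (cmap c q) v =
    fderiv (transition d' d) (cmap d' (\<phi> q)) (fderiv (rep c' d') (cmap c' q) (fderiv (transition c c')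
      (cmap c q) v))"
proof -
  let ?x = "cmap c q"
  have x: "transition c c' ?x = cmap c' q" "rep c' d' (cmap c' q) = cmap d' (\<phi> q)"
    using c d by (auto simp: transition_def rep_def)
  have "(transition d' d \<circ> (rep c' d' \<circ> transition c c') has_derivative
      fderiv (transition d' d) (cmap d' (\<phi> q)) \<circ> (fderiv (rep c' d') (cmap c' q) \<circ> fderiv (transition c
        c') ?x)) (at ?x)"
    using M.transition_deriv[of c c' q] N.transition_deriv[of d' d "\<phi> q"] rep_deriv[of c' d' q] c d x
    by (intro diff_chain_at) simp_all
  moreover have "open (cmap c ` (cdom c \<inter> (overlap c' d' \<inter> overlap c d)))"
    using c d by (intro M.open_image_Int open_Int open_overlap)
  ultimately have "(rep c d has_derivative
      fderiv (transition d' d) (cmap d' (\<phi> q)) \<circ> (fderiv (rep c' d') (cmap c' q) \<circ> fderiv (transition c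
        c') ?x)) (at ?x)"
    by (rule has_derivative_transform_within_open) (use c d in \<open>auto simp: transition_def rep_def overlap_def\<close>)
  then show ?thesis by (simp add: fderiv_eq[of "rep c d"])
qed

lemma rep_differential:
  assumes "c \<in> atlas M" "d \<in> atlas N" "q \<in> cdom c" "\<phi> q \<in> cdom d"
  shows "fderiv (rep c d) (cmap c q) v = tangent_to_chart N d (\<phi> q) (differential M N \<phi> q
    (chart_to_tangent M c q v))"
  using rep_change[of c "chart_at M q" q d "chart_at N (\<phi> q)" v] assms
  by (simp add: differential_eq M.ctt_eq N.ttc_eq)

end

section \<open>Horizontal and vertical parts of the metric of a Riemannian map\<close>

locale riem_map = M: riem_mfd M + N: riem_mfd N
  for M :: "('a::{t2_space,second_countable_topology}, 'e::euclidean_space) riemannian"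
    and N :: "('b::{t2_space,second_countable_topology}, 'f::euclidean_space) riemannian" +
  fixes \<phi> :: "'a \<Rightarrow> 'b"
  assumes riem: "riemannian_map M N \<phi>"
begin

sublocale smooth_map_pair M N \<phi>
  using riem by unfold_locales (simp add: riemannian_map_def)

abbreviation "d\<phi> \<equiv> differential M N \<phi>"

sublocale hv_split M N \<phi>
proof (intro_locales, rule hv_split_axioms.intro)
  show "linear (d\<phi> p)" for p by (rule linear_differential)
  show "\<exists>h\<in>horizontal M N \<phi> p. x - h \<in> vertical M N \<phi> p" for p x
  proof -
    have "d\<phi> p x \<in> d\<phi> p ` horizontal M N \<phi> p" using riem by (simp add: riemannian_map_def)
    then obtain h where "h \<in> horizontal M N \<phi> p" "d\<phi> p h = d\<phi> p x" by auto
    then show ?thesis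
      by (intro bexI[of _ h]) (simp_all add: vertical_def linear_diff[OF linear_differential])
  qed
qed

text \<open>The form \<open>k\<close> of the overview; \<open>vform\<close> below is
  \<open>l\<close>.\<close>

definition hform :: "'a \<Rightarrow> 'e \<Rightarrow> 'e \<Rightarrow> real" where
  "hform q u v = metric_tensor N (\<phi> q) (d\<phi> q u) (d\<phi> q v)"

definition vform :: "'a \<Rightarrow> 'e \<Rightarrow> 'e \<Rightarrow> real" where
  "vform q u v = met q u v - hform q u v"

lemma hform_sym: "hform q u v = hform q v u" by (simp add: hform_def N.sym_metric)

lemma vform_sym: "vform q u v = vform q v u" by (simp add: vform_def hform_sym M.sym_metric)

lemma d\<phi>_hproj: "d\<phi> q (hproj q x) = d\<phi> q x"
  using vproj_vert[of q x] by (simp add: vproj_def vertical_def linear_diff[OF linear_differential])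

text \<open>The isometry condition enters here: the differential ignores the vertical parts and
  preserves products of the horizontal ones.\<close>

lemma hform_eq: "hform q u v = met q (hproj q u) v"
proof -
  have "hform q u v = metric_tensor N (\<phi> q) (d\<phi> q (hproj q u)) (d\<phi> q (hproj q v))"
    by (simp add: hform_def d\<phi>_hproj)
  also have "\<dots> = met q (hproj q u) (hproj q v)"
    using riem hproj_horiz by (simp add: riemannian_map_def)
  also have "\<dots> = met q (hproj q u) v"
    using met_hproj[OF hproj_horiz, of q v u] by (simp add: M.sym_metric)
  finally show ?thesis .
qed

lemma vform_eq: "vform q u v = met q (vproj q u) v"
  by (simp add: vform_def hform_eq vproj_def M.metric.simps)

lemma vert_hform: "v \<in> vert q \<Longrightarrow> hform q v w = 0"
  by (simp add: hform_def vertical_def N.metric.simps)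

lemma horiz_hform: "h \<in> horiz q \<Longrightarrow> hform q w h = met q w h"
  using met_hproj[of h q w] by (simp add: hform_eq)

lemma horiz_vform: "h \<in> horiz q \<Longrightarrow> vform q h w = 0"
  using horiz_hform[of h q w] by (simp add: vform_def hform_sym[of q h] M.sym_metric[of q h])

lemma hform_nonneg: "hform q u u \<ge> 0"
  by (simp add: hform_def N.metric.nonneg)

lemma vform_vproj: "vform q u u = met q (vproj q u) (vproj q u)"
  using vert_horiz[OF hproj_horiz vproj_vert, of q u u] split_sum[of u q]
    M.metric.simps(2)[of q "vproj q u" "vproj q u" "hproj q u"] by (simp add: vform_eq)

lemma vform_nonneg: "vform q u u \<ge> 0"
  by (simp add: vform_vproj M.metric.nonneg)

abbreviation "hloc \<equiv> local_form M hform"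
abbreviation "vloc \<equiv> local_form M vform"

lemma hloc_pullback:
  assumes "c \<in> atlas M" "d \<in> atlas N" "y \<in> cmap c ` overlap c d"
  shows "hloc c y u v = local_metric N d (rep c d y) (fderiv (rep c d) y u) (fderiv (rep c d) y v)"
proof -
  obtain q where q: "q \<in> cdom c" "\<phi> q \<in> cdom d" "y = cmap c q" using assms(3) by (auto simp: overlap_def)
  then have "rep c d y = cmap d (\<phi> q)" using assms(1) by (simp add: rep_def)
  then show ?thesis
    using assms q by (simp add: M.local_form_cmap local_metric_eq N.local_form_cmap rep_differential hform_def)
qed

lemma rep_image: "c \<in> atlas M \<Longrightarrow> rep c d ` (cmap c ` overlap c d) \<subseteq> cmap d ` cdom d"
  by (auto simp: rep_def overlap_def)

lemma hloc_sym: "hloc c y u v = hloc c y v u"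
  by (simp add: local_form_def hform_sym)

lemma vloc_sym: "vloc c y u v = vloc c y v u"
  by (simp add: local_form_def vform_sym)

lemma form_field_hloc_overlap: "c \<in> atlas M \<Longrightarrow> d \<in> atlas N \<Longrightarrow> form_field (cmap c ` overlap c d) (hloc c)"
  by (rule form_field_pullback[OF N.form_field_local_metric N.local_metric_sym open_overlap_image rep_Ck
    rep_image])
    (auto intro: hloc_pullback)

lemma overlap_cover:
  assumes "x \<in> cmap c ` cdom c"
  obtains d where "d \<in> atlas N" "x \<in> cmap c ` overlap c d"
proof -
  obtain q where "q \<in> cdom c" "x = cmap c q" using assms by blast
  then show ?thesis using that[of "chart_at N (\<phi> q)"] by (simp add: overlap_def)
qed

lemma form_field_hloc:
  assumes c: "c \<in> atlas M" shows "form_field (cmap c ` cdom c) (hloc c)"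
proof
  fix x assume "x \<in> cmap c ` cdom c"
  then obtain d where d: "d \<in> atlas N" "x \<in> cmap c ` overlap c d" by (rule overlap_cover)
  interpret form_field "cmap c ` overlap c d" "hloc c" by (rule form_field_hloc_overlap[OF c d(1)])
  show "bilinear (hloc c x)" "(\<lambda>y. hloc c y u v) differentiable (at x)" for u v
    using bilin diffble d by auto
qed (rule M.open_img[OF c])

lemma vloc_eq: "vloc c = (\<lambda>x u v. local_metric M c x u v - hloc c x u v)"
  by (intro ext) (simp add: local_metric_eq local_form_def vform_def)

lemma form_field_vloc: "c \<in> atlas M \<Longrightarrow> form_field (cmap c ` cdom c) (vloc c)"
  unfolding vloc_eq by (intro form_field_diff M.form_field_local_metric form_field_hloc)

lemma dform_vloc: "c \<in> atlas M \<Longrightarrow> x \<in> cmap c ` cdom c \<Longrightarrow>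
    dform (vloc c) x a u v = dform (local_metric M c) x a u v - dform (hloc c) x a u v"
  unfolding vloc_eq by (rule form_field_diff(2)[OF M.form_field_local_metric form_field_hloc])

lemma hloc_Ck:
  assumes c: "c \<in> atlas M" shows "Ck_on k (cmap c ` cdom c) (\<lambda>x. hloc c x u v)"
proof (rule Ck_on_local)
  fix x assume "x \<in> cmap c ` cdom c"
  then obtain d where d: "d \<in> atlas N" "x \<in> cmap c ` overlap c d" by (rule overlap_cover)
  let ?S = "cmap c ` overlap c d"
  note S = open_overlap_image[OF c d(1)]
  have r: "Ck_on k ?S (\<lambda>y. fderiv (rep c d) y w)" for w using rep_Ck[OF c d(1), of "Suc k"] by simp
  have m: "Ck_on k ?S (\<lambda>y. local_metric N d (rep c d y) i j)" for i j
    by (rule Ck_on_compose[OF S N.open_img[OF d(1)] rep_image[OF c] rep_Ck[OF c d(1)]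
      N.Ck_local_metric[OF d(1)]])
  have "Ck_on k ?S (\<lambda>y. \<Sum>i\<in>Basis. \<Sum>j\<in>Basis. (fderiv (rep c d) y u \<bullet> i) *
      ((fderiv (rep c d) y v \<bullet> j) * local_metric N d (rep c d y) i j))"
    by (intro Ck_on_sum Ck_on_mult Ck_on_inner_left S r m)
  then have "Ck_on k ?S (\<lambda>x. hloc c x u v)"
  proof (rule Ck_on_cong[OF S])
    fix y assume y: "y \<in> ?S"
    interpret n: pos_def_form "local_metric N d (rep c d y)"
      using y rep_image[OF c, of d] by (intro N.pos_def_local_metric d) blast
    show "(\<Sum>i\<in>Basis. \<Sum>j\<in>Basis. (fderiv (rep c d) y u \<bullet> i) *
      ((fderiv (rep c d) y v \<bullet> j) * local_metric N d (rep c d y) i j)) = hloc c y u v"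
      by (simp add: hloc_pullback[OF c d(1) y] bilinear_expand[OF n.bil, symmetric])
  qed
  then show "\<exists>T. open T \<and> x \<in> T \<and> Ck_on k T (\<lambda>x. hloc c x u v)" using S d(2) by blast
qed

lemma vloc_Ck: "c \<in> atlas M \<Longrightarrow> Ck_on k (cmap c ` cdom c) (\<lambda>x. vloc c x u v)"
  unfolding vloc_eq by (intro Ck_on_diff M.open_img M.Ck_local_metric hloc_Ck)

text \<open>Project the field that is constant in the chart. In coordinates the projection solves a
  linear system with the metric on the left and the smooth form \<open>vloc\<close> on the right, so
  it is smooth although no frame of the vertical spaces is at hand.\<close>

lemma vertical_extension:
  assumes "e \<in> vert p"
  obtains V where "vertical_field_on M N \<phi> (cdom (chart_at M p)) V" "V p = e"
proof
  let ?c = "chart_at M p"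
  define V where "V q = vproj q (chart_to_tangent M ?c q e)" for q
  define z where "z x = tangent_to_chart M ?c (cinv ?c x) (V (cinv ?c x))" for x
  have "smooth_field_on M (cdom ?c) V"
  proof (rule M.smooth_field_onI[OF M.chart_at_atlas M.open_cdom[OF M.chart_at_atlas] subset_refl smooth_onI])
    fix k
    have "Ck_on k (cmap ?c ` cdom ?c) z"
    proof (rule solution_Ck[where \<beta> = "local_metric M ?c" and c = "\<lambda>x w. vloc ?c x e w"])
      fix x w assume "x \<in> cmap ?c ` cdom ?c"
      then show "local_metric M ?c x (z x) w = vloc ?c x e w"
        by (auto simp: local_metric_eq M.local_form_cmap z_def V_def vform_eq)
    qed (simp_all add: M.open_img M.pos_def_local_metric M.Ck_local_metric vloc_Ck del: image_iff)
    then show "Ck_on k (cmap ?c ` cdom ?c) (\<lambda>x. tangent_to_chart M ?c (cinv ?c x) (V (cinv ?c x)))"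
      by (simp add: z_def[abs_def])
  qed
  then show "vertical_field_on M N \<phi> (cdom ?c) V"
    unfolding vertical_field_on_def V_def using vproj_vert by blast
  have "hproj p e = 0"
    using assms subspace_0[OF subspace_horiz] by (intro hproj_eqI) auto
  then show "V p = e" by (simp add: V_def vproj_def)
qed

section \<open>The second fundamental form of the fibers at a point\<close>

context
  fixes p :: 'a
begin

private abbreviation (input) "c \<equiv> chart_at M p"
private abbreviation (input) "x \<equiv> cmap (chart_at M p) p"

lemma x_img: "x \<in> cmap c ` cdom c" by simp

text \<open>Both terms of \<open>koszul_pullback\<close> carry the image of \<open>v\<close> as last
  argument, and this image is zero.\<close>

lemma koszul_hloc_vert:
  assumes v: "v \<in> vert p"
  shows "koszul (hloc c) x u u' v = 0"
proof -
  let ?d = "chart_at N (\<phi> p)"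
  have x: "x \<in> cmap c ` overlap c ?d" by (simp add: overlap_def)
  have r: "rep c ?d x = cmap ?d (\<phi> p)" by (simp add: rep_def)
  have v0: "fderiv (rep c ?d) x v = 0" using v by (simp add: vertical_def differential_eq)
  interpret n: pos_def_form "local_metric N ?d (rep c ?d x)"
    by (rule N.pos_def_local_metric) (simp_all add: r)
  have xr: "rep c ?d x \<in> cmap ?d ` cdom ?d" using r by simp
  have lin: "linear (koszul (local_metric N ?d) (rep c ?d x) a b)" for a b
    using koszul_linear[OF N.form_field_local_metric[OF N.chart_at_atlas] xr] by simp
  show ?thesis
    using koszul_pullback[OF N.form_field_local_metric[OF N.chart_at_atlas, of "\<phi> p"]
      N.local_metric_sym[OF N.chart_at_atlas]
        open_overlap_image[OF M.chart_at_atlas N.chart_at_atlas] rep_Ck[OF M.chart_at_atlas N.chart_at_atlas]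
        rep_image[OF M.chart_at_atlas] hloc_pullback[OF M.chart_at_atlas N.chart_at_atlas] x, of u u' v]
    by (simp add: v0 n.simps linear_0[OF lin])
qed

lemma dform_hloc_vert:
  assumes "v \<in> vert p" "v' \<in> vert p"
  shows "dform (hloc c) x a v v' = 0"
  using assms
  by (intro psd_dform_zero[OF form_field_hloc[OF M.chart_at_atlas] x_img _ hloc_sym])
    (auto simp: M.local_form_cmap hform_nonneg vert_hform)

lemma dform_vloc_horiz:
  assumes "h \<in> horiz p" "h' \<in> horiz p"
  shows "dform (vloc c) x a h h' = 0"
  using assms
  by (intro psd_dform_zero[OF form_field_vloc[OF M.chart_at_atlas] x_img _ vloc_sym])
    (auto simp: M.local_form_cmap vform_nonneg horiz_vform)

text \<open>The product of \<open>T(u, v)\<close> with \<open>h\<close>, by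
  \<open>T_tensor_second_ff\<close>. As a Koszul expression of \<open>l\<close> it needs no
  extension of \<open>u\<close> and \<open>v\<close> to fields.\<close>

definition second_ff :: "'e \<Rightarrow> 'e \<Rightarrow> 'e \<Rightarrow> real" where
  "second_ff u v h = koszul (vloc c) x u v h / 2"

lemma dform_hloc_sym: "dform (hloc c) x a u v = dform (hloc c) x a v u"
  by (rule dform_commute[OF hloc_sym M.open_img[OF M.chart_at_atlas] x_img])

lemma dform_vloc_sym: "dform (vloc c) x a u v = dform (vloc c) x a v u"
  by (rule dform_commute[OF vloc_sym M.open_img[OF M.chart_at_atlas] x_img])

text \<open>For vertical \<open>u\<close> and \<open>v\<close> the derivative of
  \<open>k(u, v)\<close> along \<open>h\<close> vanishes, and the Koszul identity for
  \<open>k\<close> exchanges the derivatives along \<open>u\<close> and \<open>v\<close>. This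
  exchange expresses that the vertical distribution is integrable.\<close>

lemma second_ff_eq:
  assumes u: "u \<in> vert p" and v: "v \<in> vert p"
  shows "second_ff u v h = koszul (local_metric M c) x u v h / 2 - dform (hloc c) x u v h"
proof -
  have k: "koszul (vloc c) x u v h = koszul (local_metric M c) x u v h - koszul (hloc c) x u v h"
    by (simp add: koszul_def dform_vloc[OF M.chart_at_atlas x_img])
  have "dform (hloc c) x v u h = dform (hloc c) x u v h"
    using koszul_hloc_vert[OF v, of u h] dform_hloc_vert[OF u v, of h] dform_hloc_vert[OF v u, of h]
    by (simp add: koszul_def dform_hloc_sym[of _ h])
  then have "koszul (hloc c) x u v h = 2 * dform (hloc c) x u v h"
    using dform_hloc_vert[OF u v, of h] by (simp add: koszul_def)
  then show ?thesis using k by (simp add: second_ff_def)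
qed

lemma T_tensor_second_ff:
  assumes W: "open W" "p \<in> W" "vertical_field_on M N \<phi> W U" "vertical_field_on M N \<phi> W V"
    and h: "h \<in> horiz p"
  shows "met p (T_tensor M N \<phi> U V p) h = second_ff (U p) (V p) h"
proof -
  have uv: "U p \<in> vert p" "V p \<in> vert p" using W by (auto simp: vertical_field_on_def)
  have "met p (covariant_derivative M U V p) h =
    koszul (local_metric M c) x (U p) (V p) h / 2 - dform (hloc c) x (U p) (V p) h"
    by (rule covariant_derivative_horiz[OF W(1,2) _ form_field_hloc[OF M.chart_at_atlas] x_img])
      (use W(4) h in \<open>auto simp: vertical_field_on_def vert_hform horiz_hform\<close>)
  then show ?thesis unfolding T_tensor_def met_hproj[OF h] second_ff_eq[OF uv] .
qed

text \<open>The contribution of a factor to the derivative of the vertical energy along a geodesic.\<close>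

lemma second_ff_energy:
  assumes v: "v \<in> vert p" and h: "h \<in> horiz p"
  shows "dform (vloc c) x (v + h) (v + h) (v + h) - 2 * dform (local_metric M c) x (v + h) (v + h) v
      + dform (local_metric M c) x v (v + h) (v + h) = 2 * second_ff v v h"
proof -
  interpret L: form_field "cmap c ` cdom c" "vloc c" by (rule form_field_vloc) simp
  interpret K: form_field "cmap c ` cdom c" "hloc c" by (rule form_field_hloc) simp
  \<comment> \<open>Hence the horizontal form drops out of the two metric terms, which may be
    replaced by those of \<open>vloc\<close>; expanding \<open>v + h\<close> then leaves the Koszul
    expression of \<open>vloc\<close>.\<close>
  have k: "2 * dform (hloc c) x (v + h) (v + h) v = dform (hloc c) x v (v + h) (v + h)"
    using koszul_hloc_vert[OF v, of "v + h" "v + h"] by (simp add: koszul_def)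
  have hh: "dform (vloc c) x a h h = 0" for a using dform_vloc_horiz[OF h h] .
  show ?thesis
    using k dform_vloc[OF M.chart_at_atlas x_img, of "v + h" "v + h" v] dform_vloc[OF M.chart_at_atlas
      x_img, of v "v + h" "v + h"]
      dform_vloc_sym[of h h v] dform_vloc_sym[of v h v]
    by (simp add: second_ff_def koszul_def L.dform_simps[OF x_img] hh)
qed

end

end

section \<open>Warped products of manifolds\<close>

lemma has_derivative_map_prod:
  assumes "(a has_derivative a') (at x)" "(b has_derivative b') (at y)"
  shows "(map_prod a b has_derivative map_prod a' b') (at (x, y))"
proof -
  have "(a \<circ> fst has_derivative a' \<circ> fst) (at (x, y))" "(b \<circ> snd has_derivative b' \<circ> snd) (at (x, y))"
    using assms by (auto intro!: diff_chain_at bounded_linear_imp_has_derivative bounded_linear_fst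
      bounded_linear_snd)
  from has_derivative_Pair[OF this] show ?thesis by (simp add: map_prod_def o_def case_prod_beta')
qed

lemma Ck_on_comp_fst:
  fixes h :: "'x::euclidean_space \<Rightarrow> 'z::real_normed_vector"
  assumes "open S" "open T" "Ck_on k S h"
  shows "Ck_on k (S \<times> (T :: 'y::euclidean_space set)) (\<lambda>z. h (fst z))"
  by (rule Ck_on_compose[where f = fst, OF _ assms(1) _ _ assms(3)])
    (auto intro: open_Times assms Ck_on_fst[OF _ Ck_on_ident])

lemma Ck_on_comp_snd:
  fixes h :: "'y::euclidean_space \<Rightarrow> 'z::real_normed_vector"
  assumes "open S" "open T" "Ck_on k T h"
  shows "Ck_on k ((S :: 'x::euclidean_space set) \<times> T) (\<lambda>z. h (snd z))"
  by (rule Ck_on_compose[where f = snd, OF _ assms(2) _ _ assms(3)])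
    (auto intro: open_Times assms Ck_on_snd[OF _ Ck_on_ident])

lemma Ck_on_map_prod:
  fixes a :: "'x::euclidean_space \<Rightarrow> 'z::real_normed_vector" and b :: "'y::euclidean_space \<Rightarrow>
    'w::real_normed_vector"
  assumes "open S" "open T" "Ck_on k S a" "Ck_on k T b"
  shows "Ck_on k (S \<times> T) (map_prod a b)"
proof -
  have "Ck_on k (S \<times> T) (\<lambda>z. (a (fst z), b (snd z)))"
    using assms by (intro Ck_on_Pair open_Times Ck_on_comp_fst Ck_on_comp_snd)
  then show ?thesis by (simp add: map_prod_def case_prod_beta')
qed

subsection \<open>Warped sums of fields of forms\<close>

definition warped_form ::
  "('x \<Rightarrow> 'e \<Rightarrow> 'e \<Rightarrow> real) \<Rightarrow> ('x \<Rightarrow> real) \<Rightarrow> ('y \<Rightarrow> 'f \<Rightarrow> 'f \<Rightarrow> real) \<Rightarrow> 'x \<times> 'y \<Rightarrow> 'e \<times> 'f \<Rightarrow> 'e \<times> 'f \<Rightarrow> real" where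
  "warped_form \<alpha> F \<beta> z u v = \<alpha> (fst z) (fst u) (fst v) + F (fst z) * \<beta> (snd z) (snd u) (snd v)"

lemma bilinear_warped:
  assumes "bilinear (\<alpha> (fst z))" "bilinear (\<beta> (snd z))"
  shows "bilinear (warped_form \<alpha> F \<beta> z)"
  unfolding bilinear_def warped_form_def
  by (auto intro!: linearI simp: bilinear_ladd[OF assms(1)] bilinear_ladd[OF assms(2)]
      bilinear_radd[OF assms(1)] bilinear_radd[OF assms(2)] bilinear_lmul[OF assms(1)] bilinear_lmul[OF
        assms(2)]
      bilinear_rmul[OF assms(1)] bilinear_rmul[OF assms(2)] algebra_simps)

lemma
  fixes \<alpha> :: "'x::real_normed_vector \<Rightarrow> 'e::euclidean_space \<Rightarrow> 'e \<Rightarrow> real"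
    and \<beta> :: "'y::real_normed_vector \<Rightarrow> 'f::euclidean_space \<Rightarrow> 'f \<Rightarrow> real"
  assumes \<alpha>: "form_field S \<alpha>" and \<beta>: "form_field T \<beta>"
    and F: "\<And>x. x \<in> S \<Longrightarrow> (F has_derivative F' x) (at x)"
  shows form_field_warped: "form_field (S \<times> T) (warped_form \<alpha> F \<beta>)"
    and dform_warped: "x \<in> S \<Longrightarrow> y \<in> T \<Longrightarrow> dform (warped_form \<alpha> F \<beta>) (x, y) a u v =
      dform \<alpha> x (fst a) (fst u) (fst v) + F x * dform \<beta> y (snd a) (snd u) (snd v)
      + F' x (fst a) * \<beta> y (snd u) (snd v)"
proof -
  interpret A: form_field S \<alpha> by fact
  interpret B: form_field T \<beta> by fact
  have d: "((\<lambda>z. warped_form \<alpha> F \<beta> z u v) has_derivative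
      (\<lambda>a. dform \<alpha> x (fst a) (fst u) (fst v) + (F x * dform \<beta> y (snd a) (snd u) (snd v)
      + F' x (fst a) * \<beta> y (snd u) (snd v)))) (at (x, y))"
    if x: "x \<in> S" and y: "y \<in> T" for x y u v
  proof -
    have 1: "((\<lambda>z. \<alpha> (fst z) (fst u) (fst v)) has_derivative (\<lambda>a. dform \<alpha> x (fst a) (fst u) (fst v)))
      (at (x, y))"
      using diff_chain_at[OF bounded_linear_imp_has_derivative[OF bounded_linear_fst], of "\<lambda>x. \<alpha> x (fst
        u) (fst v)" _ "(x, y)"]
        A.has_deriv[OF x, of "fst u" "fst v"] by (simp add: o_def)
    have 2: "((\<lambda>z. \<beta> (snd z) (snd u) (snd v)) has_derivative (\<lambda>a. dform \<beta> y (snd a) (snd u) (snd v)))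
      (at (x, y))"
      using diff_chain_at[OF bounded_linear_imp_has_derivative[OF bounded_linear_snd], of "\<lambda>y. \<beta> y (snd
        u) (snd v)" _ "(x, y)"]
        B.has_deriv[OF y, of "snd u" "snd v"] by (simp add: o_def)
    have 3: "((\<lambda>z. F (fst z)) has_derivative (\<lambda>a. F' x (fst a))) (at (x, y))"
      using diff_chain_at[OF bounded_linear_imp_has_derivative[OF bounded_linear_fst], of F _ "(x, y)"]
        F[OF x] by (simp add: o_def)
    show ?thesis
      unfolding warped_form_def
      using has_derivative_add[OF 1 has_derivative_mult[OF 3 2]] by simp
  qed
  show W: "form_field (S \<times> T) (warped_form \<alpha> F \<beta>)"
  proof
    show "bilinear (warped_form \<alpha> F \<beta> z)" if "z \<in> S \<times> T" for z
      using that A.bilin B.bilin by (intro bilinear_warped) auto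
    show "(\<lambda>z. warped_form \<alpha> F \<beta> z u v) differentiable (at z)" if "z \<in> S \<times> T" for z u v
      using d[of "fst z" "snd z" u v] that unfolding differentiable_def prod.collapse by (auto simp:
        mem_Times_iff)
  qed (intro open_Times A.open_S B.open_S)
  interpret W: form_field "S \<times> T" "warped_form \<alpha> F \<beta>" by (rule W)
  show "dform (warped_form \<alpha> F \<beta>) (x, y) a u v =
      dform \<alpha> x (fst a) (fst u) (fst v) + F x * dform \<beta> y (snd a) (snd u) (snd v)
      + F' x (fst a) * \<beta> y (snd u) (snd v)" if "x \<in> S" "y \<in> T"
    using that W.dform_unique[OF _ d, of x y] by simp
qed

subsection \<open>Warped products\<close>

locale warped = A: riem_mfd M1 + B: riem_mfd M2
  for M1 :: "('a1::{t2_space,second_countable_topology}, 'e1::euclidean_space) riemannian"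
    and M2 :: "('a2::{t2_space,second_countable_topology}, 'e2::euclidean_space) riemannian" +
  fixes f :: "'a1 \<Rightarrow> real"
  assumes smooth_f: "smooth_function M1 f" and f_pos: "f p > 0"
begin

definition W :: "('a1 \<times> 'a2, 'e1 \<times> 'e2) riemannian" where
  "W = warped_product M1 f M2"

lemma atlas_W: "atlas W = {product_chart c d | c d. c \<in> atlas M1 \<and> d \<in> atlas M2}"
  and chart_at_W [simp]: "chart_at W p = product_chart (chart_at M1 (fst p)) (chart_at M2 (snd p))"
  by (simp_all add: W_def warped_product_def Let_def product_manifold_def)

lemma cdom_product [simp]: "cdom (product_chart c d) = cdom c \<times> cdom d"
  and cmap_product [simp]: "cmap (product_chart c d) = map_prod (cmap c) (cmap d)"
  by (simp_all add: product_chart_def)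

lemma product_in_atlas [simp]: "c \<in> atlas M1 \<Longrightarrow> d \<in> atlas M2 \<Longrightarrow> product_chart c d \<in> atlas W"
  by (auto simp: atlas_W)

lemma cinv_product:
  assumes cd: "c \<in> atlas M1" "d \<in> atlas M2" and "x \<in> cmap c ` cdom c" "y \<in> cmap d ` cdom d"
  shows "cinv (product_chart c d) (x, y) = (cinv c x, cinv d y)"
proof -
  have "inj_on (map_prod (cmap c) (cmap d)) (cdom c \<times> cdom d)"
    by (rule map_prod_inj_on) (metis inj_onI A.cinv_cmap cd(1), metis inj_onI B.cinv_cmap cd(2))
  moreover obtain q r where "q \<in> cdom c" "x = cmap c q" "r \<in> cdom d" "y = cmap d r" using assms by blast
  ultimately show ?thesis
    using inv_into_f_f[of "map_prod (cmap c) (cmap d)" "cdom c \<times> cdom d" "(q, r)"] cd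
    by (simp add: cinv_def[of "product_chart c d"])
qed

lemma image_product: "map_prod a b ` (S \<times> T) = a ` S \<times> b ` T"
  by force

lemma transition_product:
  assumes "c \<in> atlas M1" "d \<in> atlas M2" "z \<in> cmap c ` cdom c \<times> cmap d ` cdom d"
  shows "transition (product_chart c d) (product_chart c' d') z = map_prod (transition c c') (transition
    d d') z"
  using assms by (cases z) (simp add: transition_def cinv_product)

lemma smooth_W: "smooth_manifold W"
  unfolding smooth_manifold_def
proof (intro conjI ballI allI)
  fix e assume "e \<in> atlas W"
  then obtain c d where e: "e = product_chart c d" and cd: "c \<in> atlas M1" "d \<in> atlas M2" by (auto simp: atlas_W)
  note hc = A.atlas_homeo[OF cd(1)] and hd = B.atlas_homeo[OF cd(2)]
  show "open (cdom e)" "open (cmap e ` cdom e)"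
    using cd by (auto simp: e image_product A.open_cdom B.open_cdom A.open_img B.open_img intro!: open_Times)
  have inv: "map_prod (cinv c) (cinv d) z = cinv e z" if "z \<in> cmap c ` cdom c \<times> cmap d ` cdom d" for z
    using that cd by (cases z) (simp add: e cinv_product)
  show "homeomorphism (cdom e) (cmap e ` cdom e) (cmap e) (cinv e)"
  proof (rule homeomorphismI)
    have "continuous_on (cdom c \<times> cdom d) (\<lambda>z. (cmap c (fst z), cmap d (snd z)))"
      by (intro continuous_on_Pair continuous_on_compose2[OF A.continuous_cmap[OF cd(1)]]
          continuous_on_compose2[OF B.continuous_cmap[OF cd(2)]] continuous_on_fst continuous_on_snd
            continuous_on_id) auto
    then show "continuous_on (cdom e) (cmap e)"
      by (simp add: e map_prod_def case_prod_beta')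
    have "continuous_on (cmap c ` cdom c \<times> cmap d ` cdom d) (\<lambda>z. (cinv c (fst z), cinv d (snd z)))"
      by (intro continuous_on_Pair continuous_on_compose2[OF A.continuous_cinv[OF cd(1)]]
          continuous_on_compose2[OF B.continuous_cinv[OF cd(2)]] continuous_on_fst continuous_on_snd
            continuous_on_id) auto
    then have "continuous_on (cmap c ` cdom c \<times> cmap d ` cdom d) (map_prod (cinv c) (cinv d))"
      by (simp add: map_prod_def case_prod_beta')
    then have "continuous_on (cmap c ` cdom c \<times> cmap d ` cdom d) (cinv e)"
      by (rule continuous_on_eq) (rule inv)
    then show "continuous_on (cmap e ` cdom e) (cinv e)" by (simp add: e image_product)
  qed (use cd in \<open>auto simp: e cinv_product\<close>)
next
  fix e e' assume "e \<in> atlas W" "e' \<in> atlas W"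
  then obtain c d c' d' where e: "e = product_chart c d" "e' = product_chart c' d'"
    and cd: "c \<in> atlas M1" "d \<in> atlas M2" "c' \<in> atlas M1" "d' \<in> atlas M2" by (auto simp: atlas_W)
  let ?S = "cmap c ` (cdom c \<inter> cdom c')" and ?T = "cmap d ` (cdom d \<inter> cdom d')"
  have S: "open ?S" "open ?T"
    using cd A.open_image_Int A.open_cdom B.open_image_Int B.open_cdom by auto
  show "smooth_on (cmap e ` (cdom e \<inter> cdom e')) (cmap e' \<circ> cinv e)"
  proof (rule smooth_onI)
    fix k
    have "Ck_on k (?S \<times> ?T) (map_prod (transition c c') (transition d d'))"
      by (intro Ck_on_map_prod S A.transition_Ck B.transition_Ck cd)
    then have "Ck_on k (?S \<times> ?T) (transition e e')"
      by (rule Ck_on_cong[OF open_Times[OF S]])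
        (unfold e, rule transition_product[OF cd(1,2), symmetric], auto)
    then show "Ck_on k (cmap e ` (cdom e \<inter> cdom e')) (cmap e' \<circ> cinv e)"
      by (simp add: e image_product Times_Int_Times transition_def)
  qed
qed (simp_all add: mem_Times_iff)

sublocale W: smooth_mfd W by unfold_locales (rule smooth_W)

lemma transition_product_deriv:
  assumes "c \<in> atlas M1" "d \<in> atlas M2" "c' \<in> atlas M1" "d' \<in> atlas M2"
    "fst q \<in> cdom c \<inter> cdom c'" "snd q \<in> cdom d \<inter> cdom d'"
  shows "fderiv (transition (product_chart c d) (product_chart c' d')) (map_prod (cmap c) (cmap d) q) v
    = (fderiv (transition c c') (cmap c (fst q)) (fst v), fderiv (transition d d') (cmap d (snd q)) (snd v))"
proof -
  have q: "map_prod (cmap c) (cmap d) q = (cmap c (fst q), cmap d (snd q))" by (cases q) simp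
  have "(map_prod (transition c c') (transition d d') has_derivative
      map_prod (fderiv (transition c c') (cmap c (fst q))) (fderiv (transition d d') (cmap d (snd q))))
      (at (cmap c (fst q), cmap d (snd q)))"
    using assms by (intro has_derivative_map_prod A.transition_deriv B.transition_deriv) auto
  then have "(transition (product_chart c d) (product_chart c' d') has_derivative
      map_prod (fderiv (transition c c') (cmap c (fst q))) (fderiv (transition d d') (cmap d (snd q))))
      (at (cmap c (fst q), cmap d (snd q)))"
    by (rule has_derivative_transform_within_open[OF _ open_Times[OF A.open_img[OF assms(1)]
      B.open_img[OF assms(2)]]])
      (use assms in \<open>auto simp: transition_product\<close>)
  then show ?thesis unfolding q by (simp add: fderiv_eq[of "transition (product_chart c d) _"]
    map_prod_def case_prod_beta')
qed

lemma ctt_product: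
  assumes "c \<in> atlas M1" "d \<in> atlas M2" "fst q \<in> cdom c" "snd q \<in> cdom d"
  shows "chart_to_tangent W (product_chart c d) q v
    = (chart_to_tangent M1 c (fst q) (fst v), chart_to_tangent M2 d (snd q) (snd v))"
  using assms by (simp add: W.ctt_eq A.ctt_eq B.ctt_eq transition_product_deriv)

lemma ttc_product:
  assumes "c \<in> atlas M1" "d \<in> atlas M2" "fst q \<in> cdom c" "snd q \<in> cdom d"
  shows "tangent_to_chart W (product_chart c d) q v
    = (tangent_to_chart M1 c (fst q) (fst v), tangent_to_chart M2 d (snd q) (snd v))"
  using assms by (simp add: W.ttc_eq A.ttc_eq B.ttc_eq transition_product_deriv)

text \<open>Preferred charts of the product are products of preferred charts, so in coordinates the
  projection is linear and the metric of \<open>warped_product\<close> takes the shape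
  \<open>warped_form\<close>.\<close>

lemma differential_fst: "differential (product_manifold M1 M2) M1 fst p v = fst v"
proof -
  let ?c = "chart_at M1 (fst p)" and ?d = "chart_at M2 (snd p)"
  have q: "map_prod (cmap ?c) (cmap ?d) p = (cmap ?c (fst p), cmap ?d (snd p))" by (cases p) simp
  have "(cmap ?c \<circ> fst \<circ> cinv (product_chart ?c ?d) has_derivative fst) (at (cmap ?c (fst p), cmap ?d (snd p)))"
    by (rule has_derivative_transform_within_open[OF bounded_linear_imp_has_derivative[OF bounded_linear_fst]
          open_Times[OF A.open_img B.open_img]])
      (auto simp: cinv_product)
  then show ?thesis by (simp add: differential_def product_manifold_def q fderiv_eq)
qed

lemma differential_snd: "differential (product_manifold M1 M2) M2 snd p v = snd v"
proof -
  let ?c = "chart_at M1 (fst p)" and ?d = "chart_at M2 (snd p)"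
  have q: "map_prod (cmap ?c) (cmap ?d) p = (cmap ?c (fst p), cmap ?d (snd p))" by (cases p) simp
  have "(cmap ?d \<circ> snd \<circ> cinv (product_chart ?c ?d) has_derivative snd) (at (cmap ?c (fst p), cmap ?d (snd p)))"
    by (rule has_derivative_transform_within_open[OF bounded_linear_imp_has_derivative[OF bounded_linear_snd]
          open_Times[OF A.open_img B.open_img]])
      (auto simp: cinv_product)
  then show ?thesis by (simp add: differential_def product_manifold_def q fderiv_eq)
qed

lemma metric_W: "metric_tensor W = warped_form (metric_tensor M1) (\<lambda>p. (f p)\<^sup>2) (metric_tensor M2)"
  by (intro ext)
    (simp add: W_def warped_product_def Let_def warped_form_def differential_fst differential_snd)

definition F :: "('a1, 'e1) chart \<Rightarrow> 'e1 \<Rightarrow> real" where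
  "F c x = (f (cinv c x))\<^sup>2"

lemma f_Ck: "c \<in> atlas M1 \<Longrightarrow> Ck_on k (cmap c ` cdom c) (\<lambda>x. f (cinv c x))"
  using smooth_f smooth_on_Ck unfolding smooth_function_def o_def by blast

lemma F_Ck: "c \<in> atlas M1 \<Longrightarrow> Ck_on k (cmap c ` cdom c) (F c)"
  unfolding F_def power2_eq_square by (intro Ck_on_mult A.open_img f_Ck)

lemma local_form_warped:
  assumes "c \<in> atlas M1" "d \<in> atlas M2" "z \<in> cmap c ` cdom c \<times> cmap d ` cdom d"
  shows "local_form W (warped_form \<alpha> (\<lambda>p. (f p)\<^sup>2) \<beta>) (product_chart c d) z u v
    = warped_form (local_form M1 \<alpha> c) (F c) (local_form M2 \<beta> d) z u v"
  using assms by (auto simp: local_form_def warped_form_def F_def cinv_product ctt_product)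

lemma local_metric_W:
  assumes "c \<in> atlas M1" "d \<in> atlas M2" "z \<in> cmap c ` cdom c \<times> cmap d ` cdom d"
  shows "local_metric W (product_chart c d) z u v
    = warped_form (local_metric M1 c) (F c) (local_metric M2 d) z u v"
  using local_form_warped[OF assms] by (simp add: local_metric_eq metric_W)

sublocale W: riem_mfd W
proof (intro_locales, rule riem_mfd_axioms.intro)
  show "bilinear (metric_tensor W p)" for p
    unfolding metric_W by (intro bilinear_warped A.bil_metric B.bil_metric)
  show "metric_tensor W p u v = metric_tensor W p v u" for p u v
    by (simp add: metric_W warped_form_def A.sym_metric[of _ "fst u"] B.sym_metric[of _ "snd u"])
  show "metric_tensor W p u u > 0" if "u \<noteq> 0" for p u
  proof (cases "fst u = 0")
    case True
    then have "snd u \<noteq> 0" using that by (metis prod.collapse zero_prod_def)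
    then have "metric_tensor M2 (snd p) (snd u) (snd u) > 0" by (rule B.pos_metric)
    then show ?thesis using f_pos[of "fst p"] True by (simp add: metric_W warped_form_def A.metric.simps)
  next
    case False
    then have "metric_tensor M1 (fst p) (fst u) (fst u) > 0" by (rule A.pos_metric)
    then show ?thesis using B.metric.nonneg[of "snd p" "snd u"]
      by (simp add: metric_W warped_form_def add_pos_nonneg)
  qed
  fix e u v assume "e \<in> atlas W"
  then obtain c d where e: "e = product_chart c d" and cd: "c \<in> atlas M1" "d \<in> atlas M2" by (auto simp: atlas_W)
  let ?S = "cmap c ` cdom c" and ?T = "cmap d ` cdom d"
  note o = A.open_img[OF cd(1)] B.open_img[OF cd(2)]
  show "smooth_on (cmap e ` cdom e) (\<lambda>x. local_metric W e x u v)"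
  proof (rule smooth_onI)
    fix k
    have "Ck_on k (?S \<times> ?T) (\<lambda>z. local_metric M1 c (fst z) (fst u) (fst v)
      + F c (fst z) * local_metric M2 d (snd z) (snd u) (snd v))"
      by (intro Ck_on_add Ck_on_mult open_Times o Ck_on_comp_fst[OF o, where h = "\<lambda>x. local_metric M1 c
        x (fst u) (fst v)"]
          Ck_on_comp_fst[OF o, where h = "F c"] Ck_on_comp_snd[OF o, where h = "\<lambda>x. local_metric M2 d x
            (snd u) (snd v)"]
          F_Ck A.Ck_local_metric B.Ck_local_metric cd)
    then have "Ck_on k (?S \<times> ?T) (\<lambda>x. local_metric W e x u v)"
      by (rule Ck_on_cong[OF open_Times[OF o]]) (simp add: e local_metric_W[OF cd] warped_form_def)
    then show "Ck_on k (cmap e ` cdom e) (\<lambda>x. local_metric W e x u v)" by (simp add: e image_product)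
  qed
qed

end

section \<open>Derivatives along geodesics\<close>

lemma form_field_cong:
  assumes "form_field S \<beta>" "\<And>x u v. x \<in> S \<Longrightarrow> \<gamma> x u v = \<beta> x u v"
  shows "form_field S \<gamma>"
proof -
  interpret form_field S \<beta> by fact
  show ?thesis
  proof
    show "bilinear (\<gamma> x)" if "x \<in> S" for x
    proof -
      have "\<gamma> x = \<beta> x" using assms(2)[OF that] by (intro ext) 
      then show ?thesis using bilin[OF that] by simp
    qed
    show "(\<lambda>y. \<gamma> y u v) differentiable (at x)" if "x \<in> S" for x u v
      by (rule differentiable_cong_open[OF open_S that _ diffble[OF that, of u v]]) (simp add: assms(2))
  qed (rule open_S)
qed

lemma has_real_derivative_eqI: "(f has_derivative D) (at (t::real)) \<Longrightarrow> (\<And>h. D h = h * d) \<Longrightarrow> (f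
  has_real_derivative d) (at t)"
proof -
  assume f: "(f has_derivative D) (at t)" and "\<And>h. D h = h * d"
  then have "D = (*) d" by (intro ext) (simp add: mult.commute)
  with f show ?thesis by (simp add: has_field_derivative_def)
qed

context riem_mfd
begin

text \<open>The chart preferred at \<open>\<gamma> t\<close> is kept for nearby times so that the
  curve can be differentiated in it. The coordinate acceleration \<open>a\<close> is given through
  its metric products, the form in which the Koszul expression enters later.\<close>

lemma geodesic_in_chart:
  assumes \<gamma>: "geodesic M I \<gamma>" "t \<in> I" and c_def: "c = chart_at M (\<gamma> t)"
  obtains J X U a where "open J" "t \<in> J" "J \<subseteq> I" "X t = cmap c (\<gamma> t)" "U t = velocity M \<gamma> t"
    "\<And>s. s \<in> J \<Longrightarrow> \<gamma> s \<in> cdom c \<and> cmap c (\<gamma> s) = X s \<and> velocity M \<gamma> s = chart_to_tangent M c (\<gamma> s) (U s)"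
    "(X has_derivative (\<lambda>h. h *\<^sub>R U t)) (at t)" "(U has_derivative (\<lambda>h. h *\<^sub>R a)) (at t)"
    "\<And>w. 2 * metric_tensor M (\<gamma> t) a w
      = - koszul (local_metric M c) (cmap c (\<gamma> t)) (velocity M \<gamma> t) (velocity M \<gamma> t) w"
proof -
  have c: "c \<in> atlas M" "\<gamma> t \<in> cdom c" by (auto simp: c_def)
  define J where "J = I \<inter> \<gamma> -` cdom c"
  define X where "X = cmap c \<circ> \<gamma>"
  define U where "U s = vector_derivative X (at s)" for s
  define a where "a = vector_derivative U (at t)"
  have I: "open I" "continuous_on I \<gamma>" and acc: "acceleration M \<gamma> t = 0" and C2: "Ck_on 2 J X"
    using \<gamma> c unfolding geodesic_def J_def X_def by auto
  have J: "open J" "t \<in> J" "J \<subseteq> I"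
    using continuous_open_preimage[OF I(2,1) open_cdom[OF c(1)]] \<gamma>(2) c by (auto simp: J_def)
  have dX: "(X has_derivative (\<lambda>h. h *\<^sub>R U s)) (at s)" if "s \<in> J" for s
  proof -
    have "X differentiable (at s)" using C2 that by (simp add: numeral_2_eq_2)
    from fderiv_works[OF this] show ?thesis
      unfolding frechet_derivative_eq_vector_derivative[OF \<open>X differentiable (at s)\<close>] U_def .
  qed
  have "(\<lambda>s. fderiv X s 1) differentiable (at t)" using C2 J by (simp add: numeral_2_eq_2)
  then have dU: "U differentiable (at t)"
    by (rule differentiable_cong_open[OF J(1,2), rotated]) (simp add: fderiv_eq[OF dX])
  from fderiv_works[OF this] have U: "(U has_derivative (\<lambda>h. h *\<^sub>R a)) (at t)"
    unfolding frechet_derivative_eq_vector_derivative[OF dU] a_def .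
  have vel: "velocity M \<gamma> s = chart_to_tangent M c (\<gamma> s) (U s)" if "s \<in> J" for s
    by (rule velocity_in_chart[OF refl refl I(1) _ I(2) c(1)])
      (use dX[OF that] that in \<open>auto simp: J_def X_def has_vector_derivative_def\<close>)
  have Ut: "U t = velocity M \<gamma> t" using vel[OF J(2)] by (simp add: c_def)
  have "a + christoffel M (\<gamma> t) (velocity M \<gamma> t) (velocity M \<gamma> t) = 0"
    using acc by (simp add: acceleration_def Let_def a_def U_def[abs_def] X_def c_def)
  then have a: "a = - christoffel M (\<gamma> t) (velocity M \<gamma> t) (velocity M \<gamma> t)"
    by (rule eq_neg_iff_add_eq_0[THEN iffD2])
  have "2 * metric_tensor M (\<gamma> t) a w
      = - koszul (local_metric M c) (cmap c (\<gamma> t)) (velocity M \<gamma> t) (velocity M \<gamma> t) w" for w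
    by (simp add: a metric.simps christoffel c_def)
  then show ?thesis
    using that[OF J _ Ut _ dX[OF J(2)] U] vel by (auto simp: J_def X_def)
qed

text \<open>Serves for the speed, with the metric as \<open>\<beta>\<close>, and for the vertical
  energy, with the vertical form of the product.\<close>

lemma geodesic_form_deriv:
  assumes \<gamma>: "geodesic M I \<gamma>" "t \<in> I" and c_def: "c = chart_at M (\<gamma> t)"
    and u: "u = velocity M \<gamma> t" and x: "x = cmap c (\<gamma> t)"
    and ff: "form_field S (local_form M \<beta> c)" "x \<in> S"
  obtains a where "\<And>w. 2 * metric_tensor M (\<gamma> t) a w = - koszul (local_metric M c) x u u w"
    "((\<lambda>s. \<beta> (\<gamma> s) (velocity M \<gamma> s) (velocity M \<gamma> s)) has_real_derivative
      (dform (local_form M \<beta> c) x u u u + \<beta> (\<gamma> t) a u + \<beta> (\<gamma> t) u a)) (at t)"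
proof -
  interpret form_field S "local_form M \<beta> c" by (rule ff(1))
  obtain J X U a where J: "open J" "t \<in> J" "J \<subseteq> I" and Xt: "X t = cmap c (\<gamma> t)" "U t = velocity M \<gamma> t"
    and XJ: "\<And>s. s \<in> J \<Longrightarrow> \<gamma> s \<in> cdom c \<and> cmap c (\<gamma> s) = X s \<and> velocity M \<gamma> s = chart_to_tangent M c (\<gamma> s) (U s)"
    and X: "(X has_derivative (\<lambda>h. h *\<^sub>R U t)) (at t)" and U: "(U has_derivative (\<lambda>h. h *\<^sub>R a)) (at t)"
    and a: "\<And>w. 2 * metric_tensor M (\<gamma> t) a w
      = - koszul (local_metric M c) (cmap c (\<gamma> t)) (velocity M \<gamma> t) (velocity M \<gamma> t) w"
    by (rule geodesic_in_chart[OF \<gamma> c_def]) (rule that)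
  have Xtx: "X t = x" "U t = u" using Xt u x by simp_all
  have "((\<lambda>s. local_form M \<beta> c (X s) (U s) (U s)) has_derivative
    (\<lambda>h. dform (local_form M \<beta> c) (X t) (h *\<^sub>R U t) (U t) (U t) + local_form M \<beta> c (X t) (h *\<^sub>R a) (U t)
      + local_form M \<beta> c (X t) (U t) (h *\<^sub>R a))) (at t)"
    by (rule has_derivative_form[OF X U U]) (simp add: Xtx ff(2))
  then have "((\<lambda>s. \<beta> (\<gamma> s) (velocity M \<gamma> s) (velocity M \<gamma> s)) has_derivative
    (\<lambda>h. dform (local_form M \<beta> c) (X t) (h *\<^sub>R U t) (U t) (U t) + local_form M \<beta> c (X t) (h *\<^sub>R a) (U t)
      + local_form M \<beta> c (X t) (U t) (h *\<^sub>R a))) (at t)"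
  proof (rule has_derivative_transform_within_open[OF _ J(1,2)])
    fix s assume s: "s \<in> J"
    have "c \<in> atlas M" by (simp add: c_def)
    then show "local_form M \<beta> c (X s) (U s) (U s) = \<beta> (\<gamma> s) (velocity M \<gamma> s) (velocity M \<gamma> s)"
      using XJ[OF s] local_form_cmap by metis
  qed
  moreover have "local_form M \<beta> c x = \<beta> (\<gamma> t)" by (simp add: x c_def)
  ultimately have "((\<lambda>s. \<beta> (\<gamma> s) (velocity M \<gamma> s) (velocity M \<gamma> s)) has_real_derivative
      (dform (local_form M \<beta> c) x u u u + \<beta> (\<gamma> t) a u + \<beta> (\<gamma> t) u a)) (at t)"
    using bilin[OF ff(2)]
    by (intro has_real_derivative_eqI)
      (auto simp: Xtx dform_simps[OF ff(2)] bilinear_lmul bilinear_rmul algebra_simps)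
  then show ?thesis using a by (intro that[of a]) (simp_all add: u x)
qed

text \<open>The squared speed is the denominator in the squared sine of the angle; since it is
  constant, the Clairaut condition concerns the vertical energy alone.\<close>

lemma geodesic_speed_deriv:
  assumes \<gamma>: "geodesic M I \<gamma>" "t \<in> I"
  shows "((\<lambda>s. metric_tensor M (\<gamma> s) (velocity M \<gamma> s) (velocity M \<gamma> s)) has_real_derivative 0) (at t)"
proof -
  let ?c = "chart_at M (\<gamma> t)" and ?u = "velocity M \<gamma> t"
  let ?x = "cmap ?c (\<gamma> t)"
  have x: "?x \<in> cmap ?c ` cdom ?c" by simp
  obtain a where a: "\<And>w. 2 * metric_tensor M (\<gamma> t) a w = - koszul (local_metric M ?c) ?x ?u ?u w"
    "((\<lambda>s. metric_tensor M (\<gamma> s) (velocity M \<gamma> s) (velocity M \<gamma> s)) has_real_derivative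
      (dform (local_metric M ?c) ?x ?u ?u ?u + metric_tensor M (\<gamma> t) a ?u + metric_tensor M (\<gamma> t) ?u a)) (at t)"
    by (rule geodesic_form_deriv[OF \<gamma> refl refl refl
          form_field_local_metric[OF chart_at_atlas, of "\<gamma> t", unfolded local_metric_eq] x, folded
            local_metric_eq]) (rule that)
  have "dform (local_metric M ?c) ?x ?u ?u ?u + metric_tensor M (\<gamma> t) a ?u + metric_tensor M (\<gamma> t) ?u a = 0"
    using a(1)[of ?u] sym_metric[of "\<gamma> t" ?u a] by (simp add: koszul_def)
  with a(2) show ?thesis by simp
qed

section \<open>Differentials and gradients of functions\<close>

definition dfun :: "('a \<Rightarrow> real) \<Rightarrow> 'a \<Rightarrow> 'e \<Rightarrow> real" where
  "dfun g p = fderiv (g \<circ> cinv (chart_at M p)) (cmap (chart_at M p) p)"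

lemma dfun_has_derivative:
  assumes "smooth_function M g"
  shows "((g \<circ> cinv (chart_at M p)) has_derivative dfun g p) (at (cmap (chart_at M p) p))"
  using assms unfolding smooth_function_def dfun_def
  by (intro fderiv_works smooth_on_differentiable) auto

lemma linear_dfun: "smooth_function M g \<Longrightarrow> linear (dfun g p)"
  using dfun_has_derivative has_derivative_linear by blast

lemma gradient: "smooth_function M g \<Longrightarrow> metric_tensor M p (gradient M g p) v = dfun g p v"
  unfolding gradient_def dfun_def[symmetric] by (rule metric.riesz_the[OF linear_dfun])

lemma geodesic_fun_deriv:
  assumes \<gamma>: "geodesic M I \<gamma>" "t \<in> I" and g: "smooth_function M g"
  shows "((\<lambda>s. g (\<gamma> s)) has_real_derivative dfun g (\<gamma> t) (velocity M \<gamma> t)) (at t)"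
proof -
  let ?c = "chart_at M (\<gamma> t)"
  obtain J X U a where J: "open J" "t \<in> J" "J \<subseteq> I" and Xt: "X t = cmap ?c (\<gamma> t)" "U t = velocity M \<gamma> t"
    and XJ: "\<And>s. s \<in> J \<Longrightarrow> \<gamma> s \<in> cdom ?c \<and> cmap ?c (\<gamma> s) = X s \<and> velocity M \<gamma> s = chart_to_tangent M ?c (\<gamma>
      s) (U s)"
    and X: "(X has_derivative (\<lambda>h. h *\<^sub>R U t)) (at t)" and U: "(U has_derivative (\<lambda>h. h *\<^sub>R a)) (at t)"
    by (rule geodesic_in_chart[OF \<gamma> refl]) (rule that)
  have "((g \<circ> cinv ?c) \<circ> X has_derivative dfun g (\<gamma> t) \<circ> (\<lambda>h. h *\<^sub>R U t)) (at t)"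
    by (rule diff_chain_at[OF X]) (simp add: Xt dfun_has_derivative g)
  then have "((\<lambda>s. g (\<gamma> s)) has_derivative dfun g (\<gamma> t) \<circ> (\<lambda>h. h *\<^sub>R U t)) (at t)"
  proof (rule has_derivative_transform_within_open[OF _ J(1,2)])
    fix s assume s: "s \<in> J"
    have "cinv ?c (X s) = \<gamma> s" using XJ[OF s] cinv_cmap[OF chart_at_atlas] by metis
    then show "((g \<circ> cinv ?c) \<circ> X) s = g (\<gamma> s)" by simp
  qed
  then show ?thesis
    by (rule has_real_derivative_eqI) (simp add: Xt linear_scale[OF linear_dfun[OF g]])
qed

end

section \<open>Products of Riemannian maps\<close>

locale warped_maps = A: riem_map M1 N1 \<phi>1 + B: riem_map M2 N2 \<phi>2
    + P: warped M1 M2 f + Q: warped N1 N2 \<rho>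
  for M1 :: "('a1::{t2_space,second_countable_topology}, 'e1::euclidean_space) riemannian"
    and M2 :: "('a2::{t2_space,second_countable_topology}, 'e2::euclidean_space) riemannian"
    and N1 :: "('b1::{t2_space,second_countable_topology}, 'f1::euclidean_space) riemannian"
    and N2 :: "('b2::{t2_space,second_countable_topology}, 'f2::euclidean_space) riemannian"
    and f :: "'a1 \<Rightarrow> real" and \<rho> :: "'b1 \<Rightarrow> real"
    and \<phi>1 :: "'a1 \<Rightarrow> 'b1" and \<phi>2 :: "'a2 \<Rightarrow> 'b2"
begin

abbreviation "W \<equiv> P.W"
abbreviation "V \<equiv> Q.W"
abbreviation "\<phi> \<equiv> map_prod \<phi>1 \<phi>2"

lemma differential_product:
  "differential W V \<phi> p v = (A.d\<phi> (fst p) (fst v), B.d\<phi> (snd p) (snd v))"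
proof -
  let ?c = "chart_at M1 (fst p)" and ?d = "chart_at M2 (snd p)"
  let ?c' = "chart_at N1 (\<phi>1 (fst p))" and ?d' = "chart_at N2 (\<phi>2 (snd p))"
  have q: "map_prod (cmap ?c) (cmap ?d) p = (cmap ?c (fst p), cmap ?d (snd p))" by (cases p) simp
  have \<phi>p: "fst (\<phi> p) = \<phi>1 (fst p)" "snd (\<phi> p) = \<phi>2 (snd p)" by (cases p, simp)+
  have "(map_prod (A.rep ?c ?c') (B.rep ?d ?d') has_derivative
      map_prod (fderiv (A.rep ?c ?c') (cmap ?c (fst p))) (fderiv (B.rep ?d ?d') (cmap ?d (snd p))))
      (at (cmap ?c (fst p), cmap ?d (snd p)))"
    by (intro has_derivative_map_prod A.rep_deriv B.rep_deriv) simp_all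
  then have "(cmap (product_chart ?c' ?d') \<circ> \<phi> \<circ> cinv (product_chart ?c ?d) has_derivative
      map_prod (fderiv (A.rep ?c ?c') (cmap ?c (fst p))) (fderiv (B.rep ?d ?d') (cmap ?d (snd p))))
      (at (cmap ?c (fst p), cmap ?d (snd p)))"
    by (rule has_derivative_transform_within_open[OF _ open_Times[OF A.M.open_img[OF A.M.chart_at_atlas]
      B.M.open_img[OF B.M.chart_at_atlas]]])
      (auto simp: P.cinv_product A.rep_def B.rep_def)
  then show ?thesis
    by (simp add: differential_def[of W] q \<phi>p fderiv_eq A.differential_eq B.differential_eq map_prod_def
      case_prod_beta')
qed

lemma vert_W: "vertical W V \<phi> p = A.vert (fst p) \<times> B.vert (snd p)"
  by (auto simp: vertical_def differential_product zero_prod_def)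

lemma met_W: "metric_tensor W p u v = metric_tensor M1 (fst p) (fst u) (fst v) + (f (fst p))\<^sup>2 *
  metric_tensor M2 (snd p) (snd u) (snd v)"
  by (simp add: P.metric_W warped_form_def)

lemma f2_pos: "(f q)\<^sup>2 > 0" using P.f_pos[of q] by simp

text \<open>Warping rescales the second factor without changing orthogonality; testing with
  \<open>(v, 0)\<close> and \<open>(0, v)\<close> separates the factors.\<close>

lemma horiz_W: "horizontal W V \<phi> p = A.horiz (fst p) \<times> B.horiz (snd p)"
proof (intro set_eqI iffI)
  fix x assume x: "x \<in> horizontal W V \<phi> p"
  have "metric_tensor M1 (fst p) (fst x) v = 0" if "v \<in> A.vert (fst p)" for v
  proof -
    have "(v, 0) \<in> vertical W V \<phi> p" using that subspace_0[OF B.subspace_vert] by (simp add: vert_W)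
    then have "metric_tensor W p x (v, 0) = 0" using x by (simp add: horizontal_def)
    then show ?thesis by (simp add: met_W B.M.metric.simps)
  qed
  moreover have "metric_tensor M2 (snd p) (snd x) v = 0" if "v \<in> B.vert (snd p)" for v
  proof -
    have "(0, v) \<in> vertical W V \<phi> p" using that subspace_0[OF A.subspace_vert] by (simp add: vert_W)
    then have "metric_tensor W p x (0, v) = 0" using x by (simp add: horizontal_def)
    then show ?thesis using f2_pos[of "fst p"] by (simp add: met_W A.M.metric.simps)
  qed
  ultimately show "x \<in> A.horiz (fst p) \<times> B.horiz (snd p)" by (simp add: horizontal_def mem_Times_iff)
next
  fix x assume "x \<in> A.horiz (fst p) \<times> B.horiz (snd p)"
  then show "x \<in> horizontal W V \<phi> p"
    by (auto simp: horizontal_def[of W] vert_W met_W A.horiz_vert B.horiz_vert)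
qed

sublocale S: hv_split W V \<phi>
proof (intro_locales, rule hv_split_axioms.intro)
  show "linear (differential W V \<phi> p)" for p
    by (rule linearI)
      (simp_all add: differential_product linear_add[OF A.linear_differential] linear_add[OF
        B.linear_differential]
        linear_scale[OF A.linear_differential] linear_scale[OF B.linear_differential])
  show "\<exists>h\<in>horizontal W V \<phi> p. x - h \<in> vertical W V \<phi> p" for p x
    using A.hproj_horiz[of "fst p" "fst x"] B.hproj_horiz[of "snd p" "snd x"]
      A.vproj_vert[of "fst p" "fst x"] B.vproj_vert[of "snd p" "snd x"]
    by (intro bexI[of _ "(A.hproj (fst p) (fst x), B.hproj (snd p) (snd x))"])
      (simp_all add: horiz_W vert_W A.vproj_def B.vproj_def mem_Times_iff)
qed

lemma hproj_W: "S.hproj p x = (A.hproj (fst p) (fst x), B.hproj (snd p) (snd x))"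
  using A.hproj_horiz[of "fst p" "fst x"] B.hproj_horiz[of "snd p" "snd x"]
    A.vproj_vert[of "fst p" "fst x"] B.vproj_vert[of "snd p" "snd x"]
  by (intro S.hproj_eqI) (simp_all add: horiz_W vert_W A.vproj_def B.vproj_def mem_Times_iff)

lemma vproj_W: "S.vproj p x = (A.vproj (fst p) (fst x), B.vproj (snd p) (snd x))"
  by (simp add: S.vproj_def hproj_W A.vproj_def B.vproj_def prod_eq_iff)

section \<open>The logarithm of the warping function\<close>

definition lnf :: "'a1 \<Rightarrow> real" where "lnf q = ln (f q)"

lemma smooth_lnf: "smooth_function M1 lnf"
  unfolding smooth_function_def
proof (intro ballI smooth_onI)
  fix c k assume c: "c \<in> atlas M1"
  have "Ck_on k (cmap c ` cdom c) (\<lambda>x. ln (f (cinv c x)))"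
    by (rule Ck_on_compose[OF A.M.open_img[OF c] _ _ P.f_Ck[OF c] Ck_on_ln])
      (use P.f_pos open_greaterThan[of "0::real"] in \<open>auto simp: greaterThan_def\<close>)
  then show "Ck_on k (cmap c ` cdom c) (lnf \<circ> cinv c)" by (simp add: lnf_def[abs_def] o_def)
qed

abbreviation "dlnf \<equiv> A.M.dfun lnf"

lemma smooth_lnf_W: "smooth_function W (\<lambda>q. lnf (fst q))"
  unfolding smooth_function_def
proof (intro ballI smooth_onI)
  fix e k assume "e \<in> atlas W"
  then obtain c d where e: "e = product_chart c d" and cd: "c \<in> atlas M1" "d \<in> atlas M2" by (auto simp:
    P.atlas_W)
  note o = A.M.open_img[OF cd(1)] B.M.open_img[OF cd(2)]
  have "Ck_on k (cmap c ` cdom c) (lnf \<circ> cinv c)"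
    using smooth_lnf cd by (simp add: smooth_function_def smooth_on_Ck)
  then have "Ck_on k (cmap c ` cdom c \<times> cmap d ` cdom d) (\<lambda>z. (lnf \<circ> cinv c) (fst z))"
    by (rule Ck_on_comp_fst[OF o])
  then have "Ck_on k (cmap c ` cdom c \<times> cmap d ` cdom d) ((\<lambda>q. lnf (fst q)) \<circ> cinv e)"
    by (rule Ck_on_cong[OF open_Times[OF o]]) (use cd in \<open>auto simp: e P.cinv_product\<close>)
  then show "Ck_on k (cmap e ` cdom e) ((\<lambda>q. lnf (fst q)) \<circ> cinv e)" by (simp add: e P.image_product)
qed

lemma dfun_lnf_W: "P.W.dfun (\<lambda>q. lnf (fst q)) p u = dlnf (fst p) (fst u)"
proof -
  let ?c = "chart_at M1 (fst p)" and ?d = "chart_at M2 (snd p)"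
  have q: "map_prod (cmap ?c) (cmap ?d) p = (cmap ?c (fst p), cmap ?d (snd p))" by (cases p) simp
  have "((lnf \<circ> cinv ?c) \<circ> fst has_derivative dlnf (fst p) \<circ> fst) (at (cmap ?c (fst p), cmap ?d (snd p)))"
    using A.M.dfun_has_derivative[OF smooth_lnf, of "fst p"]
    by (intro diff_chain_at bounded_linear_imp_has_derivative bounded_linear_fst) simp
  then have "((\<lambda>q. lnf (fst q)) \<circ> cinv (product_chart ?c ?d) has_derivative dlnf (fst p) \<circ> fst) (at
    (cmap ?c (fst p), cmap ?d (snd p)))"
    by (rule has_derivative_transform_within_open[OF _ open_Times[OF A.M.open_img[OF A.M.chart_at_atlas]
      B.M.open_img[OF B.M.chart_at_atlas]]])
      (auto simp: P.cinv_product)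
  then show ?thesis by (simp add: P.W.dfun_def q fderiv_eq)
qed

abbreviation (input) "met1 p u v \<equiv> A.met (fst p) (fst u) (fst v)"
abbreviation (input) "met2 p u v \<equiv> B.met (snd p) (snd u) (snd v)"
abbreviation (input) "sff1 p u v h \<equiv> A.second_ff (fst p) (fst u) (fst v) (fst h)"
abbreviation (input) "sff2 p u v h \<equiv> B.second_ff (snd p) (snd u) (snd v) (snd h)"
abbreviation (input) "dl p u \<equiv> dlnf (fst p) (fst u)"
abbreviation (input) "fsq p \<equiv> (f (fst p))\<^sup>2"

text \<open>Written as the exponential of \<open>2 * lnf\<close>, the weight has a derivative in
  terms of \<open>d ln f\<close>, the differential of the function whose gradient the theorem speaks
  of.\<close>

lemma F_has_derivative:
  "(P.F (chart_at M1 q) has_derivative (\<lambda>a. 2 * (f q)\<^sup>2 * dlnf q a)) (at (cmap (chart_at M1 q) q))"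
proof -
  let ?c = "chart_at M1 q"
  have e: "P.F ?c = (\<lambda>x. exp (2 * (lnf \<circ> cinv ?c) x))"
  proof
    fix x
    have "exp (2 * ln (f (cinv ?c x))) = (exp (ln (f (cinv ?c x))))\<^sup>2" by (simp add: exp_double)
    then show "P.F ?c x = exp (2 * (lnf \<circ> cinv ?c) x)" using P.f_pos by (simp add: P.F_def lnf_def)
  qed
  have x: "exp (2 * lnf q) = (f q)\<^sup>2" using P.f_pos[of q] by (simp add: lnf_def exp_double)
  show ?thesis
    unfolding e
    using has_derivative_exp[OF has_derivative_mult_right[OF A.M.dfun_has_derivative[OF smooth_lnf, of
      q], of 2]]
    by (simp add: x mult_ac)
qed

lemma F_has_derivative_img: "x \<in> cmap (chart_at M1 q) ` cdom (chart_at M1 q) \<Longrightarrow>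
    (P.F (chart_at M1 q) has_derivative fderiv (P.F (chart_at M1 q)) x) (at x)"
  by (rule fderiv_works[OF Ck_on_differentiable[OF P.F_Ck[OF A.M.chart_at_atlas]]])

lemma fderiv_F: "fderiv (P.F (chart_at M1 q)) (cmap (chart_at M1 q) q) a = 2 * (f q)\<^sup>2 * dlnf q a"
  by (simp add: fderiv_eq[OF F_has_derivative])

lemma F_at: "P.F (chart_at M1 q) (cmap (chart_at M1 q) q) = (f q)\<^sup>2"
  by (simp add: P.F_def)

text \<open>Both the metric and the vertical and horizontal parts of the metric are warped sums.\<close>

lemma
  fixes p :: "'a1 \<times> 'a2"
  defines "c \<equiv> chart_at M1 (fst p)" and "d \<equiv> chart_at M2 (snd p)"
  assumes \<alpha>: "form_field (cmap c ` cdom c) (local_form M1 \<alpha> c)"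
    and \<beta>: "form_field (cmap d ` cdom d) (local_form M2 \<beta> d)"
  shows form_field_W: "form_field (cmap c ` cdom c \<times> cmap d ` cdom d)
      (local_form W (warped_form \<alpha> (\<lambda>p. (f p)\<^sup>2) \<beta>) (chart_at W p))"
    and dform_W: "dform (local_form W (warped_form \<alpha> (\<lambda>p. (f p)\<^sup>2) \<beta>) (chart_at W p)) (cmap (chart_at W
      p) p) a u v =
      dform (local_form M1 \<alpha> c) (cmap c (fst p)) (fst a) (fst u) (fst v)
      + fsq p * dform (local_form M2 \<beta> d) (cmap d (snd p)) (snd a) (snd u) (snd v)
      + 2 * fsq p * dl p a * \<beta> (snd p) (snd u) (snd v)"
proof -
  let ?S = "cmap c ` cdom c" and ?T = "cmap d ` cdom d"
  have cd: "c \<in> atlas M1" "d \<in> atlas M2" by (simp_all add: c_def d_def)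
  have F: "(P.F c has_derivative fderiv (P.F c) x) (at x)" if "x \<in> ?S" for x
    using that unfolding c_def by (rule F_has_derivative_img)
  have e: "local_form W (warped_form \<alpha> (\<lambda>p. (f p)\<^sup>2) \<beta>) (chart_at W p) z u v
      = warped_form (local_form M1 \<alpha> c) (P.F c) (local_form M2 \<beta> d) z u v" if "z \<in> ?S \<times> ?T" for z u v
    using P.local_form_warped[OF cd that] by (simp add: c_def d_def)
  show "form_field (?S \<times> ?T) (local_form W (warped_form \<alpha> (\<lambda>p. (f p)\<^sup>2) \<beta>) (chart_at W p))"
    by (rule form_field_cong[OF form_field_warped[OF \<alpha> \<beta> F] e])
  have x: "cmap c (fst p) \<in> ?S" "cmap d (snd p) \<in> ?T" by (simp_all add: c_def d_def)
  have q: "cmap (chart_at W p) p = (cmap c (fst p), cmap d (snd p))"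
    by (cases p) (simp add: c_def d_def)
  have "dform (local_form W (warped_form \<alpha> (\<lambda>p. (f p)\<^sup>2) \<beta>) (chart_at W p)) (cmap c (fst p), cmap d (snd
    p)) a u v
    = dform (warped_form (local_form M1 \<alpha> c) (P.F c) (local_form M2 \<beta> d)) (cmap c (fst p), cmap d (snd
      p)) a u v"
    by (rule dform_cong[OF open_Times[OF A.M.open_img[OF cd(1)] B.M.open_img[OF cd(2)]]]) (use x e in auto)
  also have "\<dots> = dform (local_form M1 \<alpha> c) (cmap c (fst p)) (fst a) (fst u) (fst v)
      + P.F c (cmap c (fst p)) * dform (local_form M2 \<beta> d) (cmap d (snd p)) (snd a) (snd u) (snd v)
      + fderiv (P.F c) (cmap c (fst p)) (fst a) * local_form M2 \<beta> d (cmap d (snd p)) (snd u) (snd v)"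
    by (rule dform_warped[OF \<alpha> \<beta> F x])
  finally show "dform (local_form W (warped_form \<alpha> (\<lambda>p. (f p)\<^sup>2) \<beta>) (chart_at W p)) (cmap (chart_at W p)
    p) a u v =
      dform (local_form M1 \<alpha> c) (cmap c (fst p)) (fst a) (fst u) (fst v)
      + fsq p * dform (local_form M2 \<beta> d) (cmap d (snd p)) (snd a) (snd u) (snd v)
      + 2 * fsq p * dl p a * \<beta> (snd p) (snd u) (snd v)"
    by (simp only: q) (simp add: c_def d_def F_at fderiv_F)
qed

lemma dform_metric_W: "dform (local_metric W (chart_at W p)) (cmap (chart_at W p) p) a u v =
      dform (local_metric M1 (chart_at M1 (fst p))) (cmap (chart_at M1 (fst p)) (fst p)) (fst a) (fst u) (fst v)
      + fsq p * dform (local_metric M2 (chart_at M2 (snd p))) (cmap (chart_at M2 (snd p)) (snd p)) (snd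
        a) (snd u) (snd v)
      + 2 * fsq p * dl p a * met2 p u v"
  using dform_W[OF A.M.form_field_local_metric[OF A.M.chart_at_atlas, of "fst p", unfolded local_metric_eq]
      B.M.form_field_local_metric[OF B.M.chart_at_atlas, of "snd p", unfolded local_metric_eq]]
  by (simp add: local_metric_eq P.metric_W)

text \<open>The product of \<open>T(u, v)\<close> with \<open>h\<close> on the warped product, by
  \<open>T_tensor_W\<close>. The last term comes from the weight; it makes totally geodesic fibers
  of the second factor umbilical in the product.\<close>

definition second_ff_W :: "'a1 \<times> 'a2 \<Rightarrow> 'e1 \<times> 'e2 \<Rightarrow> 'e1 \<times> 'e2 \<Rightarrow> 'e1 \<times> 'e2 \<Rightarrow> real" where
  "second_ff_W p u v h = sff1 p u v h
    + fsq p * sff2 p u v h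
    - fsq p * dl p h * met2 p u v"

text \<open>\<open>covariant_derivative_horiz\<close> for the warped sum of the horizontal forms. Of
  the derivatives of the weight only the one along \<open>h\<close> survives, as the others multiply
  products of vertical with horizontal vectors.\<close>

lemma T_tensor_W:
  assumes W: "open Z" "p \<in> Z" "vertical_field_on W V \<phi> Z X" "vertical_field_on W V \<phi> Z Y"
    and h: "h \<in> S.horiz p"
  shows "S.met p (T_tensor W V \<phi> X Y p) h = second_ff_W p (X p) (Y p) h"
proof -
  let ?\<kappa> = "warped_form A.hform (\<lambda>p. (f p)\<^sup>2) B.hform"
  have v: "X p \<in> S.vert p" "Y p \<in> S.vert p" using W by (auto simp: vertical_field_on_def)
  then have v': "fst (X p) \<in> A.vert (fst p)" "snd (X p) \<in> B.vert (snd p)"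
    "fst (Y p) \<in> A.vert (fst p)" "snd (Y p) \<in> B.vert (snd p)" by (auto simp: vert_W)
  have h': "fst h \<in> A.horiz (fst p)" "snd h \<in> B.horiz (snd p)" using h by (auto simp: horiz_W)
  have "S.met p (covariant_derivative W X Y p) h =
    koszul (local_metric W (chart_at W p)) (cmap (chart_at W p) p) (X p) (Y p) h / 2
    - dform (local_form W ?\<kappa> (chart_at W p)) (cmap (chart_at W p) p) (X p) (Y p) h"
  proof (rule S.covariant_derivative_horiz[OF W(1,2)])
    show "smooth_field_on W Z Y" using W(4) by (simp add: vertical_field_on_def)
    show "form_field (cmap (chart_at M1 (fst p)) ` cdom (chart_at M1 (fst p)) \<times> cmap (chart_at M2 (snd
      p)) ` cdom (chart_at M2 (snd p)))
       (local_form W ?\<kappa> (chart_at W p))"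
      by (rule form_field_W) (simp_all add: A.form_field_hloc B.form_field_hloc)
    show "cmap (chart_at W p) p \<in> cmap (chart_at M1 (fst p)) ` cdom (chart_at M1 (fst p)) \<times> cmap
      (chart_at M2 (snd p)) ` cdom (chart_at M2 (snd p))"
      by (cases p) simp
    show "?\<kappa> q (Y q) w = 0" if "q \<in> Z" for q w
      using W(4) that by (auto simp: vertical_field_on_def vert_W warped_form_def A.vert_hform
        B.vert_hform mem_Times_iff)
    show "?\<kappa> p w h = S.met p w h" for w
      by (simp add: warped_form_def met_W A.horiz_hform B.horiz_hform h')
  qed
  also have "dform (local_form W ?\<kappa> (chart_at W p)) (cmap (chart_at W p) p) (X p) (Y p) h
     = dform (A.hloc (chart_at M1 (fst p))) (cmap (chart_at M1 (fst p)) (fst p)) (fst (X p)) (fst (Y p)) (fst h)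
      + fsq p * dform (B.hloc (chart_at M2 (snd p))) (cmap (chart_at M2 (snd p)) (snd p)) (snd (X p))
        (snd (Y p)) (snd h)
      + 2 * fsq p * dl p (X p) * B.hform (snd p) (snd (Y p)) (snd h)"
    by (rule dform_W) (simp_all add: A.form_field_hloc B.form_field_hloc)
  finally show ?thesis
    unfolding T_tensor_def S.met_hproj[OF h] second_ff_W_def A.second_ff_eq[OF v'(1,3)]
      B.second_ff_eq[OF v'(2,4)]
      koszul_def dform_metric_W
    using B.vert_horiz[OF h'(2) v'(4)] B.vert_horiz[OF h'(2) v'(2)] B.vert_hform[OF v'(4), of "snd h"]
    by (simp add: algebra_simps add_divide_distrib diff_divide_distrib)
qed

section \<open>The vertical energy of the product\<close>

definition vform_W :: "'a1 \<times> 'a2 \<Rightarrow> 'e1 \<times> 'e2 \<Rightarrow> 'e1 \<times> 'e2 \<Rightarrow> real" where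
  "vform_W = warped_form A.vform (\<lambda>p. (f p)\<^sup>2) B.vform"

lemma vform_W_eq: "vform_W p u v = S.met p (S.vproj p u) v"
  by (simp add: vform_W_def warped_form_def A.vform_eq B.vform_eq met_W vproj_W)

lemma vform_W_sym: "vform_W p u v = vform_W p v u"
  by (simp add: vform_W_def warped_form_def A.vform_sym[of _ "fst u"] B.vform_sym[of _ "snd u"])

lemma vform_W_self: "vform_W p u u = S.met p (S.vproj p u) (S.vproj p u)"
  by (simp add: vform_W_def warped_form_def A.vform_vproj B.vform_vproj met_W vproj_W)

text \<open>The acceleration \<open>a\<close> occurs only in its product with \<open>v\<close>,
  which the geodesic equation supplies. In each factor the derivatives of the forms collect by
  \<open>second_ff_energy\<close>; those of the weight leave the last term here and the one inside
  \<open>second_ff_W\<close>.\<close>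

lemma vertical_energy_deriv:
  assumes \<gamma>: "geodesic W I \<gamma>" "t \<in> I" and p: "p = \<gamma> t" and u: "u = velocity W \<gamma> t"
    and v: "v = S.vproj p u" and h: "h = S.hproj p u"
  shows "((\<lambda>s. vform_W (\<gamma> s) (velocity W \<gamma> s) (velocity W \<gamma> s)) has_real_derivative
    2 * second_ff_W p v v h + 2 * fsq p * dl p v * met2 p h h) (at t)"
proof -
  let ?c = "chart_at M1 (fst p)" and ?d = "chart_at M2 (snd p)"
  let ?e = "chart_at W p" let ?x = "cmap ?e p"
  have ff: "form_field (cmap ?c ` cdom ?c \<times> cmap ?d ` cdom ?d) (local_form W vform_W ?e)"
    unfolding vform_W_def by (rule form_field_W) (simp_all add: A.form_field_vloc B.form_field_vloc)
  have x: "?x \<in> cmap ?c ` cdom ?c \<times> cmap ?d ` cdom ?d" by (cases p) simp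
  obtain a where a: "\<And>w. 2 * S.met p a w = - koszul (local_metric W ?e) ?x u u w"
    "((\<lambda>s. vform_W (\<gamma> s) (velocity W \<gamma> s) (velocity W \<gamma> s)) has_real_derivative
      (dform (local_form W vform_W ?e) ?x u u u + vform_W p a u + vform_W p u a)) (at t)"
    by (rule P.W.geodesic_form_deriv[OF \<gamma> _ u, of ?e ?x]) (use p ff x that in auto)
  have u_eq: "u = v + h" using S.split_sum[of u p] v h by simp
  have vh: "fst v \<in> A.vert (fst p)" "snd v \<in> B.vert (snd p)" "fst h \<in> A.horiz (fst p)" "snd h \<in> B.horiz (snd p)"
    using S.vproj_vert[of p u] S.hproj_horiz[of p u] by (auto simp: v h vert_W horiz_W)
  have 1: "vform_W p a u + vform_W p u a = 2 * S.met p a v"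
    using vform_W_eq[of p u a] vform_W_sym[of p a u] P.W.sym_metric[of p a v] by (simp add: v)
  have 2: "B.vform (snd p) (snd u) (snd u) = met2 p v v"
    by (simp add: B.vform_vproj v vproj_W)
  have z: "met2 p v h = 0" "met2 p h v = 0"
    using B.vert_horiz[OF vh(4,2)] B.horiz_vert[OF vh(4,2)] .
  have 3: "met2 p u v = met2 p v v"
    "met2 p u u = met2 p v v + met2 p h h"
    using z by (simp_all add: u_eq B.M.metric.simps)
  have 4: "dform (local_form W vform_W ?e) ?x u u u =
      dform (A.vloc ?c) (cmap ?c (fst p)) (fst u) (fst u) (fst u)
      + fsq p * dform (B.vloc ?d) (cmap ?d (snd p)) (snd u) (snd u) (snd u)
      + 2 * fsq p * dl p u * B.vform (snd p) (snd u) (snd u)"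
    unfolding vform_W_def by (rule dform_W) (simp_all add: A.form_field_vloc B.form_field_vloc)
  have 5: "2 * S.met p a v = dform (local_metric W ?e) ?x v u u - 2 * dform (local_metric W ?e) ?x u u v"
    using a(1)[of v] by (simp add: koszul_def)
  have L: "dl p u = dl p v + dl p h"
    using linear_add[OF A.M.linear_dfun[OF smooth_lnf]] by (simp add: u_eq)
  have EA: "dform (A.vloc ?c) (cmap ?c (fst p)) (fst u) (fst u) (fst u) = 2 * sff1 p v v h
      + 2 * dform (local_metric M1 ?c) (cmap ?c (fst p)) (fst u) (fst u) (fst v)
      - dform (local_metric M1 ?c) (cmap ?c (fst p)) (fst v) (fst u) (fst u)"
    using A.second_ff_energy[OF vh(1,3)] by (simp add: u_eq)
  have EB: "dform (B.vloc ?d) (cmap ?d (snd p)) (snd u) (snd u) (snd u) = 2 * sff2 p v v h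
      + 2 * dform (local_metric M2 ?d) (cmap ?d (snd p)) (snd u) (snd u) (snd v)
      - dform (local_metric M2 ?d) (cmap ?d (snd p)) (snd v) (snd u) (snd u)"
    using B.second_ff_energy[OF vh(2,4)] by (simp add: u_eq)
  have "dform (local_form W vform_W ?e) ?x u u u + vform_W p a u + vform_W p u a =
    2 * second_ff_W p v v h + 2 * fsq p * dl p v * met2 p h h"
    unfolding add.assoc 1 5 4 dform_metric_W 2 3 L EA EB second_ff_W_def
    by (simp add: algebra_simps)
  with a(2) show ?thesis by simp
qed

end

section \<open>Clairaut maps\<close>

lemma smooth_field_on_chart_Ck:
  assumes "smooth_field_on M (cdom c) X" "c \<in> atlas M"
  shows "Ck_on k (cmap c ` cdom c) (\<lambda>x. tangent_to_chart M c (cinv c x) (X (cinv c x)))"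
proof -
  have "smooth_on (cmap c ` (cdom c \<inter> cdom c)) (\<lambda>x. tangent_to_chart M c (cinv c x) (X (cinv c x)))"
    using assms unfolding smooth_field_on_def by (rule bspec)
  then show ?thesis by (simp add: smooth_on_Ck)
qed

context riem_map
begin

lemma linear_second_ff: "linear (second_ff p u v)"
  using linear_compose_scale_right[OF koszul_linear[OF form_field_vloc[OF M.chart_at_atlas] x_img], of "1/2"]
  by (simp add: second_ff_def[abs_def])

lemma second_ff_sum: "second_ff p (u + v) (u + v) h = second_ff p u u h + second_ff p v v h + 2 *
  second_ff p u v h"
proof -
  interpret L: form_field "cmap (chart_at M p) ` cdom (chart_at M p)" "vloc (chart_at M p)" by (rule
    form_field_vloc) simp
  show ?thesis
    by (simp add: second_ff_def koszul_def L.dform_simps[OF x_img] dform_vloc_sym[of p h v u] field_simps)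
qed

lemma second_ff_0: "second_ff p 0 0 h = 0" "second_ff p u v 0 = 0"
  \<comment> \<open>With \<open>u = v = 0\<close> the polarization identity says that a number is
    four times itself.\<close>
  using second_ff_sum[of p 0 0 h] linear_0[OF linear_second_ff] by simp_all

text \<open>The rank is positive, and the differential maps the horizontal space onto its
  range.\<close>

lemma horiz_nontrivial: "\<exists>h\<in>horiz p. h \<noteq> 0"
proof (rule ccontr)
  assume "\<not> ?thesis"
  then have "d\<phi> p ` horiz p \<subseteq> {0}" using linear_0[OF linear_differential] by auto
  then have "range (d\<phi> p) \<subseteq> {0}" using riem by (simp add: riemannian_map_def)
  then have "dim (range (d\<phi> p)) = 0" by (simp add: dim_eq_0)
  moreover have "0 < dim (range (d\<phi> p))" using riem unfolding riemannian_map_def by blast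
  ultimately show False by linarith
qed

lemma vertical_extension_pair:
  assumes "u \<in> vert p" "v \<in> vert p"
  obtains Z U V where "open Z" "p \<in> Z" "vertical_field_on M N \<phi> Z U" "vertical_field_on M N \<phi> Z V" "U p
    = u" "V p = v"
proof -
  obtain U where U: "vertical_field_on M N \<phi> (cdom (chart_at M p)) U" "U p = u"
    using vertical_extension[OF assms(1)] by blast
  obtain V where V: "vertical_field_on M N \<phi> (cdom (chart_at M p)) V" "V p = v"
    using vertical_extension[OF assms(2)] by blast
  show ?thesis using that[OF M.open_cdom M.in_chart_at U(1) V(1) U(2) V(2)] by simp
qed

end

text \<open>The average of equal vectors. A nontrivial vertical space excludes dimension 0, where
  division by zero would give the value 0.\<close>

lemma (in hv_split) mean_curvature_umbilic:
  assumes ext: "\<And>e. e \<in> vert p \<Longrightarrow> \<exists>W V. open W \<and> p \<in> W \<and> vertical_field_on M N \<phi> W V \<and> V p = e"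
    and nz: "vert p \<noteq> {0}"
    and T: "\<And>W U. open W \<Longrightarrow> p \<in> W \<Longrightarrow> vertical_field_on M N \<phi> W U \<Longrightarrow> T_tensor M N \<phi> U U p = met p (U p) (U p) *\<^sub>R X"
  shows "mean_curvature M N \<phi> p = X"
proof (rule mean_curvature_eqI[OF ext])
  fix W E assume W: "open W" "p \<in> W" "\<forall>i<dim (vert p). vertical_field_on M N \<phi> W (E i)"
    and on: "\<forall>i<dim (vert p). \<forall>j<dim (vert p). met p (E i p) (E j p) = (if i = j then 1 else 0)"
  have sX: "(\<Sum>i<dim (vert p). T_tensor M N \<phi> (E i) (E i) p) = (\<Sum>i<dim (vert p). X)"
    using W on by (intro sum.cong refl) (simp add: T)
  have "(1 / real m) *\<^sub>R (real m *\<^sub>R X) = X" if "m > 0" for m using that by simp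
  then show "(1 / real (dim (vert p))) *\<^sub>R (\<Sum>i<dim (vert p). T_tensor M N \<phi> (E i) (E i) p) = X"
    unfolding sX sum_constant_scaleR card_lessThan using dim_vert_pos[OF nz] by blast
qed

lemma (in hv_split) T_tensor_horiz: "T_tensor M N \<phi> U V p \<in> horiz p"
  by (simp add: T_tensor_def hproj_horiz)

context warped_maps
begin

lemma vertical_extension_W:
  assumes e: "e \<in> S.vert p"
  shows "\<exists>Z X. open Z \<and> p \<in> Z \<and> vertical_field_on W V \<phi> Z X \<and> X p = e"
proof -
  let ?c = "chart_at M1 (fst p)" and ?d = "chart_at M2 (snd p)"
  let ?Z = "cdom ?c \<times> cdom ?d"
  have e': "fst e \<in> A.vert (fst p)" "snd e \<in> B.vert (snd p)" using e by (auto simp: vert_W)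
  obtain X1 where X1: "vertical_field_on M1 N1 \<phi>1 (cdom ?c) X1" "X1 (fst p) = fst e"
    using A.vertical_extension[OF e'(1)] by blast
  obtain X2 where X2: "vertical_field_on M2 N2 \<phi>2 (cdom ?d) X2" "X2 (snd p) = snd e"
    using B.vertical_extension[OF e'(2)] by blast
  define X where "X q = (X1 (fst q), X2 (snd q))" for q
  note o = A.M.open_img[OF A.M.chart_at_atlas, of "fst p"] B.M.open_img[OF B.M.chart_at_atlas, of "snd p"]
  have "smooth_field_on W ?Z X"
  proof (rule P.W.smooth_field_onI[of "product_chart ?c ?d"])
    show "smooth_on (cmap (product_chart ?c ?d) ` ?Z)
       (\<lambda>x. tangent_to_chart W (product_chart ?c ?d) (cinv (product_chart ?c ?d) x) (X (cinv
         (product_chart ?c ?d) x)))"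
    proof (rule smooth_onI)
      fix k
      have "Ck_on k (cmap ?c ` cdom ?c) (\<lambda>x. tangent_to_chart M1 ?c (cinv ?c x) (X1 (cinv ?c x)))"
        using X1(1) by (intro smooth_field_on_chart_Ck) (simp_all add: vertical_field_on_def)
      moreover have "Ck_on k (cmap ?d ` cdom ?d) (\<lambda>x. tangent_to_chart M2 ?d (cinv ?d x) (X2 (cinv ?d x)))"
        using X2(1) by (intro smooth_field_on_chart_Ck) (simp_all add: vertical_field_on_def)
      ultimately have "Ck_on k (cmap ?c ` cdom ?c \<times> cmap ?d ` cdom ?d)
        (\<lambda>z. (tangent_to_chart M1 ?c (cinv ?c (fst z)) (X1 (cinv ?c (fst z))),
              tangent_to_chart M2 ?d (cinv ?d (snd z)) (X2 (cinv ?d (snd z)))))"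
        by (intro Ck_on_Pair open_Times o Ck_on_comp_fst[OF o, where h = "\<lambda>x. tangent_to_chart M1 ?c
          (cinv ?c x) (X1 (cinv ?c x))"]
            Ck_on_comp_snd[OF o, where h = "\<lambda>x. tangent_to_chart M2 ?d (cinv ?d x) (X2 (cinv ?d x))"])
      then have "Ck_on k (cmap ?c ` cdom ?c \<times> cmap ?d ` cdom ?d)
         (\<lambda>x. tangent_to_chart W (product_chart ?c ?d) (cinv (product_chart ?c ?d) x) (X (cinv
           (product_chart ?c ?d) x)))"
        by (rule Ck_on_cong[OF open_Times[OF o]])
          (auto simp: P.cinv_product P.ttc_product X_def)
      then show "Ck_on k (cmap (product_chart ?c ?d) ` ?Z)
         (\<lambda>x. tangent_to_chart W (product_chart ?c ?d) (cinv (product_chart ?c ?d) x) (X (cinv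
           (product_chart ?c ?d) x)))"
        by (simp add: P.image_product)
    qed
  qed (simp_all add: open_Times A.M.open_cdom B.M.open_cdom)
  moreover have "X q \<in> S.vert q" if "q \<in> ?Z" for q
    using X1(1) X2(1) that by (auto simp: X_def vert_W vertical_field_on_def)
  moreover have "open ?Z" "p \<in> ?Z" by (simp_all add: open_Times A.M.open_cdom B.M.open_cdom mem_Times_iff)
  moreover have "X p = e" by (simp add: X_def X1(2) X2(2))
  ultimately show ?thesis unfolding vertical_field_on_def by blast
qed

text \<open>Twice the derivative of \<open>ln (r sin \<theta>)\<close> along a geodesic, multiplied by the vertical energy;
  \<open>v\<close> and \<open>h\<close> are the vertical and horizontal parts of the velocity.\<close>

definition defect :: "('a1 \<times> 'a2 \<Rightarrow> real) \<Rightarrow> 'a1 \<times> 'a2 \<Rightarrow> 'e1 \<times> 'e2 \<Rightarrow> 'e1 \<times> 'e2 \<Rightarrow> real" where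
  "defect g p v h = 2 * P.W.dfun g p (v + h) * S.met p v v + 2 * second_ff_W p v v h
    + 2 * fsq p * dl p v * met2 p h h"

section \<open>The Clairaut condition along geodesics\<close>

lemma weighted_energy_deriv:
  assumes \<gamma>: "geodesic W I \<gamma>" "t \<in> I" and g: "smooth_function W g"
  shows "((\<lambda>s. exp (2 * g (\<gamma> s)) * vform_W (\<gamma> s) (velocity W \<gamma> s) (velocity W \<gamma> s)) has_real_derivative
    exp (2 * g (\<gamma> t)) * defect g (\<gamma> t) (S.vproj (\<gamma> t) (velocity W \<gamma> t)) (S.hproj (\<gamma> t) (velocity W \<gamma>
      t))) (at t)"
proof -
  have 1: "((\<lambda>s. exp (2 * g (\<gamma> s))) has_real_derivative
      exp (2 * g (\<gamma> t)) * (2 * P.W.dfun g (\<gamma> t) (velocity W \<gamma> t))) (at t)"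
    by (rule DERIV_fun_exp[OF DERIV_cmult[OF P.W.geodesic_fun_deriv[OF \<gamma> g]]])
  show ?thesis
    unfolding defect_def S.split_sum[symmetric]
    using DERIV_mult[OF 1 vertical_energy_deriv[OF \<gamma> refl refl refl refl]]
    by (simp add: vform_W_self algebra_simps)
qed

text \<open>Two forms of one identity: the first, free of roots and quotients, is to be
  differentiated; the second shows constancy once energy and speed are constant.\<close>

lemma r_sin_squared:
  assumes "u \<noteq> 0"
  shows "(exp (g p) * sin (horizontal_angle W V \<phi> p u))\<^sup>2 * S.met p u u = exp (2 * g p) * vform_W p u u"
    and "exp (g p) * sin (horizontal_angle W V \<phi> p u) = sqrt (exp (2 * g p) * vform_W p u u / S.met p u u)"
proof -
  have N: "S.met p u u > 0" using P.W.pos_metric assms by simp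
  have E: "vform_W p u u \<ge> 0" by (simp add: vform_W_self P.W.metric.nonneg)
  have s: "sin (horizontal_angle W V \<phi> p u) = sqrt (vform_W p u u / S.met p u u)"
    by (simp add: S.sin_horizontal_angle assms vform_W_self)
  have e: "exp (2 * g p) = (exp (g p))\<^sup>2" by (simp add: exp_double)
  show "(exp (g p) * sin (horizontal_angle W V \<phi> p u))\<^sup>2 * S.met p u u = exp (2 * g p) * vform_W p u u"
    using N E by (simp add: s e power_mult_distrib)
  show "exp (g p) * sin (horizontal_angle W V \<phi> p u) = sqrt (exp (2 * g p) * vform_W p u u / S.met p u u)"
    by (simp add: s e real_sqrt_mult real_sqrt_divide)
qed

text \<open>Every pair \<open>v\<close>, \<open>h\<close> with nonzero sum is realized by a geodesic
  that starts with velocity \<open>v + h\<close>; the defect is read off from the derivative at time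
  0.\<close>

lemma clairaut_imp_defect_zero:
  assumes g: "smooth_function W g" and cl: "clairaut_with W V \<phi> (\<lambda>p. exp (g p))"
    and v: "v \<in> S.vert p" and h: "h \<in> S.horiz p" and nz: "v + h \<noteq> 0"
  shows "defect g p v h = 0"
proof -
  obtain a \<gamma> where a: "0 < a" and \<gamma>: "geodesic W {-a<..<a} \<gamma>" "\<gamma> 0 = p" "velocity W \<gamma> 0 = v + h"
    and vel: "\<And>t. t \<in> {-a<..<a} \<Longrightarrow> velocity W \<gamma> t \<noteq> 0"
    by (rule P.W.geodesic_exists[OF nz, of p]) (rule that)
  let ?I = "{-a<..<a}"
  obtain K where K: "\<And>t. t \<in> ?I \<Longrightarrow> exp (g (\<gamma> t)) * sin (horizontal_angle W V \<phi> (\<gamma> t) (velocity W \<gamma> t)) = K"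
    using cl \<gamma>(1) vel unfolding clairaut_with_def constant_on_def by metis
  have 0: "0 \<in> ?I" using a by simp
  \<comment> \<open>The weighted energy is \<open>K\<close> squared times the squared speed, and the
    speed is constant.\<close>
  have 1: "((\<lambda>s. exp (2 * g (\<gamma> s)) * vform_W (\<gamma> s) (velocity W \<gamma> s) (velocity W \<gamma> s))
    has_real_derivative K\<^sup>2 * 0) (at 0)"
  proof (rule DERIV_cmult[OF P.W.geodesic_speed_deriv[OF \<gamma>(1) 0], THEN
    has_field_derivative_transform_within_open])
    show "K\<^sup>2 * S.met (\<gamma> s) (velocity W \<gamma> s) (velocity W \<gamma> s)
      = exp (2 * g (\<gamma> s)) * vform_W (\<gamma> s) (velocity W \<gamma> s) (velocity W \<gamma> s)" if "s \<in> ?I" for s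
      using r_sin_squared(1)[OF vel[OF that], of g "\<gamma> s"] K[OF that] by simp
  qed (use a in auto)
  have "S.vproj p (v + h) = v" "S.hproj p (v + h) = h"
    using v h S.hproj_eqI[of h p "v + h"] by (simp_all add: S.vproj_def)
  then have "K\<^sup>2 * 0 = exp (2 * g p) * defect g p v h"
    using DERIV_unique[OF 1 weighted_energy_deriv[OF \<gamma>(1) 0 g]] by (simp add: \<gamma>)
  then show ?thesis by simp
qed

lemma defect_zero_imp_clairaut:
  assumes g: "smooth_function W g" and z: "\<And>p v h. v \<in> S.vert p \<Longrightarrow> h \<in> S.horiz p \<Longrightarrow> defect g p v h = 0"
  shows "clairaut_with W V \<phi> (\<lambda>p. exp (g p))"
  unfolding clairaut_with_def
proof (intro conjI allI impI)
  fix I \<gamma> assume "geodesic W I \<gamma> \<and> (\<forall>t\<in>I. velocity W \<gamma> t \<noteq> 0)"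
  then have \<gamma>: "geodesic W I \<gamma>" and vel: "\<And>t. t \<in> I \<Longrightarrow> velocity W \<gamma> t \<noteq> 0" by auto
  have I: "convex I" using \<gamma> by (auto simp: geodesic_def is_interval_convex)
  have "\<exists>C. \<forall>t\<in>I. exp (2 * g (\<gamma> t)) * vform_W (\<gamma> t) (velocity W \<gamma> t) (velocity W \<gamma> t) = C"
  proof (rule has_field_derivative_zero_constant[OF I])
    fix t assume "t \<in> I"
    from weighted_energy_deriv[OF \<gamma> this g]
    show "((\<lambda>s. exp (2 * g (\<gamma> s)) * vform_W (\<gamma> s) (velocity W \<gamma> s) (velocity W \<gamma> s)) has_real_derivative
      0) (at t within I)"
      by (simp add: z S.vproj_vert S.hproj_horiz has_field_derivative_at_within)
  qed
  then obtain C where C: "\<And>t. t \<in> I \<Longrightarrow> exp (2 * g (\<gamma> t)) * vform_W (\<gamma> t) (velocity W \<gamma> t) (velocity W \<gamma>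
    t) = C" by blast
  have "\<exists>D. \<forall>t\<in>I. S.met (\<gamma> t) (velocity W \<gamma> t) (velocity W \<gamma> t) = D"
    by (rule has_field_derivative_zero_constant[OF I])
      (rule has_field_derivative_at_within[OF P.W.geodesic_speed_deriv[OF \<gamma>]])
  then obtain D where D: "\<And>t. t \<in> I \<Longrightarrow> S.met (\<gamma> t) (velocity W \<gamma> t) (velocity W \<gamma> t) = D" by blast
  have "exp (g (\<gamma> t)) * sin (horizontal_angle W V \<phi> (\<gamma> t) (velocity W \<gamma> t)) = sqrt (C / D)" if "t \<in> I" for t
    using r_sin_squared(2)[OF vel[OF that], of g "\<gamma> t"] C[OF that] D[OF that] by simp
  then show "(\<lambda>t. exp (g (\<gamma> t)) * sin (horizontal_angle W V \<phi> (\<gamma> t) (velocity W \<gamma> t))) constant_on I"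
    unfolding constant_on_def by blast
qed simp

text \<open>The middle term of the equivalence: a condition at each point, free of \<open>g\<close>,
  of vector fields and of mean curvature.\<close>

definition fiber_cond :: bool where
  "fiber_cond \<longleftrightarrow> (\<forall>q. \<forall>v\<in>A.vert q. dlnf q v = 0) \<and>
    (\<forall>q. \<forall>v\<in>A.vert q. \<forall>v'\<in>A.vert q. \<forall>h\<in>A.horiz q. A.second_ff q v v' h = - dlnf q h * A.met q v v') \<and>
    (\<forall>q. \<forall>v\<in>B.vert q. \<forall>v'\<in>B.vert q. \<forall>h\<in>B.horiz q. B.second_ff q v v' h = 0)"

text \<open>Geodesics and traces see only the quadratic forms; polarization recovers the bilinear
  ones.\<close>

lemma fiber_condI:
  assumes 1: "\<And>q v. v \<in> A.vert q \<Longrightarrow> dlnf q v = 0"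
    and 2: "\<And>q v h. v \<in> A.vert q \<Longrightarrow> h \<in> A.horiz q \<Longrightarrow> A.second_ff q v v h = - dlnf q h * A.met q v v"
    and 3: "\<And>q v h. v \<in> B.vert q \<Longrightarrow> h \<in> B.horiz q \<Longrightarrow> B.second_ff q v v h = 0"
  shows fiber_cond
proof -
  have "A.second_ff q v v' h = - dlnf q h * A.met q v v'"
    if "v \<in> A.vert q" "v' \<in> A.vert q" "h \<in> A.horiz q" for q v v' h
    using 2[OF that(1,3)] 2[OF that(2,3)] 2[OF subspace_add[OF A.subspace_vert that(1,2)] that(3)]
      A.second_ff_sum[of q v v' h] A.M.sym_metric[of q v' v]
    by (simp add: A.M.metric.simps algebra_simps)
  moreover have "B.second_ff q v v' h = 0"
    if "v \<in> B.vert q" "v' \<in> B.vert q" "h \<in> B.horiz q" for q v v' h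
    using 3[OF that(1,3)] 3[OF that(2,3)] 3[OF subspace_add[OF B.subspace_vert that(1,2)] that(3)]
      B.second_ff_sum[of q v v' h] by simp
  ultimately show ?thesis unfolding fiber_cond_def using 1 by blast
qed

lemma linear_dlnf: "linear (dlnf q)"
  by (rule A.M.linear_dfun[OF smooth_lnf])

lemma second_ff_W_linear:
  "second_ff_W p u v (- h) = - second_ff_W p u v h" "second_ff_W p u v 0 = 0"
  by (simp_all add: second_ff_W_def linear_neg[OF A.linear_second_ff] linear_neg[OF B.linear_second_ff]
      linear_neg[OF linear_dlnf] linear_0[OF linear_dlnf] A.second_ff_0 B.second_ff_0)

lemma clairaut_imp_fiber_cond:
  assumes g: "smooth_function W g" and cl: "clairaut_with W V \<phi> (\<lambda>p. exp (g p))"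
    and f1: "\<And>q. A.vert q \<noteq> {0}" and f2: "\<And>q. B.vert q \<noteq> {0}"
  shows fiber_cond
proof -
  let ?dg = "P.W.dfun g"
  have lin: "linear (?dg p)" for p by (rule P.W.linear_dfun[OF g])
  \<comment> \<open>No geodesic realizes the velocity 0, so that case is separate; by orthogonality
    both parts vanish then.\<close>
  have dz: "defect g p v h = 0" if "v \<in> S.vert p" "h \<in> S.horiz p" for p v h
  proof (cases "v + h = 0")
    case True
    have "v = 0" "h = 0"
    proof -
      have "h = - v" using True by (simp add: eq_neg_iff_add_eq_0 add.commute)
      then have "S.met p v v = 0" using S.horiz_vert[OF that(2,1)] by (simp add: P.W.metric.simps)
      then show "v = 0" by (simp add: P.W.metric.zero_iff)
      then show "h = 0" using True by simp
    qed
    then show ?thesis by (simp add: defect_def second_ff_W_linear P.W.metric.simps linear_0[OF linear_dlnf])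
  qed (rule clairaut_imp_defect_zero[OF g cl that])
  \<comment> \<open>With \<open>h = 0\<close> only twice the product of \<open>dg(v)\<close> with
    the square of \<open>|v|\<close> is left of the defect.\<close>
  have dgv: "?dg p v = 0" if v: "v \<in> S.vert p" for p v
  proof (cases "v = 0")
    case False
    then have "S.met p v v > 0" by (rule P.W.pos_metric)
    moreover have "?dg p v * S.met p v v = 0"
      using dz[OF v subspace_0[OF S.subspace_horiz]] by (simp add: defect_def second_ff_W_linear
        B.M.metric.simps)
    ultimately show ?thesis by simp
  qed (simp add: linear_0[OF lin])
  have key: "?dg p h * S.met p v v + second_ff_W p v v h = 0"
    "dl p v * met2 p h h = 0"
    if v: "v \<in> S.vert p" and h: "h \<in> S.horiz p" for p v h
  proof -
    have plus: "2 * (?dg p h * S.met p v v) + 2 * second_ff_W p v v h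
        + 2 * fsq p * (dl p v * met2 p h h) = 0"
      using dz[OF v h] by (simp add: defect_def linear_add[OF lin] dgv[OF v])
    \<comment> \<open>Replacing \<open>h\<close> by its negative flips the first two terms and keeps
      the third, so each group vanishes.\<close>
    have minus: "- 2 * (?dg p h * S.met p v v) - 2 * second_ff_W p v v h
        + 2 * fsq p * (dl p v * met2 p h h) = 0"
      using dz[OF v subspace_neg[OF S.subspace_horiz h]]
      by (simp add: defect_def linear_diff[OF lin] dgv[OF v] second_ff_W_linear B.M.metric.simps)
    from plus minus show "?dg p h * S.met p v v + second_ff_W p v v h = 0" by linarith
    from plus minus have "fsq p * (dl p v * met2 p h h) = 0" by linarith
    then show "dl p v * met2 p h h = 0" using f2_pos[of "fst p"] by auto
  qed
  note zero = subspace_0[OF A.subspace_vert] subspace_0[OF B.subspace_vert] subspace_0[OF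
    A.subspace_horiz] subspace_0[OF B.subspace_horiz]
  show ?thesis
  proof (rule fiber_condI)
    fix q1 v assume v: "v \<in> A.vert q1"
    \<comment> \<open>An arbitrary point of the other factor; types are nonempty.\<close>
    obtain q2 :: 'a2 where True by blast
    obtain h where h: "h \<in> B.horiz q2" "h \<noteq> 0" using B.horiz_nontrivial by blast
    have "dlnf q1 v * B.met q2 h h = 0"
      using key(2)[of "(v, 0)" "(q1, q2)" "(0, h)"] v h zero by (simp add: vert_W horiz_W)
    then show "dlnf q1 v = 0" using h(2) by (simp add: B.M.metric.zero_iff)
  next
    fix q1 v h assume v: "v \<in> A.vert q1" and h: "h \<in> A.horiz q1"
    obtain q2 :: 'a2 where True by blast
    \<comment> \<open>For a vertical vector of the second factor, \<open>second_ff_W\<close> along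
      \<open>(h, 0)\<close> consists of the warping term alone, which fixes \<open>dg\<close>
      there.\<close>
    obtain v2 where v2: "v2 \<in> B.vert q2" "v2 \<noteq> 0" using f2[of q2] zero by blast
    have "(?dg (q1, q2) (h, 0) - dlnf q1 h) * ((f q1)\<^sup>2 * B.met q2 v2 v2) = 0"
      using key(1)[of "(0, v2)" "(q1, q2)" "(h, 0)"] v2 h zero
      by (simp add: vert_W horiz_W met_W second_ff_W_def A.second_ff_0 B.second_ff_0 A.M.metric.simps
        algebra_simps)
    then have dg: "?dg (q1, q2) (h, 0) = dlnf q1 h"
      using v2(2) f2_pos[of q1] by (auto simp: B.M.metric.zero_iff)
    show "A.second_ff q1 v v h = - dlnf q1 h * A.met q1 v v"
      using key(1)[of "(v, 0)" "(q1, q2)" "(h, 0)"] v h zero dg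
      by (simp add: vert_W horiz_W met_W second_ff_W_def B.second_ff_0 B.M.metric.simps)
  next
    fix q2 v h assume v: "v \<in> B.vert q2" and h: "h \<in> B.horiz q2"
    obtain q1 :: 'a1 where True by blast
    \<comment> \<open>Along \<open>(0, h)\<close> a vertical vector of the first factor has zero
      \<open>second_ff_W\<close>, hence \<open>dg\<close> vanishes there.\<close>
    obtain v1 where v1: "v1 \<in> A.vert q1" "v1 \<noteq> 0" using f1[of q1] zero by blast
    have "?dg (q1, q2) (0, h) * A.met q1 v1 v1 = 0"
      using key(1)[of "(v1, 0)" "(q1, q2)" "(0, h)"] v1 h zero
      by (simp add: vert_W horiz_W met_W second_ff_W_def A.second_ff_0 B.second_ff_0 B.M.metric.simps
        linear_0[OF linear_dlnf])
    then have dg: "?dg (q1, q2) (0, h) = 0" using v1(2) by (simp add: A.M.metric.zero_iff)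
    have "(f q1)\<^sup>2 * B.second_ff q2 v v h = 0"
      using key(1)[of "(0, v)" "(q1, q2)" "(0, h)"] v h zero dg
      by (simp add: vert_W horiz_W met_W second_ff_W_def A.second_ff_0 A.M.metric.simps linear_0[OF
        linear_dlnf])
    then show "B.second_ff q2 v v h = 0" using f2_pos[of q1] by simp
  qed
qed

text \<open>The function \<open>r\<close> is the warping function itself, lifted to the
  product.\<close>

lemma fiber_cond_imp_clairaut:
  assumes fiber_cond
  shows "clairaut_with W V \<phi> (\<lambda>p. exp (lnf (fst p)))"
proof (rule defect_zero_imp_clairaut[OF smooth_lnf_W])
  fix p v h assume v: "v \<in> S.vert p" and h: "h \<in> S.horiz p"
  have v': "fst v \<in> A.vert (fst p)" "snd v \<in> B.vert (snd p)" "fst h \<in> A.horiz (fst p)" "snd h \<in> B.horiz (snd p)"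
    using v h by (auto simp: vert_W horiz_W)
  have c: "dl p v = 0" "sff1 p v v h = - dl p h * met1 p v v"
    "sff2 p v v h = 0"
    using assms v' unfolding fiber_cond_def by blast+
  show "defect (\<lambda>p. lnf (fst p)) p v h = 0"
    by (simp add: defect_def dfun_lnf_W linear_add[OF linear_dlnf] second_ff_W_def c met_W algebra_simps)
qed

section \<open>Mean curvature and umbilical fibers\<close>

abbreviation "grad_W p \<equiv> gradient W (\<lambda>q. lnf (fst q)) p"

lemma grad_W: "S.met p (grad_W p) v = dl p v"
  by (simp add: P.W.gradient[OF smooth_lnf_W] dfun_lnf_W)

lemma fiber_cond_imp_umbilic:
  assumes fc: fiber_cond and f1: "\<And>q. A.vert q \<noteq> {0}"
  shows "totally_umbilical_fibers M1 N1 \<phi>1" "totally_geodesic_fibers M2 N2 \<phi>2"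
    "mean_curvature W V \<phi> p = - grad_W p"
proof -
  \<comment> \<open>The candidate for the mean curvature of \<open>\<phi>1\<close>; it is horizontal
    because \<open>d ln f\<close> vanishes on vertical vectors.\<close>
  let ?X = "\<lambda>q. - gradient M1 lnf q"
  have X: "?X q \<in> A.horiz q" "A.met q (?X q) h = - dlnf q h" for q h
    using fc A.M.gradient[OF smooth_lnf, of q]
    by (auto simp: horizontal_def fiber_cond_def A.M.metric.simps)
  have TA: "T_tensor M1 N1 \<phi>1 U Y q = A.met q (U q) (Y q) *\<^sub>R ?X q"
    if Z: "open Z" "q \<in> Z" "vertical_field_on M1 N1 \<phi>1 Z U" "vertical_field_on M1 N1 \<phi>1 Z Y" for Z U Y q
  proof (rule A.horiz_eqI[OF A.T_tensor_horiz subspace_scale[OF A.subspace_horiz X(1)]])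
    fix h assume h: "h \<in> A.horiz q"
    have "U q \<in> A.vert q" "Y q \<in> A.vert q" using Z by (auto simp: vertical_field_on_def)
    then show "A.met q (T_tensor M1 N1 \<phi>1 U Y q) h = A.met q (A.met q (U q) (Y q) *\<^sub>R ?X q) h"
      using A.T_tensor_second_ff[OF Z h] fc h X(2)[of q h] by (simp add: fiber_cond_def A.M.metric.simps(5,7))
  qed
  have "mean_curvature M1 N1 \<phi>1 q = ?X q" for q
  proof (rule A.mean_curvature_umbilic[OF _ f1 TA])
    fix e assume "e \<in> A.vert q"
    then show "\<exists>Z U. open Z \<and> q \<in> Z \<and> vertical_field_on M1 N1 \<phi>1 Z U \<and> U q = e"
      using A.vertical_extension_pair by metis
  qed
  then show "totally_umbilical_fibers M1 N1 \<phi>1"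
    unfolding totally_umbilical_fibers_def using TA by auto
  show "totally_geodesic_fibers M2 N2 \<phi>2"
    unfolding totally_geodesic_fibers_def
  proof (intro allI impI ballI)
    fix Z U Y q assume "open Z \<and> vertical_field_on M2 N2 \<phi>2 Z U \<and> vertical_field_on M2 N2 \<phi>2 Z Y" and q: "q \<in> Z"
    then have Z: "open Z" "vertical_field_on M2 N2 \<phi>2 Z U" "vertical_field_on M2 N2 \<phi>2 Z Y" by auto
    show "T_tensor M2 N2 \<phi>2 U Y q = 0"
    proof (rule B.horiz_eqI[OF B.T_tensor_horiz subspace_0[OF B.subspace_horiz]])
      fix h assume h: "h \<in> B.horiz q"
      have "U q \<in> B.vert q" "Y q \<in> B.vert q" using Z q by (auto simp: vertical_field_on_def)
      then show "B.met q (T_tensor M2 N2 \<phi>2 U Y q) h = B.met q 0 h"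
        using B.T_tensor_second_ff[OF Z(1) q Z(2,3) h] fc h by (simp add: fiber_cond_def B.M.metric.simps(9))
    qed
  qed
  have Y: "- grad_W p \<in> S.horiz p"
  proof -
    have "S.met p (- grad_W p) v = 0" if "v \<in> S.vert p" for v
      using that fc by (auto simp: P.W.metric.simps grad_W vert_W fiber_cond_def)
    then show ?thesis by (simp add: horizontal_def[of W])
  qed
  show "mean_curvature W V \<phi> p = - grad_W p"
  proof (rule S.mean_curvature_umbilic[OF vertical_extension_W])
    obtain v where "v \<in> A.vert (fst p)" "v \<noteq> 0" using f1 subspace_0[OF A.subspace_vert] by blast
    then have "(v, 0) \<in> S.vert p" "(v, 0) \<noteq> 0"
      using subspace_0[OF B.subspace_vert] by (auto simp: vert_W zero_prod_def)
    then show "S.vert p \<noteq> {0}" by blast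
    fix Z U assume Z: "open Z" "p \<in> Z" "vertical_field_on W V \<phi> Z U"
    show "T_tensor W V \<phi> U U p = S.met p (U p) (U p) *\<^sub>R - grad_W p"
    proof (rule S.horiz_eqI[OF S.T_tensor_horiz subspace_scale[OF S.subspace_horiz Y]])
      fix h assume h: "h \<in> S.horiz p"
      have "U p \<in> S.vert p" using Z by (auto simp: vertical_field_on_def)
      then have v: "fst (U p) \<in> A.vert (fst p)" "snd (U p) \<in> B.vert (snd p)" "fst h \<in> A.horiz (fst p)"
        "snd h \<in> B.horiz (snd p)"
        using h by (auto simp: vert_W horiz_W)
      then have "sff1 p (U p) (U p) h = - dl p h * met1 p (U p) (U p)"
        "sff2 p (U p) (U p) h = 0"
        using fc unfolding fiber_cond_def by blast+
      then have "second_ff_W p (U p) (U p) h = S.met p (U p) (U p) * - dl p h"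
        by (simp add: second_ff_W_def met_W algebra_simps)
      then show "S.met p (T_tensor W V \<phi> U U p) h = S.met p (S.met p (U p) (U p) *\<^sub>R - grad_W p) h"
        unfolding T_tensor_W[OF Z(1,2,3,3) h] P.W.metric.simps(5,7) grad_W by simp
    qed
  qed
qed

text \<open>An orthonormal frame of the product need not split along the factors. The squared
  coefficients against an orthonormal basis \<open>b\<close> of the first vertical space are summed
  in both orders, with Parseval each time; the second trace is the rest of the total
  dimension.\<close>

lemma partial_trace:
  assumes e: "\<And>i. i < dim (S.vert p) \<Longrightarrow> e i \<in> S.vert p"
    and on: "\<And>i j. i < dim (S.vert p) \<Longrightarrow> j < dim (S.vert p) \<Longrightarrow> S.met p (e i) (e j) = (if i = j then 1 else 0)"
  shows "(\<Sum>i<dim (S.vert p). met1 p (e i) (e i)) = dim (A.vert (fst p))"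
    and "(\<Sum>i<dim (S.vert p). fsq p * met2 p (e i) (e i)) = dim (B.vert (snd p))"
proof -
  let ?m = "dim (S.vert p)" and ?n = "dim (A.vert (fst p))" and ?g = "A.met (fst p)"
  have dim: "?m = ?n + dim (B.vert (snd p))"
    unfolding vert_W by (rule dim_Times[OF A.subspace_vert B.subspace_vert])
  obtain b where b: "\<And>j. j < ?n \<Longrightarrow> b j \<in> A.vert (fst p)"
    "\<And>i j. i < ?n \<Longrightarrow> j < ?n \<Longrightarrow> ?g (b i) (b j) = (if i = j then 1 else 0)"
    using A.M.metric.orthonormal_basis_exists[OF A.subspace_vert] by metis
  have 1: "(\<Sum>i<?m. (?g (b j) (fst (e i)))\<^sup>2) = 1" if j: "j < ?n" for j
  proof -
    have "(b j, 0) \<in> S.vert p" using b(1)[OF j] subspace_0[OF B.subspace_vert] by (simp add: vert_W)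
    from P.W.metric.parseval[OF S.subspace_vert e on this]
    show ?thesis using b(2)[OF j j] by (simp add: met_W B.M.metric.simps)
  qed
  have 2: "(\<Sum>j<?n. (?g (b j) (fst (e i)))\<^sup>2) = ?g (fst (e i)) (fst (e i))" if i: "i < ?m" for i
  proof -
    have "fst (e i) \<in> A.vert (fst p)" using e[OF i] by (auto simp: vert_W)
    from A.M.metric.parseval[OF A.subspace_vert b this] show ?thesis
      by (simp add: A.M.sym_metric[of _ "fst (e i)" "b _"])
  qed
  have "(\<Sum>i<?m. ?g (fst (e i)) (fst (e i))) = (\<Sum>i<?m. \<Sum>j<?n. (?g (b j) (fst (e i)))\<^sup>2)"
    by (simp add: 2)
  also have "\<dots> = (\<Sum>j<?n. \<Sum>i<?m. (?g (b j) (fst (e i)))\<^sup>2)" by (rule sum.swap)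
  also have "\<dots> = ?n" by (simp add: 1)
  finally show first: "(\<Sum>i<?m. ?g (fst (e i)) (fst (e i))) = ?n" .
  have "(\<Sum>i<?m. S.met p (e i) (e i)) = ?m" by (simp add: on)
  then show "(\<Sum>i<?m. fsq p * met2 p (e i) (e i)) = dim (B.vert (snd p))"
    using first by (simp add: met_W sum.distrib dim)
qed

text \<open>On horizontal vectors the mean curvature of the product is \<open>n1\<close> times that
  of \<open>\<phi>1\<close> minus \<open>n2\<close> times the gradient of \<open>ln f\<close>,
  divided by \<open>n1 + n2\<close>, where \<open>n1\<close> and \<open>n2\<close> are the
  dimensions of the vertical spaces. Equating it to minus the gradient cancels
  \<open>n2\<close>.\<close>

lemma umbilic_imp_fiber_cond:
  assumes um: "totally_umbilical_fibers M1 N1 \<phi>1" and tg: "totally_geodesic_fibers M2 N2 \<phi>2"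
    and mc: "\<And>p. mean_curvature W V \<phi> p = - grad_W p" and f1: "\<And>q. A.vert q \<noteq> {0}"
  shows fiber_cond
proof -
  let ?H = "mean_curvature M1 N1 \<phi>1"
  have 2: "A.second_ff q v v h = A.met q v v * A.met q (?H q) h"
    if v: "v \<in> A.vert q" and h: "h \<in> A.horiz q" for q v h
  proof -
    obtain Z U Y where Z: "open Z" "q \<in> Z" "vertical_field_on M1 N1 \<phi>1 Z U" "vertical_field_on M1 N1 \<phi>1
      Z Y" "U q = v" "Y q = v"
      by (rule A.vertical_extension_pair[OF v v])
    have "T_tensor M1 N1 \<phi>1 U U q = A.met q v v *\<^sub>R ?H q"
      using um Z unfolding totally_umbilical_fibers_def by metis
    then show ?thesis using A.T_tensor_second_ff[OF Z(1,2,3,3) h] by (simp add: Z A.M.metric.simps)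
  qed
  have 3: "B.second_ff q v v h = 0" if v: "v \<in> B.vert q" and h: "h \<in> B.horiz q" for q v h
  proof -
    obtain Z U Y where Z: "open Z" "q \<in> Z" "vertical_field_on M2 N2 \<phi>2 Z U" "vertical_field_on M2 N2 \<phi>2
      Z Y" "U q = v" "Y q = v"
      by (rule B.vertical_extension_pair[OF v v])
    have "T_tensor M2 N2 \<phi>2 U U q = 0" using tg Z unfolding totally_geodesic_fibers_def by metis
    then show ?thesis using B.T_tensor_second_ff[OF Z(1,2,3,3) h] by (simp add: Z B.M.metric.simps)
  qed
  have grad: "- grad_W p \<in> S.horiz p \<and> (\<forall>h\<in>S.horiz p. S.met p (- grad_W p) h =
     (dim (A.vert (fst p)) * A.met (fst p) (?H (fst p)) (fst h) - dim (B.vert (snd p)) * dl p h) / dim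
       (S.vert p))" for p
  proof -
    let ?n1 = "real (dim (A.vert (fst p)))" and ?n2 = "real (dim (B.vert (snd p)))" and ?m = "dim (S.vert p)"
    \<comment> \<open>The trace of \<open>T\<close> as a functional of \<open>h\<close>, divided by
      the dimension of the vertical space.\<close>
    define c where "c h = (?n1 * A.met (fst p) (?H (fst p)) (fst h) - ?n2 * dl p h) / real ?m" for h ::
      "'e1 \<times> 'e2"
    have "linear c"
      by (rule linearI) (simp_all add: c_def A.M.metric.simps linear_add[OF linear_dlnf] linear_scale[OF
        linear_dlnf]
          algebra_simps add_divide_distrib diff_divide_distrib)
    \<comment> \<open>Projecting the vector that represents \<open>c\<close> keeps its products with
      horizontal vectors and makes it horizontal, as the values of \<open>T\<close> are.\<close>
    define w where "w = S.hproj p (THE z. \<forall>w. S.met p z w = c w)"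
    have w: "w \<in> S.horiz p" "S.met p w h = c h" if "h \<in> S.horiz p" for h
      using S.hproj_horiz S.met_hproj[OF that] P.W.metric.riesz_the[OF \<open>linear c\<close>] by (simp_all add: w_def)
    have w1: "w \<in> S.horiz p" by (simp add: w_def S.hproj_horiz)
    have "mean_curvature W V \<phi> p = w"
    proof (rule S.mean_curvature_eqI[OF vertical_extension_W])
      fix Z E assume Z: "open Z" "p \<in> Z" "\<forall>i<?m. vertical_field_on W V \<phi> Z (E i)"
        and on: "\<forall>i<?m. \<forall>j<?m. S.met p (E i p) (E j p) = (if i = j then 1 else 0)"
      have v: "E i p \<in> S.vert p" if "i < ?m" for i using Z that by (auto simp: vertical_field_on_def)
      have tr: "(\<Sum>i<?m. met1 p (E i p) (E i p)) = ?n1"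
        "(\<Sum>i<?m. fsq p * met2 p (E i p) (E i p)) = ?n2"
        using partial_trace[of p "\<lambda>i. E i p"] v on by auto
      show "(1 / real ?m) *\<^sub>R (\<Sum>i<?m. T_tensor W V \<phi> (E i) (E i) p) = w"
      proof (rule S.horiz_eqI[OF _ w1])
        show "(1 / real ?m) *\<^sub>R (\<Sum>i<?m. T_tensor W V \<phi> (E i) (E i) p) \<in> S.horiz p"
          by (intro subspace_scale subspace_sum S.subspace_horiz S.T_tensor_horiz)
        fix h assume h: "h \<in> S.horiz p"
        have h': "fst h \<in> A.horiz (fst p)" "snd h \<in> B.horiz (snd p)" using h by (auto simp: horiz_W)
        have "S.met p (T_tensor W V \<phi> (E i) (E i) p) h =
          met1 p (E i p) (E i p) * A.met (fst p) (?H (fst p)) (fst h)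
          - (fsq p * met2 p (E i p) (E i p)) * dl p h" if i: "i < ?m" for i
        proof -
          have vf: "vertical_field_on W V \<phi> Z (E i)" using Z i by blast
          have "fst (E i p) \<in> A.vert (fst p)" "snd (E i p) \<in> B.vert (snd p)" using v[OF i] by (auto
            simp: vert_W)
          then show ?thesis
            by (simp add: T_tensor_W[OF Z(1,2) vf vf h] second_ff_W_def 2 3 h')
        qed
        then have "(\<Sum>i<?m. S.met p (T_tensor W V \<phi> (E i) (E i) p) h) =
          (\<Sum>i<?m. met1 p (E i p) (E i p)) * A.met (fst p) (?H (fst p)) (fst h)
          - (\<Sum>i<?m. fsq p * met2 p (E i p) (E i p)) * dl p h"
          by (simp add: sum_subtractf sum_distrib_right)
        then show "S.met p ((1 / real ?m) *\<^sub>R (\<Sum>i<?m. T_tensor W V \<phi> (E i) (E i) p)) h = S.met p w h"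
          by (simp add: P.W.metric.simps(5) P.W.metric.bilinear_sum_left tr w(2)[OF h] c_def)
      qed
    qed
    then have "- grad_W p = w" using mc by simp
    then show ?thesis using w1 w(2) by (simp add: c_def)
  qed
  show ?thesis
  proof (rule fiber_condI[OF _ _ 3])
    fix q v assume v: "v \<in> A.vert q"
    obtain q2 :: 'a2 where True by blast
    have "(v, 0) \<in> S.vert (q, q2)" using v subspace_0[OF B.subspace_vert] by (simp add: vert_W)
    \<comment> \<open>Being a mean curvature, the negative gradient is horizontal; this is where
      constancy of \<open>ln f\<close> along the fibers comes from.\<close>
    then have "S.met (q, q2) (- grad_W (q, q2)) (v, 0) = 0" using S.horiz_vert grad by blast
    then show "dlnf q v = 0" by (simp add: P.W.metric.simps grad_W)
  next
    fix q v h assume v: "v \<in> A.vert q" and h: "h \<in> A.horiz q"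
    obtain q2 :: 'a2 where True by blast
    have "(h, 0) \<in> S.horiz (q, q2)" using h subspace_0[OF B.subspace_horiz] by (simp add: horiz_W)
    then have eq: "S.met (q, q2) (- grad_W (q, q2)) (h, 0) =
       (dim (A.vert q) * A.met q (?H q) h - dim (B.vert q2) * dlnf q h) / dim (S.vert (q, q2))"
      using grad[of "(q, q2)"] by force
    have "dim (S.vert (q, q2)) = dim (A.vert q) + dim (B.vert q2)"
      using dim_Times[OF A.subspace_vert B.subspace_vert] by (simp add: vert_W)
    moreover have n: "dim (A.vert q) > 0" by (rule A.dim_vert_pos[OF f1])
    ultimately have "- dlnf q h * (real (dim (A.vert q)) + real (dim (B.vert q2)))
        = dim (A.vert q) * A.met q (?H q) h - dim (B.vert q2) * dlnf q h"
      using eq by (simp add: P.W.metric.simps grad_W field_simps)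
    \<comment> \<open>The terms with the second dimension cancel; the first dimension is positive
      and can be divided out.\<close>
    then have "real (dim (A.vert q)) * (A.met q (?H q) h + dlnf q h) = 0"
      by (simp add: algebra_simps)
    then have "A.met q (?H q) h = - dlnf q h"
      using n unfolding mult_eq_0_iff of_nat_eq_0_iff by linarith
    then show "A.second_ff q v v h = - dlnf q h * A.met q v v" using 2[OF v h] by simp
  qed
qed

end

theorem theorem3p2:
  fixes M1 :: "('a1::{t2_space,second_countable_topology}, 'e1::euclidean_space) riemannian"
    and M2 :: "('a2::{t2_space,second_countable_topology}, 'e2::euclidean_space) riemannian"
    and N1 :: "('b1::{t2_space,second_countable_topology}, 'f1::euclidean_space) riemannian"
    and N2 :: "('b2::{t2_space,second_countable_topology}, 'f2::euclidean_space) riemannian"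
    and M :: "('a1 \<times> 'a2, 'e1 \<times> 'e2) riemannian"
    and N :: "('b1 \<times> 'b2, 'f1 \<times> 'f2) riemannian"
    and f :: "'a1 \<Rightarrow> real" and \<rho> :: "'b1 \<Rightarrow> real"
    and \<phi>1 :: "'a1 \<Rightarrow> 'b1" and \<phi>2 :: "'a2 \<Rightarrow> 'b2" and \<phi> :: "'a1 \<times> 'a2 \<Rightarrow> 'b1 \<times> 'b2"
  assumes "riemannian_manifold M1" "riemannian_manifold M2"
    and "riemannian_manifold N1" "riemannian_manifold N2"
    and "smooth_function M1 f" "\<forall>p. f p > 0"
    and "smooth_function N1 \<rho>" "\<forall>q. \<rho> q > 0"
    and "M = warped_product M1 f M2" "N = warped_product N1 \<rho> N2"
    and "riemannian_map M1 N1 \<phi>1" "riemannian_map M2 N2 \<phi>2"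
    and "\<phi> = map_prod \<phi>1 \<phi>2"
    and fibers1: "\<forall>p. vertical M1 N1 \<phi>1 p \<noteq> {0}"
    and fibers2: "\<forall>p. vertical M2 N2 \<phi>2 p \<noteq> {0}"
  shows "(\<exists>g. smooth_function M g \<and> clairaut_with M N \<phi> (\<lambda>p. exp (g p))) \<longleftrightarrow>
    totally_umbilical_fibers M1 N1 \<phi>1 \<and>
    totally_geodesic_fibers M2 N2 \<phi>2 \<and>
    (\<forall>p. mean_curvature M N \<phi> p = - gradient M (\<lambda>q. ln (f (fst q))) p)"
proof -
  have "riem_mfd M1" "riem_mfd M2" "riem_mfd N1" "riem_mfd N2"
    using assms(1-4) by (auto intro: riem_mfdI)
  then interpret warped_maps M1 M2 N1 N2 f \<rho> \<phi>1 \<phi>2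
    using assms unfolding warped_maps_def riem_map_def riem_map_axioms_def warped_def warped_axioms_def by blast
  have M: "M = W" and N: "N = V" using assms by (simp_all add: P.W_def Q.W_def)
  have f1: "\<And>q. A.vert q \<noteq> {0}" and f2: "\<And>q. B.vert q \<noteq> {0}" using fibers1 fibers2 by auto
  have grad: "gradient W (\<lambda>q. ln (f (fst q))) = gradient W (\<lambda>q. lnf (fst q))"
    by (simp add: lnf_def)
  show ?thesis
    unfolding M N \<open>\<phi> = _\<close> grad
  proof
    assume "\<exists>g. smooth_function W g \<and> clairaut_with W V (map_prod \<phi>1 \<phi>2) (\<lambda>p. exp (g p))"
    then have fiber_cond using clairaut_imp_fiber_cond[OF _ _ f1 f2] by blast
    from fiber_cond_imp_umbilic[OF this f1]
    show "totally_umbilical_fibers M1 N1 \<phi>1 \<and> totally_geodesic_fibers M2 N2 \<phi>2 \<and>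
      (\<forall>p. mean_curvature W V (map_prod \<phi>1 \<phi>2) p = - grad_W p)" by blast
  next
    assume "totally_umbilical_fibers M1 N1 \<phi>1 \<and> totally_geodesic_fibers M2 N2 \<phi>2 \<and>
      (\<forall>p. mean_curvature W V (map_prod \<phi>1 \<phi>2) p = - grad_W p)"
    then have fiber_cond using umbilic_imp_fiber_cond[OF _ _ _ f1] by blast
    then show "\<exists>g. smooth_function W g \<and> clairaut_with W V (map_prod \<phi>1 \<phi>2) (\<lambda>p. exp (g p))"
      using fiber_cond_imp_clairaut smooth_lnf_W by blast
  qed
qed

end
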